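(* For every integer $m \geq 2$, the conjugator length function $\mathrm{CL}$ of the group $H_m$ satisfies $\mathrm{CL}(n) \simeq n$.
   Context: Let $F = F(a_1,\ldots,a_m)$ be the free group of rank $m$ and let $\varphi \in \mathrm{Aut}(F)$ be given by $\varphi(a_1)=a_1$ and $\varphi(a_i)=a_i a_{i-1}$ for $2\le i\le m$. Define $H_m = F\rtimes_\varphi \mathbb{Z} = \langle a_1,\ldots,a_m,s \mid s^{-1}a_i s=\varphi(a_i),\ 1\le i\le m\rangle$. For a group $G$ with a finite generating set, the conjugator length function $\mathrm{CL}:\mathbb{N}\to\mathbb{N}$ is defined as follows: $\mathrm{CL}(n)$ is the least integer $N$ such that for all words $u,v$ on the generators and their inverses that represent conjugate elements of $G$ and have total length $|u|+|v|\le n$, there is a word $w$ of length at most $N$ such that $uw=wv$ in $G$. For functions $f,g:\mathbb{N}\to\mathbb{N}$ write $f\preceq g$ if there is a constant $C>0$ such that $f(n)\le C g(Cn+C)+C$ for all $n$, and write $f\simeq g$ if $f\preceq g$ and $g\preceq f$. The conjugator length functions of $G$ with respect to different finite generating sets are $\simeq$-equivalent. *)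

theory Defs
  imports "HOL-Algebra.Generated_Groups"
begin

text \<open>
  A letter \<open>(x, True)\<close> stands for \<open>x\<close> and \<open>(x, False)\<close> for its formal inverse.
\<close>

type_synonym 'a word = "('a \<times> bool) list"

definition words_on :: "'a set \<Rightarrow> 'a word set" where
  "words_on X = lists (X \<times> UNIV)"

text \<open>
  Two words over \<open>X\<close> are related if they represent the same element of the group
  \<open>\<langle>X | R\<rangle>\<close>, where a pair \<open>(u, v)\<close> in \<open>R\<close> is read as the relation \<open>u = v\<close>.
\<close>

inductive_set pres_rel :: "'a set \<Rightarrow> ('a word \<times> 'a word) set \<Rightarrow> ('a word \<times> 'a word) set"
  for X :: "'a set" and R :: "('a word \<times> 'a word) set" where
  refl: "u \<in> words_on X \<Longrightarrow> (u, u) \<in> pres_rel X R"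
| sym: "(u, v) \<in> pres_rel X R \<Longrightarrow> (v, u) \<in> pres_rel X R"
| trans: "(u, v) \<in> pres_rel X R \<Longrightarrow> (v, w) \<in> pres_rel X R \<Longrightarrow> (u, w) \<in> pres_rel X R"
| append: "(u, u') \<in> pres_rel X R \<Longrightarrow> (v, v') \<in> pres_rel X R \<Longrightarrow> (u @ v, u' @ v') \<in> pres_rel X R"
| cancel: "x \<in> X \<Longrightarrow> ([(x, b), (x, \<not> b)], []) \<in> pres_rel X R"
| relation: "(u, v) \<in> R \<Longrightarrow> u \<in> words_on X \<Longrightarrow> v \<in> words_on X \<Longrightarrow> (u, v) \<in> pres_rel X R"

definition pres_class :: "'a set \<Rightarrow> ('a word \<times> 'a word) set \<Rightarrow> 'a word \<Rightarrow> 'a word set" where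
  "pres_class X R u = pres_rel X R `` {u}"

definition presented_group :: "'a set \<Rightarrow> ('a word \<times> 'a word) set \<Rightarrow> 'a word set monoid" where
  "presented_group X R =
     \<lparr>carrier = words_on X // pres_rel X R,
      mult = (\<lambda>A B. \<Union>a\<in>A. \<Union>b\<in>B. pres_class X R (a @ b)),
      one = pres_class X R []\<rparr>"

lemma words_on_append [simp]:
  "u @ v \<in> words_on X \<longleftrightarrow> u \<in> words_on X \<and> v \<in> words_on X"
  by (auto simp: words_on_def)

lemma words_on_Nil [simp]: "[] \<in> words_on X"
  by (simp add: words_on_def)

lemma words_on_Cons [simp]: "l # u \<in> words_on X \<longleftrightarrow> fst l \<in> X \<and> u \<in> words_on X"
  by (cases l) (auto simp: words_on_def)

lemma pres_rel_words_on:
  "(u, v) \<in> pres_rel X R \<Longrightarrow> u \<in> words_on X \<and> v \<in> words_on X"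
  by (induction rule: pres_rel.induct) auto

lemma equiv_pres_rel: "equiv (words_on X) (pres_rel X R)"
proof (rule equivI)
  show "pres_rel X R \<subseteq> words_on X \<times> words_on X"
    by (auto dest: pres_rel_words_on)
  show "refl_on (words_on X) (pres_rel X R)"
    by (auto intro!: refl_onI pres_rel.refl)
  show "sym (pres_rel X R)"
    by (auto intro!: symI pres_rel.sym)
  show "trans (pres_rel X R)"
    by (auto intro!: transI intro: pres_rel.trans)
qed

lemma pres_class_eq_iff:
  assumes "u \<in> words_on X" "v \<in> words_on X"
  shows "pres_class X R u = pres_class X R v \<longleftrightarrow> (u, v) \<in> pres_rel X R"
  using eq_equiv_class_iff[OF equiv_pres_rel assms] by (simp add: pres_class_def)

lemma carrier_presented_group:
  "carrier (presented_group X R) = pres_class X R ` words_on X"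
  by (auto simp: presented_group_def quotient_def pres_class_def)

lemma one_presented_group: "\<one>\<^bsub>presented_group X R\<^esub> = pres_class X R []"
  by (simp add: presented_group_def)

lemma mult_presented_group:
  assumes "u \<in> words_on X" "v \<in> words_on X"
  shows "pres_class X R u \<otimes>\<^bsub>presented_group X R\<^esub> pres_class X R v = pres_class X R (u @ v)"
proof -
  have "pres_class X R (a @ b) = pres_class X R (u @ v)"
    if "a \<in> pres_class X R u" "b \<in> pres_class X R v" for a b
  proof -
    have "(u @ v, a @ b) \<in> pres_rel X R"
      using that by (auto simp: pres_class_def intro: pres_rel.append)
    then show ?thesis
      using pres_class_eq_iff pres_rel_words_on by metis
  qed
  moreover have "u \<in> pres_class X R u" "v \<in> pres_class X R v"
    using assms by (auto simp: pres_class_def intro: pres_rel.refl)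
  ultimately have "(\<Union>a\<in>pres_class X R u. \<Union>b\<in>pres_class X R v. pres_class X R (a @ b))
      = pres_class X R (u @ v)"
    by (safe; blast)
  then show ?thesis
    by (simp add: presented_group_def)
qed

definition inv_word :: "'a word \<Rightarrow> 'a word" where
  "inv_word u = rev (map (\<lambda>(x, b). (x, \<not> b)) u)"

lemma inv_word_words_on: "u \<in> words_on X \<Longrightarrow> inv_word u \<in> words_on X"
  by (induction u) (auto simp: inv_word_def)

lemma inv_word_cancel: "u \<in> words_on X \<Longrightarrow> (inv_word u @ u, []) \<in> pres_rel X R"
proof (induction u)
  case Nil
  then show ?case by (auto simp: inv_word_def intro: pres_rel.refl)
next
  case (Cons l u)
  obtain x b where l: "l = (x, b)" by (cases l)
  have u: "x \<in> X" "u \<in> words_on X"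
    using Cons.prems l by auto
  have "([(x, \<not> b), (x, b)], []) \<in> pres_rel X R"
    using pres_rel.cancel[OF u(1), of "\<not> b"] by simp
  from pres_rel.append[OF this pres_rel.refl[OF u(2)]]
  have "([(x, \<not> b), (x, b)] @ u, [] @ u) \<in> pres_rel X R" .
  from pres_rel.append[OF pres_rel.refl[OF inv_word_words_on[OF u(2)]] this]
  have "(inv_word u @ ([(x, \<not> b), (x, b)] @ u), inv_word u @ ([] @ u)) \<in> pres_rel X R" .
  then have "(inv_word (l # u) @ (l # u), inv_word u @ u) \<in> pres_rel X R"
    by (simp add: inv_word_def l)
  then show ?case
    using Cons.IH u pres_rel.trans by blast
qed

lemma group_presented_group: "group (presented_group X R)"
proof (rule groupI)
  fix x assume "x \<in> carrier (presented_group X R)"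
  then obtain u where u: "u \<in> words_on X" "x = pres_class X R u"
    by (auto simp: carrier_presented_group)
  have "pres_class X R (inv_word u) \<otimes>\<^bsub>presented_group X R\<^esub> x = \<one>\<^bsub>presented_group X R\<^esub>"
    using u inv_word_words_on[OF u(1)] inv_word_cancel[OF u(1)]
    by (simp add: mult_presented_group one_presented_group pres_class_eq_iff)
  then show "\<exists>y\<in>carrier (presented_group X R).
      y \<otimes>\<^bsub>presented_group X R\<^esub> x = \<one>\<^bsub>presented_group X R\<^esub>"
    using inv_word_words_on[OF u(1)] by (auto simp: carrier_presented_group)
qed (auto simp: carrier_presented_group one_presented_group mult_presented_group)

fun word_val :: "('g, 'c) monoid_scheme \<Rightarrow> 'g word \<Rightarrow> 'g" where
  "word_val G [] = \<one>\<^bsub>G\<^esub>"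
| "word_val G ((g, b) # u) = (if b then g else inv\<^bsub>G\<^esub> g) \<otimes>\<^bsub>G\<^esub> word_val G u"

definition conjugate :: "('g, 'c) monoid_scheme \<Rightarrow> 'g \<Rightarrow> 'g \<Rightarrow> bool" where
  "conjugate G x y \<longleftrightarrow> (\<exists>g\<in>carrier G. y = inv\<^bsub>G\<^esub> g \<otimes>\<^bsub>G\<^esub> x \<otimes>\<^bsub>G\<^esub> g)"

definition conj_bound :: "('g, 'c) monoid_scheme \<Rightarrow> 'g set \<Rightarrow> nat \<Rightarrow> nat \<Rightarrow> bool" where
  "conj_bound G S n N \<longleftrightarrow>
     (\<forall>u\<in>words_on S. \<forall>v\<in>words_on S.
        conjugate G (word_val G u) (word_val G v) \<and> length u + length v \<le> n \<longrightarrow>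
        (\<exists>w\<in>words_on S. length w \<le> N \<and>
           word_val G u \<otimes>\<^bsub>G\<^esub> word_val G w = word_val G w \<otimes>\<^bsub>G\<^esub> word_val G v))"

definition CL :: "('g, 'c) monoid_scheme \<Rightarrow> 'g set \<Rightarrow> nat \<Rightarrow> nat" where
  "CL G S n = (LEAST N. conj_bound G S n N)"

definition finite_generating_set :: "('g, 'c) monoid_scheme \<Rightarrow> 'g set \<Rightarrow> bool" where
  "finite_generating_set G S \<longleftrightarrow> finite S \<and> S \<subseteq> carrier G \<and> generate G S = carrier G"

lemma (in group) word_val_closed:
  "S \<subseteq> carrier G \<Longrightarrow> u \<in> words_on S \<Longrightarrow> word_val G u \<in> carrier G"
  by (induction u) auto

lemma (in group) word_val_append:
  assumes "S \<subseteq> carrier G" "u \<in> words_on S" "v \<in> words_on S"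
  shows "word_val G (u @ v) = word_val G u \<otimes> word_val G v"
  using assms
proof (induction u)
  case Nil
  then show ?case by (simp add: word_val_closed)
next
  case (Cons l u)
  obtain x b where l: "l = (x, b)" by (cases l)
  have "x \<in> carrier G" "word_val G u \<in> carrier G" "word_val G v \<in> carrier G"
    using Cons.prems l word_val_closed[of S] by auto
  then show ?case
    using Cons l by (auto simp: m_assoc)
qed

lemma (in group) generate_word_val:
  assumes "S \<subseteq> carrier G" "g \<in> generate G S"
  shows "\<exists>w\<in>words_on S. word_val G w = g"
  using assms(2)
proof induction
  case one
  show ?case by (rule bexI[of _ "[]"]) auto
next
  case (incl h)
  then show ?case using assms(1) by (intro bexI[of _ "[(h, True)]"]) auto
next
  case (inv h)
  then show ?case using assms(1) by (intro bexI[of _ "[(h, False)]"]) auto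
next
  case (eng h1 h2)
  then obtain w1 w2 where "w1 \<in> words_on S" "word_val G w1 = h1"
      "w2 \<in> words_on S" "word_val G w2 = h2"
    by blast
  then show ?case
    using assms(1) by (intro bexI[of _ "w1 @ w2"]) (auto simp: word_val_append)
qed

text \<open>The minimum in the definition of the conjugator length function exists.\<close>

lemma (in group) conj_bound_CL:
  assumes "finite_generating_set G S"
  shows "conj_bound G S n (CL G S n)"
proof -
  have S: "finite S" "S \<subseteq> carrier G" "generate G S = carrier G"
    using assms by (auto simp: finite_generating_set_def)
  let ?W = "{u \<in> words_on S. length u \<le> n}"
  let ?P = "\<lambda>u v w. w \<in> words_on S \<and> word_val G u \<otimes> word_val G w = word_val G w \<otimes> word_val G v"
  have "finite {u. set u \<subseteq> S \<times> (UNIV :: bool set) \<and> length u \<le> n}"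
    using S by (intro finite_lists_length_le) auto
  then have fin: "finite (?W \<times> ?W)"
    by (auto simp: words_on_def lists_eq_set)
  define f where "f = (\<lambda>(u, v). length (SOME w. ?P u v w))"
  have "conj_bound G S n (\<Sum>p\<in>?W \<times> ?W. f p)"
    unfolding conj_bound_def
  proof (intro ballI impI, elim conjE)
    fix u v assume uv: "u \<in> words_on S" "v \<in> words_on S" "length u + length v \<le> n"
      and "conjugate G (word_val G u) (word_val G v)"
    then obtain g where g: "g \<in> carrier G" "word_val G v = inv g \<otimes> word_val G u \<otimes> g"
      by (auto simp: conjugate_def)
    have u: "word_val G u \<in> carrier G"
      using S(2) uv(1) by (rule word_val_closed)
    obtain w where w: "w \<in> words_on S" "word_val G w = g"
      using g(1) generate_word_val[OF S(2)] S(3) by blast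
    have "g \<otimes> (inv g \<otimes> word_val G u \<otimes> g) = word_val G u \<otimes> g"
      using g(1) u by (simp add: m_assoc[symmetric])
    then have "?P u v w"
      using g w by simp
    then have "?P u v (SOME w. ?P u v w)"
      by (rule someI)
    moreover have "f (u, v) \<le> (\<Sum>p\<in>?W \<times> ?W. f p)"
      using uv fin by (intro member_le_sum) auto
    ultimately show "\<exists>w\<in>words_on S. length w \<le> (\<Sum>p\<in>?W \<times> ?W. f p) \<and>
        word_val G u \<otimes> word_val G w = word_val G w \<otimes> word_val G v"
      by (auto simp: f_def)
  qed
  then show ?thesis
    unfolding CL_def by (rule LeastI)
qed

definition preceq :: "(nat \<Rightarrow> nat) \<Rightarrow> (nat \<Rightarrow> nat) \<Rightarrow> bool"  (infix "\<preceq>" 50) where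
  "f \<preceq> g \<longleftrightarrow> (\<exists>C>0. \<forall>n. f n \<le> C * g (C * n + C) + C)"

definition simeq :: "(nat \<Rightarrow> nat) \<Rightarrow> (nat \<Rightarrow> nat) \<Rightarrow> bool"  (infix "\<simeq>" 50) where
  "f \<simeq> g \<longleftrightarrow> f \<preceq> g \<and> g \<preceq> f"

datatype gen = Gen nat | Stable

text \<open>
  \<open>Gen i\<close> is the free generator \<open>a\<^sub>i\<close> of \<open>F\<close> and \<open>Stable\<close> is
  the stable letter \<open>s\<close> of the presentation of \<open>F \<rtimes> \<int>\<close>; \<open>phi i\<close> is the word for the image
  of \<open>a\<^sub>i\<close> under the automorphism.
\<close>

definition gens :: "nat \<Rightarrow> gen set" where
  "gens m = Gen ` {1..m} \<union> {Stable}"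

definition phi :: "nat \<Rightarrow> gen word" where
  "phi i = (if i = 1 then [(Gen 1, True)] else [(Gen i, True), (Gen (i - 1), True)])"

definition H_relations :: "nat \<Rightarrow> (gen word \<times> gen word) set" where
  "H_relations m = {([(Stable, False), (Gen i, True), (Stable, True)], phi i) | i. 1 \<le> i \<and> i \<le> m}"

definition H :: "nat \<Rightarrow> gen word set monoid" where
  "H m = presented_group (gens m) (H_relations m)"

definition H_gens :: "nat \<Rightarrow> gen word set set" where
  "H_gens m = (\<lambda>x. pres_class (gens m) (H_relations m) [(x, True)]) ` gens m"

lemma group_H: "group (H m)"
  by (simp add: H_def group_presented_group)

lemma finite_generating_set_H_gens: "finite_generating_set (H m) (H_gens m)"
proof -
  interpret group "H m" by (rule group_H)
  let ?c = "pres_class (gens m) (H_relations m)"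
  have sub: "H_gens m \<subseteq> carrier (H m)"
    by (auto simp: H_gens_def H_def carrier_presented_group)
  have letter: "?c [(x, b)] \<in> generate (H m) (H_gens m)" if x: "x \<in> gens m" for x b
  proof (cases b)
    case True
    then show ?thesis using x by (auto simp: H_gens_def intro: generate.incl)
  next
    case False
    have "([(x, False), (x, \<not> False)], []) \<in> pres_rel (gens m) (H_relations m)"
      using x by (rule pres_rel.cancel)
    then have "?c [(x, False)] \<otimes>\<^bsub>H m\<^esub> ?c [(x, True)] = \<one>\<^bsub>H m\<^esub>"
      using x by (simp add: H_def mult_presented_group one_presented_group pres_class_eq_iff)
    then have "inv\<^bsub>H m\<^esub> (?c [(x, True)]) = ?c [(x, False)]"
      using x by (intro inv_equality) (auto simp: H_def carrier_presented_group)
    moreover have "?c [(x, True)] \<in> H_gens m"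
      using x by (auto simp: H_gens_def)
    ultimately show ?thesis
      using False generate.inv by metis
  qed
  have "?c u \<in> generate (H m) (H_gens m)" if "u \<in> words_on (gens m)" for u
    using that
  proof (induction u)
    case Nil
    then show ?case
      using generate.one[of "H m" "H_gens m"] by (simp add: H_def one_presented_group)
  next
    case (Cons l u)
    obtain x b where l: "l = (x, b)" by (cases l)
    have "?c (l # u) = ?c [(x, b)] \<otimes>\<^bsub>H m\<^esub> ?c u"
      using Cons.prems l by (simp add: H_def mult_presented_group)
    then show ?case
      using Cons l letter generate.eng by fastforce
  qed
  then have "carrier (H m) \<subseteq> generate (H m) (H_gens m)"
    by (auto simp: H_def carrier_presented_group)
  moreover have "finite (H_gens m)"
    by (simp add: H_gens_def gens_def)
  ultimately show ?thesis
    using sub generate_in_carrier[OF sub] by (auto simp: finite_generating_set_def)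
qed

end

theory Submission
  imports Defs
begin

text \<open>
  Write \<open>s\<^sub>i = s a\<^sub>i\<^sup>-\<^sup>1\<close> and \<open>s\<^sub>0 = s\<close>. The relation for \<open>a\<^sub>i\<close> says
  \<open>a\<^sub>i\<^sup>-\<^sup>1 s a\<^sub>i = s\<^sub>i\<^sub>-\<^sub>1\<close>, so \<open>\<langle>a\<^sub>1, \<dots>, a\<^sub>i, s\<rangle>\<close> is an HNN extension of
  \<open>\<langle>a\<^sub>1, \<dots>, a\<^sub>i\<^sub>-\<^sub>1, s\<rangle>\<close> with cyclic edge groups \<open>\<langle>s\<rangle>\<close> and \<open>\<langle>s\<^sub>i\<^sub>-\<^sub>1\<rangle>\<close>. Counting \<open>s\<close> shows that
  these are undistorted, so that Britton reduction costs only a constant factor. By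
  induction on \<open>i\<close> one proves two things: for \<open>c, d \<in> {s, s\<^sub>i}\<close> either \<open>c g = g d\<close> or
  \<open>\<bar>j\<bar>\<close> is linearly bounded by the lengths of \<open>g\<close> and \<open>c\<^sup>-\<^sup>j g d\<^sup>j\<close>; and conjugate elements have
  a conjugator of linear length. In the second statement, Collins' lemma leaves as only
  unknown a power \<open>c\<^sup>p\<close> of an edge generator, which the first statement either bounds or shows
  to be superfluous. Britton's lemma comes from the normal form in \<open>F \<rtimes> \<int>\<close>.

  The lower bound is attained by \<open>a\<^sub>m\<close> and \<open>s\<^sup>-\<^sup>j a\<^sub>m s\<^sup>j\<close>: in a Heisenberg quotient one sees that
  every conjugator has \<open>s\<close>-exponent \<open>j\<close>.
\<close>

section \<open>Groups and word length\<close>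

text \<open>In the Bass-Serre tree of such an extension \<open>s\<close> fixes arbitrarily long
  paths: already at the second level it commutes with both \<open>a_1\<close> and
  \<open>a_2 a_1 a_2^-1\<close>. So the action is not acylindrical, and no count of edges bounds the
  edge power left open by Collins' lemma. That is why a divergence statement is carried up the tower
  along with the conjugacy statement. Tracing an edge power along a path could multiply constants at
  every letter. It does not, because the \<open>s\<close>-exponent is 1 on every edge generator: the
  powers met along a path differ only by the length of the data, and a single place of divergence
  bounds all of them. For the pairs from \<open>{s, s_i}\<close> the reasons differ:
  \<open>(s, s)\<close> is inherited through the tree, \<open>(s, s_i)\<close> is separated by the
  exponent of \<open>a_i\<close>, and \<open>s_i\<close> translates along an axis of the new tree,
  where an element carrying a long stretch of this axis back into it, in the same direction, is a
  power of \<open>s_i\<close>. The last point uses that the two edge groups meet trivially, so the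
  tower starts from \<open><a_1, s>\<close>, free abelian of rank 2: one level lower both edge
  generators are \<open>s\<close>.\<close>

class grp = monoid_mult + inverse +
  assumes grp_left_inverse [simp]: "inverse x * x = 1"
begin

lemma grp_left_inverse_assoc [simp]: "inverse x * (x * y) = y"
  by (simp add: mult_assoc[symmetric])

lemma grp_right_inverse [simp]: "x * inverse x = 1"
proof -
  have "x * inverse x = inverse (inverse x) * (inverse x * x) * inverse x"
    by (simp only: mult_assoc grp_left_inverse_assoc)
  then show ?thesis
    by simp
qed

lemma grp_right_inverse_assoc [simp]: "x * (inverse x * y) = y"
  by (simp add: mult_assoc[symmetric])

lemma grp_left_cancel [simp]: "x * y = x * z \<longleftrightarrow> y = z"
  by (metis grp_left_inverse_assoc)

lemma grp_right_cancel [simp]: "y * x = z * x \<longleftrightarrow> y = z"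
  by (metis grp_right_inverse mult_assoc mult_1_right)

lemma grp_inverse_unique: "x * y = 1 \<Longrightarrow> inverse x = y"
  by (metis grp_left_inverse_assoc mult_1_right)

lemma grp_inverse_inverse [simp]: "inverse (inverse x) = x"
  by (rule grp_inverse_unique) simp

lemma grp_inverse_one [simp]: "inverse 1 = 1"
  by (rule grp_inverse_unique) simp

lemma grp_inverse_mult [simp]: "inverse (x * y) = inverse y * inverse x"
  by (rule grp_inverse_unique) (simp add: mult_assoc)

lemma grp_eq_inverse_mult: "x = inverse y * z \<longleftrightarrow> y * x = z"
  by (metis grp_left_inverse_assoc grp_right_inverse_assoc)

lemma grp_eq_mult_inverse: "x = z * inverse y \<longleftrightarrow> x * y = z"
  by (metis grp_left_inverse grp_right_inverse mult_assoc mult_1_right)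

end

lemma powi_Suc: "x powi (p + 1) = x powi p * x" for x :: "'a::grp"
proof (cases p rule: int_cases2)
  case (nonneg n)
  have "x powi (int n + 1) = x ^ Suc n"
    by (metis of_nat_Suc add.commute power_int_of_nat)
  then show ?thesis
    by (simp add: nonneg power_commutes)
next
  case (nonpos n)
  show ?thesis
  proof (cases n)
    case 0
    then show ?thesis by (simp add: nonpos)
  next
    case (Suc k)
    have "x powi (- int k) = inverse x ^ k" "x powi (- int (Suc k)) = inverse x ^ Suc k"
      by (simp_all add: power_int_def nat_add_distrib)
    moreover have p: "p + 1 = - int k" "p = - int (Suc k)"
      using Suc nonpos by auto
    ultimately have "x powi (p + 1) = inverse x ^ k" "x powi p = inverse x ^ k * inverse x"
      by (simp_all only: p power_Suc2)
    then show ?thesis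
      by (simp add: mult.assoc)
  qed
qed

lemma powi_add: "x powi (p + q) = x powi p * x powi q" for x :: "'a::grp"
proof (induction q rule: int_induct[where k = 0])
  case (step1 i)
  then show ?case
    using powi_Suc[of x "p + i"] powi_Suc[of x i] by (simp add: add.assoc mult.assoc)
next
  case (step2 i)
  have "x powi (p + (i - 1)) * x = x powi p * x powi (i - 1) * x"
    using step2 powi_Suc[of x "p + (i - 1)"] powi_Suc[of x "i - 1"]
    by (simp add: algebra_simps mult.assoc)
  then show ?case by simp
qed simp

lemma powi_minus: "x powi (- p) = inverse (x powi p)" for x :: "'a::grp"
  by (rule grp_inverse_unique[symmetric]) (simp add: powi_add[symmetric])

lemma powi_diff: "x powi (p - q) = x powi p * inverse (x powi q)" for x :: "'a::grp"
  using powi_add[of x p "- q"] by (simp add: powi_minus)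

lemma powi_conj: "x * z = z * y \<Longrightarrow> x powi p * z = z * y powi p" for x y z :: "'a::grp"
proof (induction p rule: int_induct[where k = 0])
  case (step1 i)
  then show ?case
    by (metis powi_Suc mult.assoc)
next
  case (step2 i)
  have "x powi (i - 1) * z * y = x powi (i - 1) * x * z"
    by (simp add: step2.prems mult.assoc)
  also have "\<dots> = z * y powi (i - 1) * y"
    using step2 powi_Suc[of x "i - 1"] powi_Suc[of y "i - 1"] by (simp add: mult.assoc)
  finally show ?case by simp
qed simp

section \<open>Word length and generated subgroups\<close>

inductive word_length :: "'g::grp set \<Rightarrow> nat \<Rightarrow> 'g \<Rightarrow> bool" for Y where
  one: "word_length Y 0 1"
| gen: "y \<in> Y \<Longrightarrow> word_length Y n g \<Longrightarrow> word_length Y (Suc n) (y * g)"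
| inv: "y \<in> Y \<Longrightarrow> word_length Y n g \<Longrightarrow> word_length Y (Suc n) (inverse y * g)"

definition span :: "'g::grp set \<Rightarrow> 'g set" where
  "span Y = {g. \<exists>n. word_length Y n g}"

text \<open>Outside \<open>span Y\<close> the value is unspecified, which is why membership
  hypotheses accompany the estimates.\<close>

definition len :: "'g::grp set \<Rightarrow> 'g \<Rightarrow> nat" where
  "len Y g = (LEAST n. word_length Y n g)"

lemma word_length_mult:
  "word_length Y n g \<Longrightarrow> word_length Y k h \<Longrightarrow> word_length Y (n + k) (g * h)"
  by (induction rule: word_length.induct) (auto simp: mult.assoc intro: word_length.intros)

lemma word_length_gen: "y \<in> Y \<Longrightarrow> word_length Y 1 y"
  using word_length.gen[OF _ word_length.one] by fastforce

lemma word_length_gen_inverse: "y \<in> Y \<Longrightarrow> word_length Y 1 (inverse y)"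
  using word_length.inv[OF _ word_length.one] by fastforce

lemma word_length_inverse: "word_length Y n g \<Longrightarrow> word_length Y n (inverse g)"
proof (induction rule: word_length.induct)
  case (gen y n g)
  then show ?case
    using word_length_mult[OF gen.IH word_length_gen_inverse[OF gen.hyps(1)]] by simp
next
  case (inv y n g)
  then show ?case
    using word_length_mult[OF inv.IH word_length_gen[OF inv.hyps(1)]] by simp
qed (auto intro: word_length.intros)

lemma word_length_len: "g \<in> span Y \<Longrightarrow> word_length Y (len Y g) g"
  unfolding span_def len_def by (auto intro: LeastI)

lemma len_le: "word_length Y n g \<Longrightarrow> len Y g \<le> n"
  unfolding len_def by (rule Least_le)

lemma span_one [simp, intro]: "1 \<in> span Y"
  by (auto simp: span_def intro: word_length.one)

lemma span_gen [simp, intro]: "y \<in> Y \<Longrightarrow> y \<in> span Y"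
  by (auto simp: span_def intro: word_length_gen)

lemma span_mult [simp, intro]: "g \<in> span Y \<Longrightarrow> h \<in> span Y \<Longrightarrow> g * h \<in> span Y"
  by (auto simp: span_def intro: word_length_mult)

lemma span_inverse [simp, intro]: "g \<in> span Y \<Longrightarrow> inverse g \<in> span Y"
  by (auto simp: span_def intro: word_length_inverse)

lemma span_power [simp, intro]: "g \<in> span Y \<Longrightarrow> g ^ n \<in> span Y"
  by (induction n) auto

lemma span_powi [simp, intro]: "g \<in> span Y \<Longrightarrow> g powi p \<in> span Y"
  by (simp add: power_int_def)

lemma span_induct [consumes 1, case_names one gen inv]:
  assumes "g \<in> span Y" "P 1"
    and "\<And>y g. y \<in> Y \<Longrightarrow> g \<in> span Y \<Longrightarrow> P g \<Longrightarrow> P (y * g)"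
    and "\<And>y g. y \<in> Y \<Longrightarrow> g \<in> span Y \<Longrightarrow> P g \<Longrightarrow> P (inverse y * g)"
  shows "P g"
proof -
  obtain n where "word_length Y n g"
    using assms(1) by (auto simp: span_def)
  then show ?thesis
  proof (induction rule: word_length.induct)
    case (gen y n g)
    then show ?case using assms(3)[of y g] by (auto simp: span_def)
  next
    case (inv y n g)
    then show ?case using assms(4)[of y g] by (auto simp: span_def)
  qed (fact assms(2))
qed

lemma span_commute:
  assumes "\<And>y. y \<in> Y \<Longrightarrow> y * x = x * y" "g \<in> span Y"
  shows "g * x = x * g"
  using assms(2)
proof (induction rule: span_induct)
  case (gen y g)
  have "y * g * x = y * x * g"
    using gen.IH by (simp add: mult.assoc)
  then show ?case
    using assms(1)[OF gen.hyps(1)] by (simp add: mult.assoc)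
next
  case (inv y g)
  have "inverse y * x = x * inverse y"
    using powi_conj[OF assms(1)[OF inv.hyps(1)], of "- 1"] by (simp add: powi_minus)
  moreover have "inverse y * g * x = inverse y * x * g"
    using inv.IH by (simp add: mult.assoc)
  ultimately show ?case by (simp add: mult.assoc)
qed simp

lemma span_subset: "Y \<subseteq> span Z \<Longrightarrow> span Y \<subseteq> span Z"
proof
  fix g assume "Y \<subseteq> span Z" "g \<in> span Y"
  from this(2,1) show "g \<in> span Z"
    by (induction rule: span_induct) auto
qed

lemma span_mono: "Y \<subseteq> Z \<Longrightarrow> span Y \<subseteq> span Z"
  by (rule span_subset) auto

lemma word_length_scale:
  assumes "word_length Y n g" and "\<And>y. y \<in> Y \<Longrightarrow> y \<in> span Z \<and> len Z y \<le> b"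
  shows "\<exists>k \<le> b * n. word_length Z k g"
  using assms(1)
proof (induction rule: word_length.induct)
  case one
  show ?case by (auto intro: word_length.one)
next
  case (gen y n g)
  then obtain k where "k \<le> b * n" "word_length Z k g" by blast
  moreover have "word_length Z (len Z y) y" "len Z y \<le> b"
    using assms(2)[OF gen.hyps(1)] by (auto intro: word_length_len)
  ultimately show ?case
    by (intro exI[of _ "len Z y + k"]) (auto intro: word_length_mult)
next
  case (inv y n g)
  then obtain k where "k \<le> b * n" "word_length Z k g" by blast
  moreover have "word_length Z (len Z y) (inverse y)" "len Z y \<le> b"
    using assms(2)[OF inv.hyps(1)] by (auto intro: word_length_len word_length_inverse)
  ultimately show ?case
    by (intro exI[of _ "len Z y + k"]) (auto intro: word_length_mult)
qed

lemma len_scale: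
  assumes "g \<in> span Y" and "\<And>y. y \<in> Y \<Longrightarrow> y \<in> span Z \<and> len Z y \<le> b"
  shows "len Z g \<le> b * len Y g"
  using word_length_scale[OF word_length_len[OF assms(1)] assms(2)] len_le le_trans by blast

lemma len_one [simp]: "len Y 1 = 0"
  using len_le[OF word_length.one] by simp

lemma len_eq_0: "g \<in> span Y \<Longrightarrow> len Y g = 0 \<Longrightarrow> g = 1"
  using word_length_len by (fastforce elim: word_length.cases)

lemma len_gen: "y \<in> Y \<Longrightarrow> len Y y \<le> 1"
  using len_le word_length_gen by blast

lemma len_mult: "g \<in> span Y \<Longrightarrow> h \<in> span Y \<Longrightarrow> len Y (g * h) \<le> len Y g + len Y h"
  by (intro len_le word_length_mult word_length_len)

lemma len_inverse [simp]: "g \<in> span Y \<Longrightarrow> len Y (inverse g) = len Y g"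
  by (metis len_le word_length_inverse word_length_len span_inverse grp_inverse_inverse le_antisym)

lemma len_power: "g \<in> span Y \<Longrightarrow> len Y (g ^ n) \<le> n * len Y g"
proof (induction n)
  case (Suc n)
  then show ?case
    using len_mult[of g Y "g ^ n"] by simp
qed simp

lemma len_powi: "g \<in> span Y \<Longrightarrow> int (len Y (g powi p)) \<le> \<bar>p\<bar> * int (len Y g)"
proof (cases p rule: int_cases2)
  case (nonneg n)
  then show "g \<in> span Y \<Longrightarrow> ?thesis"
    using len_power[of g Y n] by (simp flip: of_nat_mult)
next
  case (nonpos n)
  then show "g \<in> span Y \<Longrightarrow> ?thesis"
    using len_power[of g Y n] by (simp add: powi_minus flip: of_nat_mult)
qed

lemma len_powi_gen: "y \<in> Y \<Longrightarrow> int (len Y (y powi p)) \<le> \<bar>p\<bar>"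
proof -
  assume y: "y \<in> Y"
  have "int (len Y (y powi p)) \<le> \<bar>p\<bar> * int (len Y y)"
    using y by (intro len_powi) auto
  also have "\<dots> \<le> \<bar>p\<bar> * 1"
    using len_gen[OF y] by (intro mult_left_mono) auto
  finally show ?thesis by simp
qed

text \<open>Additivity is relative to a set because the exponent of \<open>a_i\<close> is a
  homomorphism on \<open><a_1, ..., a_i, s>\<close> but not one level higher, where conjugation of
  \<open>a_{i+1}\<close> by \<open>s\<close> changes it.\<close>

definition additive_on :: "'g::grp set \<Rightarrow> ('g \<Rightarrow> int) \<Rightarrow> bool" where
  "additive_on A f \<longleftrightarrow> (\<forall>x\<in>A. \<forall>y\<in>A. f (x * y) = f x + f y)"

lemma additive_onD: "additive_on A f \<Longrightarrow> x \<in> A \<Longrightarrow> y \<in> A \<Longrightarrow> f (x * y) = f x + f y"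
  by (simp add: additive_on_def)

lemma additive_on_one: "additive_on (span Y) f \<Longrightarrow> f 1 = 0"
  using additive_onD[of "span Y" f 1 1] by simp

lemma additive_on_inverse:
  "additive_on (span Y) f \<Longrightarrow> x \<in> span Y \<Longrightarrow> f (inverse x) = - f x"
  using additive_onD[of "span Y" f x "inverse x"] additive_on_one[of Y f] by simp

lemma additive_on_powi:
  assumes "additive_on (span Y) f" "x \<in> span Y"
  shows "f (x powi p) = p * f x"
proof (induction p rule: int_induct[where k = 0])
  case base
  then show ?case using assms by (simp add: additive_on_one)
next
  case (step1 i)
  then show ?case
    using powi_Suc[of x i] assms by (simp add: additive_onD[OF assms(1)] algebra_simps)
next
  case (step2 i)
  have "f (x powi i) = f (x powi (i - 1)) + f x"
    using powi_Suc[of x "i - 1"] assms by (simp add: additive_onD[OF assms(1)])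
  then show ?case using step2 by (simp add: algebra_simps)
qed

lemma additive_on_len:
  assumes "additive_on (span Y) f" "g \<in> span Y" and gen: "\<And>y. y \<in> Y \<Longrightarrow> \<bar>f y\<bar> \<le> int b"
  shows "\<bar>f g\<bar> \<le> int b * int (len Y g)"
proof -
  have "word_length Y n g \<Longrightarrow> g \<in> span Y \<and> \<bar>f g\<bar> \<le> int b * int n" for n g
  proof (induction rule: word_length.induct)
    case one
    then show ?case using assms(1) by (simp add: additive_on_one)
  next
    case (gen y n g)
    then have "f (y * g) = f y + f g"
      by (intro additive_onD[OF assms(1)]) auto
    then show ?case using gen assms(3)[of y] by (auto simp: algebra_simps)
  next
    case (inv y n g)
    then have "f (inverse y * g) = - f y + f g"
      using assms(1) by (simp add: additive_onD[OF assms(1)] additive_on_inverse)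
    then show ?case using inv assms(3)[of y] by (auto simp: algebra_simps)
  qed
  then show ?thesis
    using word_length_len[OF assms(2)] by blast
qed

section \<open>HNN extensions with cyclic edge groups\<close>

text \<open>The Boolean is the orientation of an edge of the Bass-Serre tree.
  \<open>edge s s' e\<close> generates the edge group that can be moved across
  \<open>stable t e\<close> from the left; it comes out on the right as
  \<open>edge s s' (\<not> e)\<close>.\<close>

definition edge :: "'g \<Rightarrow> 'g \<Rightarrow> bool \<Rightarrow> 'g" where
  "edge s s' e = (if e then s else s')"

definition stable :: "'g::grp \<Rightarrow> bool \<Rightarrow> 'g" where
  "stable t e = (if e then t else inverse t)"

definition path :: "'g::grp \<Rightarrow> (bool \<times> 'g) list \<Rightarrow> 'g" where
  "path t r = prod_list (map (\<lambda>x. stable t (fst x) * snd x) r)"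

text \<open>A pinch is \<open>t^e x t^-e\<close> with \<open>x\<close> in the group generated by
  \<open>edge s s' (\<not> e)\<close>; it collapses to a power of \<open>edge s s' e\<close>. As
  only neighbouring entries matter, reducedness becomes a \<open>successively\<close>
  condition.\<close>

definition pinch_free :: "'g::grp \<Rightarrow> 'g \<Rightarrow> bool \<times> 'g \<Rightarrow> bool \<times> 'g \<Rightarrow> bool" where
  "pinch_free s s' x y \<longleftrightarrow> fst y = fst x \<or> snd x \<notin> range (\<lambda>p. edge s s' (\<not> fst x) powi p)"

lemma path_Nil [simp]: "path t [] = 1"
  by (simp add: path_def)

lemma path_Cons [simp]: "path t (x # r) = stable t (fst x) * (snd x * path t r)"
  by (simp add: path_def mult.assoc)

lemma path_append [simp]: "path t (r @ r') = path t r * path t r'"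
  by (simp add: path_def)

lemma stable_cancel [simp]:
  "stable t (\<not> e) * stable t e = 1" "stable t e * stable t (\<not> e) = 1"
  "stable t (\<not> e) * (stable t e * x) = x" "stable t e * (stable t (\<not> e) * x) = x"
  by (simp_all add: stable_def)

lemma edge_powi_stable:
  fixes t s s' :: "'g::grp"
  assumes "s * t = t * s'"
  shows "edge s s' e powi p * stable t e = stable t e * edge s s' (\<not> e) powi p"
proof -
  have "s' * inverse t = inverse t * s"
    using assms by (metis grp_eq_inverse_mult grp_eq_mult_inverse mult.assoc)
  then have "edge s s' e * stable t e = stable t e * edge s s' (\<not> e)"
    using assms by (simp add: edge_def stable_def)
  then show ?thesis by (rule powi_conj)
qed

section \<open>The two statements carried up the tower\<close>

definition conj_bounded :: "'g::grp set \<Rightarrow> nat \<Rightarrow> bool" where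
  "conj_bounded Y C \<longleftrightarrow>
     (\<forall>g\<in>span Y. \<forall>h\<in>span Y. \<forall>z\<in>span Y. g * z = z * h \<longrightarrow>
        (\<exists>z'\<in>span Y. g * z' = z' * h \<and> len Y z' \<le> C * (len Y g + len Y h + 1)))"

text \<open>Translates of the axes of \<open>c\<close> and \<open>d\<close> are either parallel or diverge linearly.\<close>

definition axes_diverge :: "'g::grp set \<Rightarrow> 'g \<Rightarrow> 'g \<Rightarrow> nat \<Rightarrow> bool" where
  "axes_diverge Y c d C \<longleftrightarrow>
     (\<forall>g\<in>span Y. \<forall>j::int. c * g = g * d \<or>
        \<bar>j\<bar> \<le> int (C * (len Y g + len Y (inverse (c powi j) * g * d powi j))))"

text \<open>The values of \<open>f\<close> at \<open>g\<close> and at the conjugated element differ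
  by \<open>j (f y - f x)\<close>, that is by \<open>j\<close> or \<open>-j\<close>, and
  \<open>f\<close> is bounded by the length.\<close>

lemma axes_diverge_additive:
  assumes f: "additive_on (span Z) f" "\<And>z. z \<in> Z \<Longrightarrow> \<bar>f z\<bar> \<le> 1"
    and xy: "x \<in> span Z" "y \<in> span Z" "\<bar>f y - f x\<bar> = 1"
  shows "axes_diverge Z x y 1"
  unfolding axes_diverge_def
proof (intro ballI allI disjI2)
  fix g and j :: int
  assume g: "g \<in> span Z"
  define d where "d = j * (f y - f x)"
  have len: "\<bar>f h\<bar> \<le> int (len Z h)" if "h \<in> span Z" for h
    using additive_on_len[OF f(1) that, of 1] f(2) by simp
  have "f (inverse (x powi j) * g * y powi j) = f g + d"
    using xy g by (simp add: additive_onD[OF f(1)] additive_on_inverse[OF f(1)]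
      additive_on_powi[OF f(1)] d_def algebra_simps)
  moreover have "\<bar>d\<bar> = \<bar>j\<bar>"
    using xy(3) by (simp add: abs_mult d_def)
  moreover have "\<bar>f (inverse (x powi j) * g * y powi j)\<bar> \<le> int (len Z (inverse (x powi j) * g * y powi j))"
    using xy g by (intro len) simp
  ultimately show "\<bar>j\<bar> \<le> int (1 * (len Z g + len Z (inverse (x powi j) * g * y powi j)))"
    using len[OF g] by simp
qed

text \<open>\<open>britton\<close> speaks of first letters only: the tails satisfy an equation of
  the same shape, so it can be iterated. \<open>\<sigma>\<close> will be the exponent of
  \<open>s\<close> and \<open>\<tau>\<close> that of the stable letter \<open>t\<close>.
  \<open>independent\<close> says that the edge groups \<open><s>\<close> and \<open><s'>\<close>
  meet trivially.\<close>

locale hnn =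
  fixes Y :: "'g::grp set" and t s s' :: 'g and \<sigma> \<tau> :: "'g \<Rightarrow> int"
  assumes s_gen: "s \<in> Y" "s' \<in> Y"
    and rel: "s * t = t * s'"
    and sigma_additive: "additive_on UNIV \<sigma>"
    and sigma_s: "\<sigma> s = 1" "\<sigma> s' = 1" and sigma_t: "\<sigma> t = 0"
    and sigma_gen: "y \<in> Y \<Longrightarrow> \<bar>\<sigma> y\<bar> \<le> 1"
    and tau_additive: "additive_on (span (insert t (insert (s * inverse t) Y))) \<tau>"
    and tau_t: "\<tau> t = 1"
    and tau_gen: "y \<in> Y \<Longrightarrow> \<tau> y = 0"
    and independent: "s powi p = s' powi q \<Longrightarrow> p = 0"
    and britton:
      "\<lbrakk>successively (pinch_free s s') r; successively (pinch_free s s') r';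
        snd ` set r \<subseteq> span Y; snd ` set r' \<subseteq> span Y; g \<in> span Y; h \<in> span Y; u \<in> span Y;
        g * path t r * u = h * path t r'\<rbrakk> \<Longrightarrow>
       r = [] \<and> r' = [] \<or>
       (\<exists>e x r1 y r1' p. r = (e, x) # r1 \<and> r' = (e, y) # r1' \<and> h = g * edge s s' e powi p)"
begin

abbreviation "K \<equiv> span Y"
abbreviation "c \<equiv> edge s s'"
abbreviation "T \<equiv> stable t"
abbreviation "P \<equiv> path t"

section \<open>Britton-reduced paths and their cost\<close>

definition red :: "(bool \<times> 'g) list \<Rightarrow> bool" where
  "red r \<longleftrightarrow> successively (pinch_free s s') r \<and> snd ` set r \<subseteq> K"

text \<open>Stable letters are counted as well, so that one quantity bounds the number of edges and
  the word length in the extension.\<close>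

definition cost :: "(bool \<times> 'g) list \<Rightarrow> nat" where
  "cost r = (\<Sum>x\<leftarrow>r. 1 + len Y (snd x))"

lemma cost_simps [simp]:
  "cost [] = 0" "cost (x # r) = 1 + len Y (snd x) + cost r" "cost (r @ r') = cost r + cost r'"
  by (simp_all add: cost_def)

lemma length_le_cost: "length r \<le> cost r"
  by (induction r) auto

lemma edge_gen [simp]: "c e \<in> Y"
  using s_gen by (simp add: edge_def)

lemma edge_span [simp]: "c e \<in> K"
  by (rule span_gen) simp

lemma edge_stable: "c e powi p * T e = T e * c (\<not> e) powi p"
  using rel by (rule edge_powi_stable)

lemma edge_stable_assoc: "c e powi p * (T e * x) = T e * (c (\<not> e) powi p * x)"
  using edge_stable[of e p] by (simp add: mult.assoc[symmetric])

lemma sigma_mult: "\<sigma> (x * y) = \<sigma> x + \<sigma> y"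
  using sigma_additive by (simp add: additive_on_def)

lemma sigma_additive_span: "additive_on (span Z) \<sigma>"
  by (simp add: additive_on_def sigma_mult)

lemma sigma_inverse [simp]: "\<sigma> (inverse x) = - \<sigma> x"
  by (rule additive_on_inverse[OF sigma_additive_span, of _ "{x}"]) simp

lemma sigma_powi [simp]: "\<sigma> (x powi p) = p * \<sigma> x"
  by (rule additive_on_powi[OF sigma_additive_span, of _ "{x}"]) simp

lemma sigma_one [simp]: "\<sigma> 1 = 0"
  by (rule additive_on_one[OF sigma_additive_span])

lemma sigma_edge [simp]: "\<sigma> (c e) = 1"
  by (simp add: edge_def sigma_s)

lemma sigma_stable [simp]: "\<sigma> (T e) = 0"
  by (simp add: stable_def sigma_t)

lemma sigma_len: "g \<in> K \<Longrightarrow> \<bar>\<sigma> g\<bar> \<le> int (len Y g)"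
  using additive_on_len[OF sigma_additive_span, of g Y 1] sigma_gen by simp

lemma sigma_path: "snd ` set r \<subseteq> K \<Longrightarrow> \<bar>\<sigma> (P r)\<bar> \<le> int (cost r)"
proof (induction r)
  case (Cons x r)
  then show ?case using sigma_len[of "snd x"] by (auto simp: sigma_mult)
qed simp

lemma len_edge_powi: "int (len Y (c e powi p)) \<le> \<bar>p\<bar>"
  by (rule len_powi_gen) simp

lemma red_Nil [simp]: "red []"
  by (simp add: red_def)

lemma red_single [simp]: "red [x] \<longleftrightarrow> snd x \<in> K"
  by (simp add: red_def)

lemma red_append:
  "red (r @ r') \<longleftrightarrow> red r \<and> red r' \<and> (r = [] \<or> r' = [] \<or> pinch_free s s' (last r) (hd r'))"
  by (auto simp: red_def successively_append_iff)

lemma red_append_self: "red (r @ r) \<longleftrightarrow> red r \<and> (r = [] \<or> pinch_free s s' (last r) (hd r))"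
  unfolding red_append by blast

lemma red_Cons:
  "red (x # r) \<longleftrightarrow> snd x \<in> K \<and> red r \<and> (r = [] \<or> pinch_free s s' x (hd r))"
  using red_append[of "[x]" r] by simp

text \<open>After cancelling \<open>g t^e\<close> and moving the edge power across
  \<open>t^e\<close>, the tails satisfy an equation of the original form. This is the step of all
  inductions along paths below.\<close>

lemma britton_red:
  assumes "red r" "red r'" "g \<in> K" "h \<in> K" "u \<in> K" "g * (P r * u) = h * P r'"
  obtains "r = []" "r' = []"
  | e x r1 y r1' p where "r = (e, x) # r1" "r' = (e, y) # r1'" "h = g * c e powi p"
      "x * (P r1 * u) = c (\<not> e) powi p * (y * P r1')"
proof -
  have "r = [] \<and> r' = [] \<or>
      (\<exists>e x r1 y r1' p. r = (e, x) # r1 \<and> r' = (e, y) # r1' \<and> h = g * c e powi p)"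
    using assms by (intro britton) (auto simp: red_def mult.assoc)
  then show thesis
  proof (elim disjE exE conjE)
    fix e x r1 y r1' p
    assume eq: "r = (e, x) # r1" "r' = (e, y) # r1'" "h = g * c e powi p"
    have "x * (P r1 * u) = c (\<not> e) powi p * (y * P r1')"
      using assms(6) unfolding eq by (simp add: mult.assoc edge_stable_assoc)
    then show thesis using that(2) eq by simp
  qed (use that in auto)
qed

lemma britton_length:
  assumes "red r" "red r'" "g \<in> K" "h \<in> K" "u \<in> K" "g * (P r * u) = h * P r'"
  shows "length r = length r'"
  using assms
proof (induction r arbitrary: r' g h)
  case Nil
  from Nil.prems show ?case
    by (rule britton_red) auto
next
  case (Cons z r)
  from Cons.prems show ?case
  proof (rule britton_red)
    fix e x r1 y r1' p
    assume *: "z # r = (e, x) # r1" "r' = (e, y) # r1'"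
      "x * (P r1 * u) = c (\<not> e) powi p * (y * P r1')"
    have "length r = length r1'"
      using Cons.prems * by (intro Cons.IH[of r1' x "c (\<not> e) powi p * y"])
        (auto simp: red_Cons mult.assoc)
    then show ?thesis using * by simp
  qed simp
qed

lemma red_last_mult:
  assumes "red (r @ [(e, x)])" "u \<in> K"
  shows "red (r @ [(e, x * u)])"
  using assms by (auto simp: red_append pinch_free_def)

text \<open>The right factor is absorbed by the last vertex element, or by \<open>g\<close> if the
  path has no edge.\<close>

lemma path_mult:
  assumes "red r" "g \<in> K" "u \<in> K"
  obtains g' r' where "g' \<in> K" "red r'" "length r' = length r" "g * (P r * u) = g' * P r'"
    "len Y g' + cost r' \<le> len Y g + cost r + len Y u"
proof (cases r rule: rev_cases)
  case Nil
  then show ?thesis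
    using that[of "g * u" "[]"] assms len_mult[of g Y u] by simp
next
  case (snoc r0 x)
  have "red (r0 @ [(fst x, snd x * u)])"
    using red_last_mult[of r0 "fst x" "snd x" u] assms snoc by simp
  then show ?thesis
    using that[of g "r0 @ [(fst x, snd x * u)]"] assms snoc len_mult[of "snd x" Y u]
    by (auto simp: mult.assoc red_append)
qed

text \<open>Undistortion of the edge groups: collapsing a pinch replaces
  \<open>c (\<not> e)^p\<close> by \<open>c e^p\<close>, of length at most
  \<open>\<bar>p\<bar>\<close>, and \<open>p\<close> is the \<open>\<sigma>\<close>-value of the old
  element, hence bounded by its length. A pinch therefore never raises the cost.\<close>

lemma stable_path:
  assumes "red r" "g \<in> K"
  obtains g' r' where "g' \<in> K" "red r'" "T e * (g * P r) = g' * P r'"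
    "len Y g' + cost r' \<le> len Y g + cost r + 1"
proof (cases "r \<noteq> [] \<and> \<not> pinch_free s s' (e, g) (hd r)")
  case True
  then obtain z r1 where "r = z # r1" "fst z = (\<not> e)" "g \<in> range (\<lambda>p. c (\<not> e) powi p)"
    by (cases r) (auto simp: pinch_free_def)
  then obtain x p where r: "r = (\<not> e, x) # r1" "g = c (\<not> e) powi p"
    by (cases z) auto
  have x: "x \<in> K" "red r1"
    using assms r by (auto simp: red_Cons)
  have "T e * (g * P r) = (c e powi p * x) * P r1"
    using edge_stable_assoc[of "\<not> e" p] by (simp add: r mult.assoc)
  moreover have "int (len Y (c e powi p)) \<le> int (len Y g)"
    using len_edge_powi[of e p] sigma_len[OF assms(2)] by (simp add: r)
  then have "len Y (c e powi p * x) \<le> len Y g + len Y x"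
    using len_mult[of "c e powi p" Y x] x by simp
  ultimately show ?thesis
    using that[of "c e powi p * x" r1] x r by simp
next
  case False
  then have "red ((e, g) # r)"
    using assms by (auto simp: red_Cons)
  then show ?thesis
    using that[of 1 "(e, g) # r"] by simp
qed

text \<open>\<open>s t^-1\<close> is an edge generator of the next extension. Counting it as one
  letter keeps the length of its powers at most the exponent.\<close>

abbreviation "Y2 \<equiv> insert t (insert (s * inverse t) Y)"
abbreviation "G \<equiv> span Y2"

text \<open>The factor 2 is due to the generator \<open>s t^-1\<close>, which contributes a stable
  letter and a letter of \<open>Y\<close>.\<close>

lemma reduced_form:
  assumes "word_length Y2 n g"
  shows "\<exists>h r. h \<in> K \<and> red r \<and> g = h * P r \<and> len Y h + cost r \<le> 2 * n"
  using assms
proof (induction rule: word_length.induct)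
  case one
  show ?case by (intro exI[of _ 1] exI[of _ "[]"]) simp
next
  case (gen y n g)
  then obtain h r where hr: "h \<in> K" "red r" "g = h * P r" "len Y h + cost r \<le> 2 * n"
    by blast
  consider "y \<in> Y" | "y = t" | "y = s * inverse t"
    using gen.hyps by blast
  then show ?case
  proof cases
    case 1
    then have "len Y (y * h) \<le> 1 + len Y h"
      using len_mult[of y Y h] len_gen[of y Y] hr by (auto simp: span_gen)
    then show ?thesis
      using 1 hr by (intro exI[of _ "y * h"] exI[of _ r]) (auto simp: mult.assoc)
  next
    case 2
    obtain h' r' where "h' \<in> K" "red r'" "T True * (h * P r) = h' * P r'"
        "len Y h' + cost r' \<le> len Y h + cost r + 1"
      using stable_path[OF hr(2,1)] by blast
    then show ?thesis
      using 2 hr by (intro exI[of _ h'] exI[of _ r']) (auto simp: stable_def)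
  next
    case 3
    obtain h' r' where *: "h' \<in> K" "red r'" "T False * (h * P r) = h' * P r'"
        "len Y h' + cost r' \<le> len Y h + cost r + 1"
      using stable_path[OF hr(2,1)] by blast
    then have "len Y (s * h') \<le> 1 + len Y h'"
      using len_mult[of s Y h'] len_gen[of s Y] s_gen by auto
    then show ?thesis
      using 3 hr * s_gen by (intro exI[of _ "s * h'"] exI[of _ r']) (auto simp: stable_def mult.assoc)
  qed
next
  case (inv y n g)
  then obtain h r where hr: "h \<in> K" "red r" "g = h * P r" "len Y h + cost r \<le> 2 * n"
    by blast
  consider "y \<in> Y" | "y = t" | "y = s * inverse t"
    using inv.hyps by blast
  then show ?case
  proof cases
    case 1
    then have "len Y (inverse y * h) \<le> 1 + len Y h"
      using len_mult[of "inverse y" Y h] len_gen[of y Y] hr by auto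
    then show ?thesis
      using 1 hr by (intro exI[of _ "inverse y * h"] exI[of _ r]) (auto simp: mult.assoc)
  next
    case 2
    obtain h' r' where "h' \<in> K" "red r'" "T False * (h * P r) = h' * P r'"
        "len Y h' + cost r' \<le> len Y h + cost r + 1"
      using stable_path[OF hr(2,1)] by blast
    then show ?thesis
      using 2 hr by (intro exI[of _ h'] exI[of _ r']) (auto simp: stable_def)
  next
    case 3
    have "len Y (inverse s * h) \<le> 1 + len Y h"
      using len_mult[of "inverse s" Y h] len_gen[of s Y] s_gen hr by auto
    moreover obtain h' r' where *: "h' \<in> K" "red r'" "T True * (inverse s * h * P r) = h' * P r'"
        "len Y h' + cost r' \<le> len Y (inverse s * h) + cost r + 1"
      using stable_path[OF hr(2), of "inverse s * h" True] hr s_gen by blast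
    ultimately show ?thesis
      using 3 hr by (intro exI[of _ h'] exI[of _ r']) (auto simp: stable_def mult.assoc)
  qed
qed

lemma reduced_form_len:
  assumes "g \<in> G"
  obtains h r where "h \<in> K" "red r" "g = h * P r" "len Y h + cost r \<le> 2 * len Y2 g"
  using reduced_form[OF word_length_len[OF assms]] by blast

lemma K_subset_G: "K \<subseteq> G"
  by (rule span_mono) blast

lemma len_K_G: "g \<in> K \<Longrightarrow> len Y2 g \<le> len Y g"
  using len_scale[of g Y Y2 1] len_gen[of _ Y2] by (simp add: span_gen)

lemma stable_G [simp]: "T e \<in> G"
  by (auto simp: stable_def)

lemma len_stable: "len Y2 (T e) \<le> 1"
proof -
  have "t \<in> Y2" "t \<in> G" by auto
  then show ?thesis
    using len_gen[of t Y2] by (simp add: stable_def)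
qed

lemma path_G: "snd ` set r \<subseteq> K \<Longrightarrow> P r \<in> G \<and> len Y2 (P r) \<le> cost r"
proof (induction r)
  case (Cons x r)
  then have x: "snd x \<in> K" "snd x \<in> G" "P r \<in> G" "len Y2 (P r) \<le> cost r"
    using K_subset_G by auto
  have "len Y2 (T (fst x) * (snd x * P r)) \<le> len Y2 (T (fst x)) + (len Y2 (snd x) + len Y2 (P r))"
    using x len_mult[of "snd x" Y2 "P r"] len_mult[of "T (fst x)" Y2 "snd x * P r"] by auto
  also have "\<dots> \<le> 1 + (len Y (snd x) + cost r)"
    using x len_stable len_K_G by (intro add_mono) auto
  finally show ?case using x by auto
qed simp

lemma red_path_G: "red r \<Longrightarrow> P r \<in> G" "red r \<Longrightarrow> len Y2 (P r) \<le> cost r"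
  using path_G by (auto simp: red_def)


text \<open>
  Britton reduction of the equation below either pinches \<open>R\<close> against \<open>r'\<close> or \<open>r\<close> against \<open>R'\<close>, or
  else matches the first letters of \<open>R\<close> and \<open>r\<close>. Each of these shortens \<open>R\<close> or \<open>R'\<close>, so that after at
  most \<open>length R\<close> letters of \<open>r\<close> and \<open>r'\<close> only an edge element is left of \<open>u * P R\<close>.
\<close>

lemma overlap:
  assumes "red r" "red r'" "red R" "red R'" "u \<in> K" "u' \<in> K"
    and "u * (P R * P r') = P r * (u' * P R')"
    and "length R + length R' < length r" "length R + length R' < length r'"
  shows "\<exists>\<alpha> \<beta> p. \<alpha> + \<beta> \<le> length R \<and>
    u * (P R * P (take \<beta> r')) = P (take \<alpha> r) * c (fst (r ! \<alpha>)) powi p"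
  using assms
proof (induction "length R + length R'" arbitrary: r r' R R' u u' rule: less_induct)
  case less
  obtain e' x' r1' where r': "r' = (e', x') # r1'"
    using less.prems by (cases r') auto
  obtain r0 e x where r: "r = r0 @ [(e, x)]"
    using less.prems by (cases r rule: rev_cases) auto
  have rK: "red r1'" "x' \<in> K" "red r0" "x \<in> K"
    using less.prems r r' by (auto simp: red_Cons red_append)
  consider (1) R0 y where "R = R0 @ [y]" "\<not> pinch_free s s' y (e', x')"
    | (2) y R1 where "R' = y # R1" "\<not> pinch_free s s' (e, x * u') y"
    | (3) "R = [] \<or> pinch_free s s' (last R) (e', x')" "R' = [] \<or> pinch_free s s' (e, x * u') (hd R')"
    by (cases R rule: rev_cases; cases R'; auto)
  then show ?case
  proof cases
    case 1
    then obtain y' q where y: "y = (\<not> e', y')" "y' = c e' powi q"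
      by (cases y) (auto simp: pinch_free_def)
    have R0: "red R0" "y' \<in> K"
      using less.prems 1 y by (auto simp: red_append)
    have "c (\<not> e') powi q * x' \<in> K"
      using rK by simp
    then obtain u1 R1 where R1: "u1 \<in> K" "red R1" "length R1 = length R0"
        "u * (P R0 * (c (\<not> e') powi q * x')) = u1 * P R1"
      using path_mult[OF R0(1) less.prems(5)] by blast
    have peel: "u * (P R * P (take (Suc n) r')) = u1 * (P R1 * P (take n r1'))" for n
    proof -
      have "u * (P R * P (take (Suc n) r'))
          = u * (P R0 * (c (\<not> e') powi q * x')) * P (take n r1')"
        using 1 y r' edge_stable_assoc[of e' q] by (simp add: mult.assoc)
      then show ?thesis by (simp add: R1(4) mult.assoc)
    qed
    have "u1 * (P R1 * P r1') = P r * (u' * P R')"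
      using peel[of "length r1'"] less.prems(7) r' by simp
    then obtain \<alpha> \<beta> p where "\<alpha> + \<beta> \<le> length R1"
        "u1 * (P R1 * P (take \<beta> r1')) = P (take \<alpha> r) * c (fst (r ! \<alpha>)) powi p"
      using less.hyps[of R1 R' r r1' u1 u'] less.prems R1 rK 1 r' by auto
    then show ?thesis
      using peel R1 1 by (intro exI[of _ \<alpha>] exI[of _ "Suc \<beta>"] exI[of _ p]) simp
  next
    case 2
    then obtain y' q where y: "y = (\<not> e, y')" "x * u' = c (\<not> e) powi q"
      by (cases y) (auto simp: pinch_free_def)
    have R1: "red R1" "y' \<in> K"
      using less.prems 2 y by (auto simp: red_Cons)
    have "P r * (u' * P R') = P r0 * (T e * (x * u' * (T (\<not> e) * (y' * P R1))))"
      using 2(1) y(1) r by (simp add: mult.assoc)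
    also have "\<dots> = P r0 * (c e powi q * y' * P R1)"
      using edge_stable_assoc[of "\<not> e" q] by (simp add: y(2) mult.assoc)
    finally obtain \<alpha> \<beta> p where *: "\<alpha> + \<beta> \<le> length R"
        "u * (P R * P (take \<beta> r')) = P (take \<alpha> r0) * c (fst (r0 ! \<alpha>)) powi p"
      using less.hyps[of R R1 r0 r' u "c e powi q * y'"] less.prems rK R1 2 r by auto
    moreover have "\<alpha> < length r0"
      using * less.prems(8) r 2 by simp
    ultimately show ?thesis
      using r by (intro exI[of _ \<alpha>] exI[of _ \<beta>] exI[of _ p]) (simp add: nth_append)
  next
    case 3
    have "red (R @ r')"
      using 3 less.prems r' by (auto simp: red_append)
    moreover have "red (r0 @ [(e, x * u')])"
      using red_last_mult less.prems r by simp
    then have "red (r0 @ (e, x * u') # R')"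
      using 3 less.prems by (auto simp: red_append red_Cons)
    moreover have "u * (P (R @ r') * 1) = 1 * P (r0 @ (e, x * u') # R')"
      using less.prems(7) r by (simp add: mult.assoc)
    ultimately show ?thesis
    proof (rule britton_red[OF _ _ less.prems(5) span_one span_one])
      fix f y r1 z r2 p
      assume *: "R @ r' = (f, y) # r1" "r0 @ (e, x * u') # R' = (f, z) # r2" "1 = u * c f powi p"
      have u: "u = c f powi (- p)"
        using *(3) by (simp add: powi_minus grp_eq_mult_inverse[of u 1, simplified])
      show ?thesis
      proof (cases R)
        case Nil
        have "fst (r ! 0) = f"
          using *(2) r by (cases r0) auto
        then show ?thesis
          using u Nil by (intro exI[of _ 0] exI[of _ "- p"]) simp
      next
        case (Cons w R1)
        then have R: "R = (f, y) # R1"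
          using *(1) by auto
        have "r0 \<noteq> []"
          using less.prems(8) Cons r by auto
        then obtain r3 where r0: "r0 = (f, z) # r3"
          using *(2) by (cases r0) auto
        define u2 where "u2 = inverse z * (c (\<not> f) powi (- p) * y)"
        have K: "red R1" "y \<in> K" "z \<in> K" "red (r3 @ [(e, x)])"
          using less.prems R r r0 by (auto simp: red_Cons)
        then have "u2 \<in> K"
          by (simp add: u2_def)
        have peel: "u * (P R * a) = T f * (z * (u2 * (P R1 * a)))" for a
          using edge_stable_assoc[of f "- p"] by (simp add: u R u2_def mult.assoc)
        have "u2 * (P R1 * P r') = P (r3 @ [(e, x)]) * (u' * P R')"
          using less.prems(7) peel[of "P r'"] by (simp add: r r0 mult.assoc)
        then obtain \<alpha> \<beta> q where **: "\<alpha> + \<beta> \<le> length R1"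
            "u2 * (P R1 * P (take \<beta> r')) = P (take \<alpha> (r3 @ [(e, x)])) * c (fst ((r3 @ [(e, x)]) ! \<alpha>)) powi q"
          using less.hyps[of R1 R' "r3 @ [(e, x)]" r' u2 u'] less.prems K \<open>u2 \<in> K\<close> R r r0 by auto
        then show ?thesis
          using peel R r r0 by (intro exI[of _ "Suc \<alpha>"] exI[of _ \<beta>] exI[of _ q]) (simp add: mult.assoc)
      qed
    qed (use r' in auto)
  qed
qed

section \<open>Divergence of powers of the old edge generator\<close>

lemma edge_divergence:
  assumes "axes_diverge Y (c e) (c f) C" "g \<in> K" "h \<in> K" "g * c f powi j = c e powi p * h"
  shows "c e * g = g * c f \<or> \<bar>j\<bar> \<le> int (2 * C * (len Y g + len Y h))"
proof -
  have "c e powi (p - j) * h = inverse (c e powi j) * g * c f powi j"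
    using assms(4) powi_add[of "c e" "- j" p] by (simp add: powi_minus mult.assoc)
  then have "int (len Y (inverse (c e powi j) * g * c f powi j)) \<le> \<bar>p - j\<bar> + int (len Y h)"
    using len_mult[of "c e powi (p - j)" Y h] len_edge_powi[of e "p - j"] assms by simp
  \<comment> \<open>\<open>\<sigma>\<close> bounds \<open>p - j\<close> by the two lengths, so that
    the given equation with unequal exponents can be fed to \<open>axes_diverge\<close>, which has
    the same exponent on both sides; this doubles the constant.\<close>
  moreover have "\<sigma> g + j = p + \<sigma> h"
    using arg_cong[OF assms(4), of \<sigma>] by (simp add: sigma_mult)
  then have "\<bar>p - j\<bar> \<le> int (len Y g) + int (len Y h)"
    using sigma_len[OF assms(2)] sigma_len[OF assms(3)] by linarith
  ultimately have "len Y g + len Y (inverse (c e powi j) * g * c f powi j) \<le> 2 * (len Y g + len Y h)"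
    by simp
  then have "C * (len Y g + len Y (inverse (c e powi j) * g * c f powi j)) \<le> C * (2 * (len Y g + len Y h))"
    by (rule mult_le_mono2)
  also have "\<dots> = 2 * C * (len Y g + len Y h)"
    by simp
  finally have *: "int (C * (len Y g + len Y (inverse (c e powi j) * g * c f powi j)))
      \<le> int (2 * C * (len Y g + len Y h))"
    by (rule of_nat_mono)
  show ?thesis
    using assms(1,2) order_trans[OF _ *] by (auto simp only: axes_diverge_def)
qed

text \<open>Compare first letters. If the axes are parallel both at the first vertex and along the
  tail, they are parallel along the whole path. Otherwise one of the two places diverges and bounds
  its own exponent, \<open>q\<close> or \<open>j\<close>.\<close>

lemma path_divergence:
  assumes "\<And>e f. axes_diverge Y (c e) (c f) C"
    and "red r" "red r'" "g \<in> K" "h \<in> K" "g * (P r * c f powi j) = c e powi p * (h * P r')"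
  shows "c e * (g * P r) = g * P r * c f \<or>
    \<bar>j\<bar> \<le> int ((2 * C + 1) * (len Y g + cost r + len Y h + cost r'))"
  using assms(2-)
proof (induction r arbitrary: e g h p r')
  case Nil
  have "r' = []"
    using britton_length[of "[]" r' g "c e powi p * h" "c f powi j"] Nil.prems by (simp add: mult.assoc)
  moreover have "2 * C * (len Y g + len Y h) \<le> (2 * C + 1) * (len Y g + len Y h)"
    by (rule mult_le_mono1) simp
  ultimately show ?case
    using edge_divergence[OF assms(1) Nil.prems(3,4), of f j e p] Nil.prems by fastforce
next
  case (Cons w r)
  have eq: "g * (P (w # r) * c f powi j) = (c e powi p * h) * P r'"
    using Cons.prems by (simp add: mult.assoc)
  have K': "c e powi p * h \<in> K" "c f powi j \<in> K"
    using Cons.prems by auto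
  show ?case
  proof (rule britton_red[OF Cons.prems(1,2,3) K' eq])
    fix e' x r1 y r1' q
    assume *: "w # r = (e', x) # r1" "r' = (e', y) # r1'" "c e powi p * h = g * c e' powi q"
      "x * (P r1 * c f powi j) = c (\<not> e') powi q * (y * P r1')"
    have K: "x \<in> K" "y \<in> K" "red r" "red r1'"
      using Cons.prems * by (auto simp: red_Cons)
    have IH: "c (\<not> e') * (x * P r) = x * P r * c f \<or>
        \<bar>j\<bar> \<le> int ((2 * C + 1) * (len Y x + cost r + len Y y + cost r1'))"
      using Cons.IH[of r1' x y "\<not> e'" q] * K by simp
    have hd: "c e * g = g * c e' \<or> \<bar>q\<bar> \<le> int (2 * C * (len Y g + len Y h))"
      using edge_divergence[OF assms(1), of g h e' q e p] Cons.prems * by simp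
    \<comment> \<open>A bound on \<open>q\<close> gives one on \<open>j\<close> directly, by
      comparing \<open>\<sigma>\<close> of the tails, without passing through the vertices in
      between. Hence \<open>2 * C + 1\<close> does not grow with the number of edges.\<close>
    have "\<sigma> x + \<sigma> (P r) + j = q + \<sigma> y + \<sigma> (P r1')"
      using arg_cong[OF *(4), of \<sigma>] *(1) by (simp only: sigma_mult sigma_powi sigma_edge) simp
    then have "\<bar>j - q\<bar> \<le> int (len Y x + cost r + len Y y + cost r1')"
      using sigma_len[OF K(1)] sigma_len[OF K(2)] sigma_path[of r] sigma_path[of r1'] K
      by (simp add: red_def)
    moreover have "2 * C * (len Y g + len Y h) + (len Y x + cost r + len Y y + cost r1')
        \<le> (2 * C + 1) * (len Y g + cost (w # r) + len Y h + cost r')"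
      using * by (simp add: algebra_simps)
    moreover have "(2 * C + 1) * (len Y x + cost r + len Y y + cost r1')
        \<le> (2 * C + 1) * (len Y g + cost (w # r) + len Y h + cost r')"
      using * by (intro mult_le_mono2) simp
    moreover have "c e * (g * P (w # r)) = g * P (w # r) * c f"
      if "c e * g = g * c e'" "c (\<not> e') * (x * P r) = x * P r * c f"
    proof -
      have "c e * (g * P (w # r)) = (c e * g) * (T e' * (x * P r))"
        using * by (simp add: mult.assoc)
      also have "\<dots> = g * (T e' * (c (\<not> e') * (x * P r)))"
        using edge_stable_assoc[of e' 1] by (simp add: that(1) mult.assoc)
      finally show ?thesis
        using * by (simp add: that(2) mult.assoc)
    qed
    ultimately show ?thesis
      using IH hd by linarith
  qed (use Cons.prems in auto)
qed

lemma diverge_edge: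
  assumes "\<And>e f. axes_diverge Y (c e) (c f) C"
  shows "axes_diverge Y2 s s (4 * C + 2)"
  unfolding axes_diverge_def
proof (intro ballI allI)
  fix g and j :: int
  assume g: "g \<in> G"
  define h where "h = inverse (s powi j) * g * s powi j"
  have "s \<in> G"
    using s_gen by simp
  then have "h \<in> G"
    using g by (simp add: h_def)
  obtain g0 r where r: "g0 \<in> K" "red r" "g = g0 * P r" "len Y g0 + cost r \<le> 2 * len Y2 g"
    using reduced_form_len[OF g] .
  obtain h0 r' where r': "h0 \<in> K" "red r'" "h = h0 * P r'" "len Y h0 + cost r' \<le> 2 * len Y2 h"
    using reduced_form_len[OF \<open>h \<in> G\<close>] .
  have s: "c True = s"
    by (simp add: edge_def)
  have "g0 * (P r * s powi j) = s powi j * (h0 * P r')"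
    unfolding r'(3)[symmetric] h_def by (simp add: r(3) mult.assoc)
  then have "s * g = g * s \<or> \<bar>j\<bar> \<le> int ((2 * C + 1) * (len Y g0 + cost r + len Y h0 + cost r'))"
    using path_divergence[OF assms r(2) r'(2) r(1) r'(1), of True j True j] by (simp add: s r(3))
  moreover have "(2 * C + 1) * (len Y g0 + cost r + len Y h0 + cost r')
      \<le> (2 * C + 1) * (2 * (len Y2 g + len Y2 h))"
    using r(4) r'(4) by (intro mult_le_mono2) simp
  moreover have "(2 * C + 1) * (2 * (len Y2 g + len Y2 h)) = (4 * C + 2) * (len Y2 g + len Y2 h)"
    by (simp add: algebra_simps)
  ultimately show "s * g = g * s \<or>
      \<bar>j\<bar> \<le> int ((4 * C + 2) * (len Y2 g + len Y2 (inverse (s powi j) * g * s powi j)))"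
    unfolding h_def by linarith
qed


section \<open>Divergence involving the twisted generator\<close>

lemma s_G [simp]: "s \<in> G" "s' \<in> G" "t \<in> G"
  using s_gen by auto

lemma tau_twisted [simp]: "\<tau> (s * inverse t) = -1" "\<tau> s = 0"
  using additive_onD[OF tau_additive, of s "inverse t"] additive_on_inverse[OF tau_additive, of t]
    tau_t tau_gen s_gen by auto

text \<open>\<open>\<tau>\<close> vanishes on \<open>s\<close> and is \<open>-1\<close> on
  \<open>s t^-1\<close>.\<close>

lemma diverge_mixed: "axes_diverge Y2 s (s * inverse t) 1" "axes_diverge Y2 (s * inverse t) s 1"
  by (rule axes_diverge_additive[OF tau_additive]; use tau_t tau_gen in force)+

abbreviation "w \<equiv> s * inverse t"
text \<open>The conjugate \<open>s^-1 w s\<close> of \<open>w\<close>. It is the value of the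
  one-edge path \<open>[(False, s)]\<close>, and all edges of its powers have the same orientation,
  so \<open>v ^ n\<close> is a reduced path.\<close>

abbreviation "v \<equiv> inverse t * s"

lemma path_replicate: "P (replicate n (False, s)) = v ^ n"
  by (induction n) (simp_all add: stable_def mult.assoc)

lemma red_replicate: "red (replicate n (False, s))"
proof (induction n)
  case (Suc n)
  then show ?case
    using s_gen by (cases n) (auto simp: red_Cons pinch_free_def)
qed simp

text \<open>
  Acylindricity: on a sufficiently long common stretch of the axis of \<open>v\<close> and of its translate
  by \<open>g\<close>, the element \<open>g\<close> acts as a power of \<open>v\<close> up to \<open>s'\<^sup>p\<close>; going one edge further shows
  \<open>p = 0\<close>.
\<close>

lemma axis_stabilizer:
  assumes "g \<in> K" "red r" "h \<in> K" "red r'" "g * P r * v ^ n = v ^ n * (h * P r')"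
    and "length r + length r' + 1 < n"
  shows "g * P r \<in> range (\<lambda>p. v powi p)"
proof -
  have fst: "fst (replicate n (False, s) ! a) = False" if "a < n" for a n
    using that by simp
  obtain \<alpha> \<beta> p where ab: "\<alpha> + \<beta> \<le> length r"
      "g * (P r * P (take \<beta> (replicate n (False, s)))) =
        P (take \<alpha> (replicate n (False, s))) * c (fst (replicate n (False, s) ! \<alpha>)) powi p"
    using overlap[OF red_replicate red_replicate assms(2,4,1,3), of n n] assms(5,6)
    by (auto simp: path_replicate mult.assoc)
  then have eq: "g * P r * v ^ \<beta> = v ^ \<alpha> * s' powi p"
    using assms(6) fst[of \<alpha> n] by (simp add: path_replicate take_replicate mult.assoc edge_def min_def)
  obtain k where k: "n = Suc (\<beta> + k)"
    using ab(1) assms(6) less_iff_Suc_add[of \<beta> n] by auto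
  obtain l where l: "n = Suc (\<alpha> + l)"
    using ab(1) assms(6) less_iff_Suc_add[of \<alpha> n] by auto
  \<comment> \<open>One factor \<open>v\<close> is split off on each side. Since
    \<open>s'^p t^-1 = t^-1 s^p\<close>, passing it turns \<open>s'^p\<close> into
    \<open>s^p\<close>, and a second comparison will show that this is again a power of
    \<open>s'\<close>.\<close>
  have "v ^ \<alpha> * (s' powi p * (v * v ^ k)) = v ^ \<alpha> * (v * v ^ l * (h * P r'))"
  proof -
    have "v ^ \<alpha> * (s' powi p * (v * v ^ k)) = g * P r * (v ^ \<beta> * (v * v ^ k))"
      using eq by (metis mult.assoc)
    also have "v ^ \<beta> * (v * v ^ k) = v ^ n"
      unfolding k by (simp only: power_add[symmetric] power_Suc[symmetric] add_Suc_right)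
    also have "g * P r * v ^ n = v ^ \<alpha> * (v * v ^ l) * (h * P r')"
      unfolding assms(5) by (simp only: l power_add[symmetric] power_Suc[symmetric] add_Suc_right)
    finally show ?thesis by (simp only: mult.assoc)
  qed
  then have "s' powi p * (v * v ^ k) = v * v ^ l * (h * P r')"
    by simp
  moreover have "s' powi p * (v * v ^ k) = inverse t * s * (s powi p * v ^ k)"
    using edge_stable_assoc[of False p "s * v ^ k"] powi_conj[of s s s p]
    by (simp add: stable_def edge_def mult.assoc[symmetric])
  ultimately have "s powi p * v ^ k = v ^ l * (h * P r')"
    by (simp add: mult.assoc)
  moreover have "length r' < k" "length r' < l" "s powi p \<in> K"
    using k l ab(1) assms(6) s_gen by auto
  \<comment> \<open>With an empty \<open>R\<close>, \<open>overlap\<close> can only return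
    \<open>\<alpha> = \<beta> = 0\<close>, so the edge element it yields is \<open>s powi p\<close>
    itself.\<close>
  ultimately obtain q where "s powi p = c (fst (replicate l (False, s) ! 0)) powi q"
    using overlap[OF red_replicate red_replicate red_Nil assms(4) _ assms(3), of "s powi p" k l]
    by (auto simp: path_replicate)
  then have "s powi p = s' powi q"
    using fst[of 0 l] \<open>length r' < l\<close> by (simp add: edge_def)
  then have "p = 0"
    by (rule independent)
  then have "g * P r * v ^ \<beta> = v ^ \<alpha>"
    using eq by simp
  then have "g * P r = v powi (int \<alpha> - int \<beta>)"
    by (simp add: powi_diff grp_eq_mult_inverse)
  then show ?thesis by blast
qed

text \<open>Passing from \<open>w\<close> to \<open>v\<close> conjugates by \<open>s\<close> and
  adds 2 to each of the two lengths, and reduced forms double them, so the two paths have at most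
  \<open>2 * L + 8\<close> edges, where \<open>L\<close> is the sum of the lengths. Including the
  extra edge used in \<open>axis_stabilizer\<close> this is \<open>2 * L + 9\<close>, at most
  \<open>11 * L\<close> because \<open>g \<noteq> 1\<close>.\<close>

lemma diverge_twisted_pos:
  assumes g: "g \<in> G" and "w * g \<noteq> g * w"
  shows "n \<le> 11 * (len Y2 g + len Y2 (inverse (w ^ n) * g * w ^ n))"
proof (rule ccontr)
  assume n: "\<not> ?thesis"
  define h where "h = inverse (w ^ n) * g * w ^ n"
  have h: "h \<in> G"
    using g by (simp add: h_def)
  have sv: "s * v ^ k = w ^ k * s" for k
    using powi_conj[of w s v "int k"] by (simp add: mult.assoc)
  have conj: "inverse s * x * s \<in> G \<and> len Y2 (inverse s * x * s) \<le> len Y2 x + 2" if "x \<in> G" for x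
    using that len_mult[of "inverse s * x" Y2 s] len_mult[of "inverse s" Y2 x] len_gen[of s Y2] s_gen
    by fastforce
  obtain g0 r where r: "g0 \<in> K" "red r" "inverse s * g * s = g0 * P r"
      "len Y g0 + cost r \<le> 2 * len Y2 (inverse s * g * s)"
    using reduced_form_len conj[OF g] by blast
  obtain h0 r' where r': "h0 \<in> K" "red r'" "inverse s * h * s = h0 * P r'"
      "len Y h0 + cost r' \<le> 2 * len Y2 (inverse s * h * s)"
    using reduced_form_len conj[OF h] by blast
  have "g * w ^ n = w ^ n * h"
    by (simp add: h_def mult.assoc)
  moreover have "s * (g0 * P r * v ^ n) = g * w ^ n * s"
    using sv[of n] by (simp add: r(3)[symmetric] mult.assoc)
  moreover have "s * (v ^ n * (h0 * P r')) = w ^ n * (h * s)"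
    unfolding r'(3)[symmetric] using sv[of n] by (simp add: mult.assoc[symmetric]) (simp add: mult.assoc)
  ultimately have eq: "g0 * P r * v ^ n = v ^ n * (h0 * P r')"
    by (metis grp_left_cancel mult.assoc)
  have "g \<noteq> 1"
    using assms(2) by auto
  then have "len Y2 g \<ge> 1"
    using len_eq_0[OF g] by fastforce
  moreover have "length r \<le> 2 * len Y2 g + 4"
    using r(4) conj[OF g] length_le_cost[of r] by simp
  moreover have "length r' \<le> 2 * len Y2 h + 4"
    using r'(4) conj[OF h] length_le_cost[of r'] by simp
  ultimately have "length r + length r' + 1 < n"
    using n unfolding h_def[symmetric] by simp
  then obtain p where "g0 * P r = v powi p"
    using axis_stabilizer[OF r(1,2) r'(1,2) eq] by blast
  then have "g = s * v powi p * inverse s"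
    using r(3) by (metis grp_eq_inverse_mult grp_eq_mult_inverse mult.assoc)
  moreover have "s * v powi p = w powi p * s"
    using powi_conj[of w s v p] by (simp add: mult.assoc)
  ultimately have "g = w powi p"
    by (simp add: mult.assoc)
  then have "w * g = g * w"
    using powi_conj[of w w w p] by simp
  then show False
    using assms(2) by contradiction
qed

lemma diverge_twisted: "axes_diverge Y2 w w 11"
  unfolding axes_diverge_def
proof (intro ballI allI disjCI)
  fix g and j :: int
  assume g: "g \<in> G"
    and "\<not> \<bar>j\<bar> \<le> int (11 * (len Y2 g + len Y2 (inverse (w powi j) * g * w powi j)))"
  then have j: "\<not> \<bar>j\<bar> \<le> int (11 * (len Y2 g + len Y2 (inverse (w powi j) * g * w powi j)))"
    by simp
  show "w * g = g * w"
  proof (cases j rule: int_cases2)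
    case (nonneg n)
    then show ?thesis
      using diverge_twisted_pos[OF g, of n] j by auto
  next
    case (nonpos n)
    \<comment> \<open>For negative exponents \<open>g\<close> and its conjugate exchange roles, and
      the bound is symmetric in them.\<close>
    define h where "h = w ^ n * g * inverse (w ^ n)"
    have h: "h \<in> G" "inverse (w ^ n) * h * w ^ n = g" "inverse (w powi j) * g * w powi j = h"
      using g by (simp_all add: h_def nonpos powi_minus mult.assoc del: grp_inverse_mult)
    then have "w * h = h * w"
      using diverge_twisted_pos[OF h(1), of n] j nonpos by (auto simp: add.commute)
    then have "w powi int n * h = h * w powi int n"
      by (rule powi_conj[of w h w "int n"])
    then have "h = g"
      by (simp add: h_def mult.assoc)
    then show ?thesis
      using \<open>w * h = h * w\<close> by simp
  qed
qed

lemma axes_diverge_mono: "axes_diverge Z x y B \<Longrightarrow> B \<le> B' \<Longrightarrow> axes_diverge Z x y B'"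
  unfolding axes_diverge_def by (meson mult_le_mono1 of_nat_mono order_trans)

text \<open>The constant dominates those of the three kinds of pairs: \<open>4 * C + 2\<close>, 11
  and 1.\<close>

lemma diverge_step:
  assumes "\<And>e f. axes_diverge Y (edge s s' e) (edge s s' f) C"
  shows "axes_diverge Y2 (edge s w e) (edge s w f) (4 * C + 11)"
proof -
  have "axes_diverge Y2 s s (4 * C + 11)"
    using diverge_edge[OF assms] by (rule axes_diverge_mono) simp
  moreover have "axes_diverge Y2 w w (4 * C + 11)"
    using diverge_twisted by (rule axes_diverge_mono) simp
  moreover have "axes_diverge Y2 s w (4 * C + 11)" "axes_diverge Y2 w s (4 * C + 11)"
    by (rule axes_diverge_mono[OF diverge_mixed(1)], simp)
      (rule axes_diverge_mono[OF diverge_mixed(2)], simp)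
  ultimately show ?thesis
    by (simp add: edge_def)
qed


section \<open>Cyclic reduction and Collins' lemma\<close>

lemma cyclic_reduction:
  assumes "red r" "g \<in> K"
  shows "\<exists>z\<in>G. len Y2 z \<le> len Y g + cost (butlast r) \<and>
    ((\<exists>g'\<in>K. len Y g' \<le> len Y g + cost r \<and> g * (P r * z) = z * g') \<or>
     (\<exists>r'. r' \<noteq> [] \<and> red (r' @ r') \<and> cost r' \<le> len Y g + cost r \<and> g * (P r * z) = z * P r'))"
  using assms
proof (induction "length r" arbitrary: r g rule: less_induct)
  case less
  show ?case
  proof (cases r rule: rev_cases)
    case Nil
    then show ?thesis
      using less.prems by (intro bexI[of _ 1]) auto
  next
    case (snoc r0 x0)
    then obtain e x where r: "r = r0 @ [(e, x)]"
      by (cases x0) auto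
    have K: "red r0" "x \<in> K" "g \<in> G" "len Y2 g \<le> len Y g"
      using less.prems r K_subset_G len_K_G by (auto simp: red_append)
    \<comment> \<open>Conjugation by \<open>g\<close> moves it into the last vertex element. After
      that only the junction of the end of \<open>r'\<close> with its beginning can contain a
      pinch.\<close>
    define r' where "r' = r0 @ [(e, x * g)]"
    have r': "red r'" "cost r' \<le> cost r + len Y g" "P r * g = P r'"
      using red_last_mult[of r0 e x g] less.prems len_mult[of x Y g] K
      by (simp_all add: r r'_def mult.assoc)
    show ?thesis
    proof (cases "red (r' @ r')")
      case True
      then show ?thesis
        using r' K by (intro bexI[of _ g] conjI disjI2 exI[of _ r']) (auto simp: r'_def)
    next
      case False
      then have "\<not> pinch_free s s' (e, x * g) (hd r')"
        using r'(1) unfolding red_append_self by (auto simp: r'_def)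
      moreover from this obtain y0 r1 where r0: "r0 = y0 # r1"
        by (cases r0) (auto simp: r'_def pinch_free_def)
      ultimately obtain y q where y: "y0 = (\<not> e, y)" "x * g = c (\<not> e) powi q"
        by (cases y0) (auto simp: r'_def pinch_free_def)
      have K1: "y \<in> K" "red r1"
        using K(1) by (auto simp: r0 y red_Cons)
      have xg: "x * g \<in> K"
        using K(2) less.prems(2) by simp
      have "\<bar>q\<bar> \<le> int (len Y x + len Y g)"
        using sigma_len[OF xg] len_mult[OF K(2) less.prems(2)] by (simp add: y)
      then have q: "len Y (c e powi q) \<le> len Y x + len Y g"
        using len_edge_powi[of e q] by simp
      have step: "g * (P r * (g * (T (\<not> e) * z))) = g * (T (\<not> e) * (y * (P r1 * (c e powi q * z))))" for z
      proof -
        have "P r * (g * (T (\<not> e) * z)) = T (\<not> e) * (y * (P r1 * (T e * (x * g * (T (\<not> e) * z)))))"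
          by (simp add: r r0 y(1) mult.assoc)
        also have "\<dots> = T (\<not> e) * (y * (P r1 * (c e powi q * z)))"
          using edge_stable_assoc[of "\<not> e" q] by (simp add: y(2))
        finally show ?thesis by simp
      qed
      have gT: "g * T (\<not> e) \<in> G" "len Y2 (g * T (\<not> e)) \<le> len Y g + 1"
        using len_mult[of g Y2 "T (\<not> e)"] len_stable[of "\<not> e"] K by auto
      show ?thesis
      proof (cases r1 rule: rev_cases)
        case Nil
        have "len Y (y * c e powi q) \<le> len Y g + cost r"
          using len_mult[of y Y "c e powi q"] K1 q by (simp add: r r0 y Nil)
        then show ?thesis
          using step[of 1] gT K1
          by (intro bexI[of _ "g * T (\<not> e)"] conjI disjI1 bexI[of _ "y * c e powi q"])
            (auto simp: r r0 y Nil mult.assoc)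
      next
        case (snoc r2 x2)
        define r3 where "r3 = r2 @ [(fst x2, snd x2 * c e powi q)]"
        have "snd x2 \<in> K"
          using K1 by (auto simp: snoc red_append)
        then have r3: "red r3" "P r3 = P r1 * c e powi q" "cost r3 \<le> cost r1 + len Y x + len Y g"
          using red_last_mult[of r2 "fst x2" "snd x2" "c e powi q"] K1 q
            len_mult[of "snd x2" Y "c e powi q"]
          by (simp_all add: r3_def snoc mult.assoc)
        \<comment> \<open>The bound for the conjugator leaves out the last entry because that entry
          absorbs the edge power of each round; counting it would add the length of \<open>g\<close>
          again every time.\<close>
        have bl: "cost (butlast r3) \<le> cost r1"
          by (simp add: r3_def snoc)
        obtain z where z: "z \<in> G" "len Y2 z \<le> len Y y + cost (butlast r3)"
          "(\<exists>g'\<in>K. len Y g' \<le> len Y y + cost r3 \<and> y * (P r3 * z) = z * g') \<or>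
           (\<exists>r'. r' \<noteq> [] \<and> red (r' @ r') \<and> cost r' \<le> len Y y + cost r3 \<and> y * (P r3 * z) = z * P r')"
          using less.hyps[of r3 y] r3(1) K1(1) by (auto simp: r r0 snoc r3_def)
        have le: "len Y y + cost r3 \<le> len Y g + cost r"
          using r3(3) by (simp add: r r0 y)
        have conj: "g * (P r * (g * T (\<not> e) * z)) = g * T (\<not> e) * z * a" if "y * (P r3 * z) = z * a" for a
          using step[of z] that by (simp add: r3(2) mult.assoc)
        have "len Y2 (g * T (\<not> e) * z) \<le> len Y g + cost (butlast r)"
          using len_mult[OF gT(1) z(1)] gT(2) z(2) bl by (simp add: r r0 y)
        moreover have "g * T (\<not> e) * z \<in> G"
          using gT z by simp
        ultimately show ?thesis
          using z(3) conj le by (meson order_trans)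
      qed
    qed
  qed
qed

lemma red_rotate1: "red ((x # r) @ (x # r)) \<Longrightarrow> red ((r @ [x]) @ (r @ [x]))"
  unfolding red_append_self
  by (cases "r = []") (auto simp: red_Cons red_append[of r "[x]"])

text \<open>If \<open>R\<close> and \<open>r\<close> meet without a pinch, then \<open>R\<close> and
  \<open>R @ r\<close> are paths of two reduced forms of one element, against
  \<open>britton_length\<close>. Otherwise the pinch shortens \<open>R\<close>, and the price is a
  rotation of \<open>r\<close> by one letter.\<close>

lemma hyperbolic_not_elliptic:
  assumes "g \<in> K" "u \<in> K" "red R" "r \<noteq> []" "red (r @ r)"
  shows "g * (u * P R) \<noteq> u * P R * P r"
  using assms(2-)
proof (induction "length R" arbitrary: R u r rule: less_induct)
  case less
  show ?case
  proof
    assume eq: "g * (u * P R) = u * P R * P r"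
    obtain e x r1 where r: "r = (e, x) # r1"
      using less.prems by (cases r) auto
    show False
    proof (cases "R = [] \<or> pinch_free s s' (last R) (e, x)")
      case True
      then have "red (R @ r)"
        using less.prems r unfolding red_append_self by (auto simp: red_append)
      then have "length (R @ r) = length R"
        using less.prems assms(1) eq
        by (intro britton_length[of _ _ u "g * u" 1]) (auto simp: mult.assoc)
      then show False
        using r by simp
    next
      case False
      then obtain R0 y0 where R0: "R = R0 @ [y0]" "\<not> pinch_free s s' y0 (e, x)"
        by (cases R rule: rev_cases) auto
      then obtain y q where y: "y0 = (\<not> e, y)" "y = c e powi q"
        by (cases y0) (auto simp: pinch_free_def)
      have K: "x \<in> K" "red R0"
        using less.prems unfolding red_append_self by (auto simp: r R0 red_append red_Cons)
      then have "c (\<not> e) powi q * x \<in> K"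
        by simp
      then obtain u' R' where R': "u' \<in> K" "red R'" "length R' = length R0"
          "u * (P R0 * (c (\<not> e) powi q * x)) = u' * P R'"
        using path_mult[OF K(2) less.prems(1)] by blast
      have "u * (P R * (T e * x)) = u' * P R'"
        using edge_stable_assoc[of e q] by (simp add: R'(4)[symmetric] R0 y mult.assoc)
      moreover have "g * (u * (P R * (T e * x))) = u * (P R * (T e * x)) * P (r1 @ [(e, x)])"
        using eq by (simp add: r mult.assoc[symmetric])
      ultimately have "g * (u' * P R') = u' * P R' * P (r1 @ [(e, x)])"
        by simp
      moreover have "red ((r1 @ [(e, x)]) @ (r1 @ [(e, x)]))"
        using red_rotate1 less.prems(4) r by blast
      ultimately show False
        using less.hyps[of R' u' "r1 @ [(e, x)]"] R' R0 by simp
    qed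
  qed
qed

text \<open>If the connecting path has an edge, \<open>g\<close> fixes the first one and is
  conjugate in \<open>K\<close> to an edge power, which crosses the edge with the same exponent. In
  later steps the exponent cannot change either, since \<open>\<sigma>\<close> is invariant under
  conjugation. So only the two ends of the path are kept, and its length is irrelevant.\<close>

lemma elliptic_conjugate:
  assumes "g \<in> K" "h \<in> K" "u \<in> K" "red R" "g * (u * P R) = u * P R * h"
  shows "(\<exists>z\<in>K. g * z = z * h) \<or>
    (\<exists>e f q. (\<exists>z\<in>K. g * z = z * c e powi q) \<and> (\<exists>z\<in>K. h * z = z * c f powi q))"
  using assms(1,3-)
proof (induction R arbitrary: g u)
  case Nil
  then show ?case by auto
next
  case (Cons w R)
  have eq: "u * (P (w # R) * h) = g * u * P (w # R)"
    using Cons.prems by (simp add: mult.assoc)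
  have "g * u \<in> K"
    using Cons.prems by simp
  then show ?case
  proof (rule britton_red[OF Cons.prems(3,3,2) _ assms(2) eq])
    fix e x r1 y r1' p
    assume *: "w # R = (e, x) # r1" "w # R = (e, y) # r1'" "g * u = u * c e powi p"
      "x * (P r1 * h) = c (\<not> e) powi p * (y * P r1')"
    have xR: "x \<in> K" "red R"
      using Cons.prems * by (auto simp: red_Cons)
    have "(\<exists>z\<in>K. c (\<not> e) powi p * z = z * h) \<or>
      (\<exists>e' f q. (\<exists>z\<in>K. c (\<not> e) powi p * z = z * c e' powi q) \<and> (\<exists>z\<in>K. h * z = z * c f powi q))"
      using * xR by (intro Cons.IH[of "c (\<not> e) powi p" x]) (auto simp: mult.assoc)
    then show ?thesis
    proof (elim disjE exE conjE bexE)
      fix z assume z: "z \<in> K" "c (\<not> e) powi p * z = z * h"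
      then have "h * inverse z = inverse z * c (\<not> e) powi p"
        by (metis grp_eq_inverse_mult grp_eq_mult_inverse mult.assoc)
      then show ?thesis
        using z(1) *(3) Cons.prems(2) span_inverse by blast
    next
      fix e' f q z z'
      assume z: "z \<in> K" "c (\<not> e) powi p * z = z * c e' powi q" "z' \<in> K" "h * z' = z' * c f powi q"
      have "p = q"
        using arg_cong[OF z(2), of \<sigma>] by (simp add: sigma_mult)
      then show ?thesis
        using z *(3) Cons.prems(2) by blast
    qed
  qed simp
qed

lemma red_concat_replicate:
  assumes "red (r @ r)"
  shows "red (concat (replicate n r))"
proof (induction n)
  case (Suc n)
  then show ?case
    using assms by (cases n) (auto simp: red_append)
qed simp

lemma path_concat_replicate: "P (concat (replicate n r)) = P r ^ n"
  by (induction n) auto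

lemma take_concat_replicate:
  assumes "a < n * length r"
  shows "\<exists>i b. take a (concat (replicate n r)) = concat (replicate i r) @ take b r"
  using assms
proof (induction n arbitrary: a)
  case (Suc n)
  show ?case
  proof (cases "a < length r")
    case True
    then show ?thesis
      by (intro exI[of _ 0] exI[of _ a]) simp
  next
    case False
    then have "a - length r < n * length r"
      using Suc.prems by auto
    then obtain i b where "take (a - length r) (concat (replicate n r)) = concat (replicate i r) @ take b r"
      using Suc.IH by blast
    then show ?thesis
      using False by (intro exI[of _ "Suc i"] exI[of _ b]) simp
  qed
qed simp

lemma red_rotation: "red (r @ r) \<Longrightarrow> red (drop b r @ take b r)"
proof -
  assume "red (r @ r)"
  moreover have "r @ r = take b r @ (drop b r @ take b r) @ drop b r"
    by (metis append_assoc append_take_drop_id)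
  ultimately have "red (take b r @ (drop b r @ take b r) @ drop b r)"
    by simp
  then show ?thesis
    by (simp only: red_append)
qed

lemma hyperbolic_conjugate:
  assumes div: "\<And>e f. axes_diverge Y (c e) (c f) C"
    and r: "r \<noteq> []" "red (r @ r)" "r' \<noteq> []" "red (r' @ r')"
    and u: "u \<in> G" "P r * u = u * P r'"
  shows "\<exists>z\<in>G. P r * z = z * P r' \<and> len Y2 z \<le> (2 * C + 2) * (cost r + cost r')"
proof -
  obtain u0 R where R: "u0 \<in> K" "red R" "u = u0 * P R"
    using reduced_form_len[OF u(1)] by blast
  \<comment> \<open>\<open>overlap\<close> is applied with \<open>R' = R\<close> and asks for more
    than \<open>2 * length R\<close> edges; each period has at least one.\<close>
  define n where "n = 2 * length R + 1"
  have len: "length (concat (replicate n r)) = n * length r" for r :: "(bool \<times> 'g) list"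
    by (induction n) auto
  have n: "n \<le> n * length r" "n \<le> n * length r'"
    using r(1,3) by (cases r; cases r'; simp)+
  have "u * P r' ^ n = P r ^ n * u"
    using powi_conj[OF u(2), of "int n"] by simp
  then have "u0 * (P R * P (concat (replicate n r'))) = P (concat (replicate n r)) * (u0 * P R)"
    by (simp add: path_concat_replicate R(3) mult.assoc)
  moreover have "length R + length R < n"
    by (simp add: n_def)
  then have "length R + length R < length (concat (replicate n r))"
      "length R + length R < length (concat (replicate n r'))"
    using n unfolding len by linarith+
  ultimately obtain \<alpha> \<beta> p e where ab: "\<alpha> + \<beta> \<le> length R"
      "u0 * (P R * P (take \<beta> (concat (replicate n r')))) = P (take \<alpha> (concat (replicate n r))) * c e powi p"
    using overlap[OF red_concat_replicate[OF r(2)] red_concat_replicate[OF r(4)] R(2,2,1,1)] by blast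
  obtain i b where ib: "take \<alpha> (concat (replicate n r)) = concat (replicate i r) @ take b r"
    using take_concat_replicate[of \<alpha> n r] ab(1) n by (auto simp: n_def)
  obtain k d where kd: "take \<beta> (concat (replicate n r')) = concat (replicate k r') @ take d r'"
    using take_concat_replicate[of \<beta> n r'] ab(1) n by (auto simp: n_def)
  define x x' where "x = P (take b r)" and "x' = P (take d r')"
  define y y' where "y = P (drop b r @ take b r)" and "y' = P (drop d r' @ take d r')"
  have xG: "x \<in> G" "x' \<in> G" "len Y2 x \<le> cost r" "len Y2 x' \<le> cost r'"
  proof -
    have "red (take a q) \<and> cost (take a q) \<le> cost q" if "red (q @ q)" for a q
      using that red_append[of "take a q" "drop a q"] cost_simps(3)[of "take a q" "drop a q"]
      by (auto simp: red_append simp del: cost_simps)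
    then show "x \<in> G" "x' \<in> G" "len Y2 x \<le> cost r" "len Y2 x' \<le> cost r'"
      unfolding x_def x'_def using r red_path_G by (meson order_trans)+
  qed
  have rotate: "P q * P (take a q) = P (take a q) * P (drop a q @ take a q)" for a q
  proof -
    have "P q = P (take a q) * P (drop a q)"
      by (simp only: path_append[symmetric] append_take_drop_id)
    then show ?thesis
      by (simp only: path_append mult.assoc)
  qed
  have xy: "P r * x = x * y" "P r' * x' = x' * y'"
    unfolding x_def y_def x'_def y'_def by (rule rotate)+
  have x'_inv: "inverse x' * P r' = y' * inverse x'"
    using xy(2) by (simp add: grp_eq_mult_inverse mult.assoc)
  \<comment> \<open>Complete periods commute with \<open>P r\<close> and \<open>P r'\<close>. They
    cancel, so that only the partial periods \<open>x\<close> and \<open>x'\<close> and the edge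
    power remain.\<close>
  have "u * (P r' ^ k * x') = P r ^ i * (x * c e powi p)"
    using ab(2) by (simp add: ib kd R(3) path_concat_replicate x_def x'_def mult.assoc)
  moreover have "P r * (u * (P r' ^ k * x')) = u * (P r' ^ k * x') * y'"
  proof -
    have "P r * (u * (P r' ^ k * x')) = u * (P r' ^ k * (P r' * x'))"
      using u(2) power_commutes[of "P r'" k] by (simp only: mult.assoc[symmetric])
    then show ?thesis
      by (simp only: xy(2) mult.assoc)
  qed
  ultimately have "P r * (P r ^ i * (x * c e powi p)) = P r ^ i * (x * c e powi p) * y'"
    by simp
  also have "P r * (P r ^ i * (x * c e powi p)) = P r ^ i * (x * (y * c e powi p))"
  proof -
    have "P r * (x * c e powi p) = x * (y * c e powi p)"
      using xy(1) by (simp only: mult.assoc[symmetric])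
    moreover have "P r * (P r ^ i * b) = P r ^ i * (P r * b)" for b
      using power_commutes[of "P r" i] by (simp only: mult.assoc[symmetric])
    ultimately show ?thesis by simp
  qed
  finally have "P r ^ i * (x * (y * c e powi p)) = P r ^ i * (x * (c e powi p * y'))"
    by (simp only: mult.assoc)
  then have yy: "y * c e powi p = c e powi p * y'"
    by simp
  have "c e * y = y * c e \<or> \<bar>p\<bar> \<le> int ((2 * C + 1) * (cost r + cost r'))"
  proof -
    have "cost (drop a q @ take a q) = cost q" for a q
      using cost_simps(3)[of "take a q" "drop a q"] by simp
    moreover have "1 * (P (drop b r @ take b r) * c e powi p)
        = c e powi p * (1 * P (drop d r' @ take d r'))"
      using yy by (simp only: y_def y'_def mult_1_left)
    ultimately show ?thesis
      using path_divergence[OF div red_rotation[OF r(2)] red_rotation[OF r(4)] span_one span_one]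
      by (simp add: y_def y'_def del: path_append)
  qed
  then show ?thesis
  proof
    \<comment> \<open>Here the power commutes with \<open>y\<close> and gives \<open>y = y'\<close>,
      so \<open>p\<close> may be replaced by 0.\<close>
    assume "c e * y = y * c e"
    then have "c e powi p * y = y * c e powi p"
      by (rule powi_conj)
    then have "y = y'"
      using yy by simp
    then have "P r * (x * inverse x') = x * inverse x' * P r'"
      using xy(1) x'_inv by (simp add: mult.assoc) (simp add: mult.assoc[symmetric])
    moreover have "len Y2 (x * inverse x') \<le> cost r + cost r'"
      using len_mult[of x Y2 "inverse x'"] xG by simp
    then have "len Y2 (x * inverse x') \<le> (2 * C + 2) * (cost r + cost r')"
      by simp
    ultimately show ?thesis
      using xG by blast
  next
    assume p: "\<bar>p\<bar> \<le> int ((2 * C + 1) * (cost r + cost r'))"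
    define z where "z = x * (c e powi p * inverse x')"
    have "P r * z = z * P r'"
    proof -
      have "z * P r' = x * (y * c e powi p) * inverse x'"
        unfolding yy using x'_inv by (simp add: z_def mult.assoc)
      then show ?thesis
        using xy(1) by (simp add: z_def mult.assoc[symmetric])
    qed
    moreover have "c e powi p \<in> G"
      using K_subset_G by auto
    moreover have "len Y2 (c e powi p) \<le> len Y (c e powi p)"
      by (intro len_K_G) simp
    then have "len Y2 (c e powi p) \<le> (2 * C + 1) * (cost r + cost r')"
      using p len_edge_powi[of e p] by linarith
    ultimately have "len Y2 z \<le> cost r + ((2 * C + 1) * (cost r + cost r') + cost r')" "z \<in> G"
      using len_mult[of x Y2 "c e powi p * inverse x'"] len_mult[of "c e powi p" Y2 "inverse x'"] xG
      by (simp_all add: z_def)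
    then show ?thesis
      using \<open>P r * z = z * P r'\<close> by (intro bexI[of _ z]) (auto simp: algebra_simps)
  qed
qed


lemma conj_bounded_step:
  assumes div: "\<And>e f. axes_diverge Y (c e) (c f) C" and bnd: "conj_bounded Y B"
  shows "\<exists>B'. conj_bounded Y2 B'"
proof
  \<comment> \<open>Hyperbolic elements need \<open>4 * C + 4\<close>, elliptic ones at most
    \<open>4 * B + 1\<close>, and undoing the cyclic reductions adds 2. One generous constant covers
    all cases.\<close>
  show "conj_bounded Y2 (8 * C + 4 * B + 20)"
    unfolding conj_bounded_def
  proof (intro ballI impI)
    fix g h u
    assume gh: "g \<in> G" "h \<in> G" "u \<in> G" "g * u = u * h"
    have reduce: "\<exists>z\<in>G. len Y2 z \<le> 2 * len Y2 x \<and>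
        ((\<exists>x'\<in>K. len Y x' \<le> 2 * len Y2 x \<and> x * z = z * x') \<or>
         (\<exists>r. r \<noteq> [] \<and> red (r @ r) \<and> cost r \<le> 2 * len Y2 x \<and> x * z = z * P r))" if x: "x \<in> G" for x
    proof -
      obtain k r where r: "k \<in> K" "red r" "x = k * P r" "len Y k + cost r \<le> 2 * len Y2 x"
        using reduced_form_len[OF x] .
      have "cost (butlast r) \<le> cost r"
        by (cases r rule: rev_cases) auto
      moreover obtain z where z: "z \<in> G" "len Y2 z \<le> len Y k + cost (butlast r)"
        "(\<exists>x'\<in>K. len Y x' \<le> len Y k + cost r \<and> x * z = z * x') \<or>
         (\<exists>r'. r' \<noteq> [] \<and> red (r' @ r') \<and> cost r' \<le> len Y k + cost r \<and> x * z = z * P r')"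
        using cyclic_reduction[OF r(2,1)] unfolding r(3) mult.assoc by blast
      ultimately have "len Y2 z \<le> 2 * len Y2 x"
        using r(4) by linarith
      then show ?thesis
        using z(1,3) le_trans[OF _ r(4)] by blast
    qed
    have lift: "\<exists>z\<in>G. g * z = z * h \<and> len Y2 z \<le> (8 * C + 4 * B + 20) * (len Y2 g + len Y2 h + 1)"
      if "zg \<in> G" "zh \<in> G" "g * zg = zg * g'" "h * zh = zh * h'" "len Y2 zg \<le> 2 * len Y2 g"
        "len Y2 zh \<le> 2 * len Y2 h" "z \<in> G" "g' * z = z * h'"
        "len Y2 z \<le> (8 * C + 4 * B + 18) * (len Y2 g + len Y2 h + 1)"
      for zg zh g' h' z
    proof (intro bexI[of _ "zg * (z * inverse zh)"] conjI)
      have "h' * inverse zh = inverse zh * h"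
        using that(4) by (metis grp_eq_inverse_mult grp_eq_mult_inverse mult.assoc)
      then show "g * (zg * (z * inverse zh)) = zg * (z * inverse zh) * h"
        using that(3,8) by (metis mult.assoc)
      have "len Y2 (zg * (z * inverse zh)) \<le> len Y2 zg + (len Y2 z + len Y2 zh)"
        using len_mult[of zg Y2 "z * inverse zh"] len_mult[of z Y2 "inverse zh"] that by simp
      also have "\<dots> \<le> 2 * len Y2 g + ((8 * C + 4 * B + 18) * (len Y2 g + len Y2 h + 1) + 2 * len Y2 h)"
        using that by (intro add_mono)
      also have "\<dots> \<le> (8 * C + 4 * B + 20) * (len Y2 g + len Y2 h + 1)"
        by (simp add: algebra_simps)
      finally show "len Y2 (zg * (z * inverse zh)) \<le> (8 * C + 4 * B + 20) * (len Y2 g + len Y2 h + 1)" .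
    qed (use that in auto)
    obtain zg where zg: "zg \<in> G" "len Y2 zg \<le> 2 * len Y2 g"
        "(\<exists>x'\<in>K. len Y x' \<le> 2 * len Y2 g \<and> g * zg = zg * x') \<or>
         (\<exists>r. r \<noteq> [] \<and> red (r @ r) \<and> cost r \<le> 2 * len Y2 g \<and> g * zg = zg * P r)"
      using reduce[OF gh(1)] by blast
    obtain zh where zh: "zh \<in> G" "len Y2 zh \<le> 2 * len Y2 h"
        "(\<exists>x'\<in>K. len Y x' \<le> 2 * len Y2 h \<and> h * zh = zh * x') \<or>
         (\<exists>r. r \<noteq> [] \<and> red (r @ r) \<and> cost r \<le> 2 * len Y2 h \<and> h * zh = zh * P r)"
      using reduce[OF gh(2)] by blast
    define a where "a = inverse zg * (u * zh)"
    have a: "a \<in> G" "g' * a = a * h'" if "g * zg = zg * g'" "h * zh = zh * h'" for g' h'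
    proof -
      show "a \<in> G"
        using zg(1) zh(1) gh(3) by (simp add: a_def)
      have "g' = inverse zg * g * zg"
        using that(1) by (metis grp_eq_inverse_mult mult.assoc)
      then have "g' * a = inverse zg * (g * u) * zh"
        by (simp add: a_def mult.assoc)
      then show "g' * a = a * h'"
        using that(2) gh(4) by (simp add: a_def mult.assoc)
    qed
    have not_mixed: False
      if mixed: "g1 \<in> K" "b \<in> G" "r \<noteq> []" "red (r @ r)" "g1 * b = b * P r" for g1 b r
    proof -
      obtain k R where "k \<in> K" "red R" "b = k * P R"
        using reduced_form_len[OF mixed(2)] by blast
      then show False
        using hyperbolic_not_elliptic[OF mixed(1) _ _ mixed(3,4), of k R] mixed(5) by simp
    qed
    show "\<exists>z\<in>G. g * z = z * h \<and> len Y2 z \<le> (8 * C + 4 * B + 20) * (len Y2 g + len Y2 h + 1)"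
      using zg(3)
    proof (elim disjE bexE exE conjE)
      fix r assume r: "r \<noteq> []" "red (r @ r)" "cost r \<le> 2 * len Y2 g" "g * zg = zg * P r"
      show ?thesis
        using zh(3)
      proof (elim disjE bexE exE conjE)
        fix h' assume "h' \<in> K" "h * zh = zh * h'"
        then have "h' * inverse a = inverse a * P r" "inverse a \<in> G"
          using a[OF r(4)] by (metis grp_eq_inverse_mult grp_eq_mult_inverse mult.assoc, simp)
        then show ?thesis
          using not_mixed[OF \<open>h' \<in> K\<close> _ r(1,2)] by blast
      next
        fix r' assume r': "r' \<noteq> []" "red (r' @ r')" "cost r' \<le> 2 * len Y2 h" "h * zh = zh * P r'"
        obtain z where z: "z \<in> G" "P r * z = z * P r'" "len Y2 z \<le> (2 * C + 2) * (cost r + cost r')"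
          using hyperbolic_conjugate[OF div r(1,2) r'(1,2) a[OF r(4) r'(4)]] by blast
        have "(2 * C + 2) * (cost r + cost r') \<le> (2 * C + 2) * (2 * len Y2 g + 2 * len Y2 h)"
          using r(3) r'(3) by (intro mult_le_mono2) simp
        also have "\<dots> \<le> (8 * C + 4 * B + 18) * (len Y2 g + len Y2 h + 1)"
          by (simp add: algebra_simps)
        finally show ?thesis
          using lift[OF zg(1) zh(1) r(4) r'(4) zg(2) zh(2) z(1,2)] z(3) by simp
      qed
    next
      fix g' assume g': "g' \<in> K" "len Y g' \<le> 2 * len Y2 g" "g * zg = zg * g'"
      show ?thesis
        using zh(3)
      proof (elim disjE bexE exE conjE)
        fix r assume "r \<noteq> []" "red (r @ r)" "h * zh = zh * P r"
        then show ?thesis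
          using not_mixed[OF g'(1)] a[OF g'(3)] by blast
      next
        fix h' assume h': "h' \<in> K" "len Y h' \<le> 2 * len Y2 h" "h * zh = zh * h'"
        have conjK: "\<exists>z'\<in>K. x * z' = z' * y \<and> len Y2 z' \<le> B * (len Y x + len Y y + 1)"
          if xy: "x \<in> K" "y \<in> K" "z \<in> K" "x * z = z * y" for x y z
        proof -
          obtain z' where "z' \<in> K" "x * z' = z' * y" "len Y z' \<le> B * (len Y x + len Y y + 1)"
            using bnd xy unfolding conj_bounded_def by blast
          then show ?thesis
            using le_trans[OF len_K_G] by blast
        qed
        obtain k R where k: "k \<in> K" "red R" "a = k * P R"
          using reduced_form_len a(1)[OF g'(3) h'(3)] by blast
        have "g' * (k * P R) = k * P R * h'"
          using a(2)[OF g'(3) h'(3)] by (simp add: k(3))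
        from elliptic_conjugate[OF g'(1) h'(1) k(1,2) this] show ?thesis
        proof (elim disjE exE conjE bexE)
          fix z assume "z \<in> K" "g' * z = z * h'"
          then obtain z' where z': "z' \<in> K" "g' * z' = z' * h'"
              "len Y2 z' \<le> B * (len Y g' + len Y h' + 1)"
            using conjK[OF g'(1) h'(1)] by blast
          have "B * (len Y g' + len Y h' + 1) \<le> B * (2 * len Y2 g + 2 * len Y2 h + 1)"
            using g'(2) h'(2) by (intro mult_le_mono2) simp
          also have "\<dots> \<le> (8 * C + 4 * B + 18) * (len Y2 g + len Y2 h + 1)"
            by (simp add: algebra_simps)
          finally show ?thesis
            using lift[OF zg(1) zh(1) g'(3) h'(3) zg(2) zh(2) _ z'(2)] z' K_subset_G by auto
        next
          fix e f q z1 z2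
          assume z: "z1 \<in> K" "g' * z1 = z1 * c e powi q" "z2 \<in> K" "h' * z2 = z2 * c f powi q"
          \<comment> \<open>The exponent of the edge powers is a conjugacy invariant of
            \<open>g'\<close> and \<open>h'\<close>, so these powers are no longer than
            \<open>g'\<close> and \<open>h'\<close> and the bound in \<open>K\<close> applies to
            both halves.\<close>
          have "\<sigma> g' = q" "\<sigma> h' = q"
            using arg_cong[OF z(2), of \<sigma>] arg_cong[OF z(4), of \<sigma>] by (simp_all add: sigma_mult)
          then have q: "len Y (c e powi q) \<le> len Y g'" "len Y (c f powi q) \<le> len Y h'"
            using sigma_len[OF g'(1)] sigma_len[OF h'(1)] len_edge_powi[of e q] len_edge_powi[of f q] by auto
          have K: "c e powi q \<in> K" "c f powi q \<in> K"
            by simp_all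
          obtain y1 where y1: "y1 \<in> K" "g' * y1 = y1 * c e powi q"
              "len Y2 y1 \<le> B * (len Y g' + len Y (c e powi q) + 1)"
            using conjK[OF g'(1) K(1) z(1,2)] by blast
          obtain y2 where y2: "y2 \<in> K" "h' * y2 = y2 * c f powi q"
              "len Y2 y2 \<le> B * (len Y h' + len Y (c f powi q) + 1)"
            using conjK[OF h'(1) K(2) z(3,4)] by blast
          \<comment> \<open>If the two edge generators differ, then \<open>f = (\<not> e)\<close>
            and a single stable letter conjugates one power to the other.\<close>
          define b where "b = (if e = f then 1 else T e)"
          have b: "b \<in> G" "len Y2 b \<le> 1" "c e powi q * b = b * c f powi q"
            using len_stable[of e] edge_stable[of e q] by (auto simp: b_def)
          have y: "y1 \<in> G" "y2 \<in> G"
            using y1 y2 K_subset_G by auto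
          have "g' * (y1 * (b * inverse y2)) = y1 * (b * (c f powi q * inverse y2))"
            using y1(2) b(3) by (metis mult.assoc)
          also have "c f powi q * inverse y2 = inverse y2 * h'"
            using y2(2) by (metis grp_eq_inverse_mult grp_eq_mult_inverse mult.assoc)
          finally have conj: "g' * (y1 * (b * inverse y2)) = y1 * (b * inverse y2) * h'"
            by (simp add: mult.assoc)
          have "len Y2 (y1 * (b * inverse y2)) \<le> len Y2 y1 + (len Y2 b + len Y2 y2)"
            using len_mult[of y1 Y2 "b * inverse y2"] len_mult[of b Y2 "inverse y2"] y b by simp
          also have "\<dots> \<le> B * (4 * len Y2 g + 1) + (1 + B * (4 * len Y2 h + 1))"
          proof (intro add_mono b)
            show "len Y2 y1 \<le> B * (4 * len Y2 g + 1)"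
              using g'(2) q(1) by (intro le_trans[OF y1(3)] mult_le_mono2) simp
            show "len Y2 y2 \<le> B * (4 * len Y2 h + 1)"
              using h'(2) q(2) by (intro le_trans[OF y2(3)] mult_le_mono2) simp
          qed
          also have "\<dots> \<le> (8 * C + 4 * B + 18) * (len Y2 g + len Y2 h + 1)"
            by (simp add: algebra_simps)
          finally show ?thesis
            using lift[OF zg(1) zh(1) g'(3) h'(3) zg(2) zh(2) _ conj] y b by simp
        qed
      qed
    qed
  qed
qed

end

section \<open>A faithful model of the groups\<close>

subsection \<open>Reduced words and substitutions\<close>

definition reduced :: "'a word \<Rightarrow> bool" where
  "reduced x \<longleftrightarrow> successively (\<lambda>k l. l \<noteq> (fst k, \<not> snd k)) x"

definition push :: "'a \<times> bool \<Rightarrow> 'a word \<Rightarrow> 'a word" where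
  "push l x = (if x \<noteq> [] \<and> hd x = (fst l, \<not> snd l) then tl x else l # x)"

text \<open>Left multiplication in the free group, with cancellation only at the head of the reduced
  word \<open>x\<close>. In particular \<open>act w []\<close> is the free reduction of
  \<open>w\<close>.\<close>

definition act :: "'a word \<Rightarrow> 'a word \<Rightarrow> 'a word" where
  "act w x = foldr push w x"

lemma act_Nil [simp]: "act [] x = x"
  by (simp add: act_def)

lemma act_Cons [simp]: "act (l # w) x = push l (act w x)"
  by (simp add: act_def)

lemma act_append [simp]: "act (w @ w') x = act w (act w' x)"
  by (simp add: act_def)

lemma reduced_Nil [simp]: "reduced []"
  by (simp add: reduced_def)

lemma reduced_Cons:
  "reduced (l # x) \<longleftrightarrow> reduced x \<and> (x = [] \<or> hd x \<noteq> (fst l, \<not> snd l))"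
  by (auto simp: reduced_def successively_Cons)

lemma reduced_append:
  "reduced (x @ y) \<longleftrightarrow> reduced x \<and> reduced y \<and>
    (x = [] \<or> y = [] \<or> hd y \<noteq> (fst (last x), \<not> snd (last x)))"
  by (auto simp: reduced_def successively_append_iff)

lemma reduced_push [simp]: "reduced x \<Longrightarrow> reduced (push l x)"
  by (cases x) (auto simp: push_def reduced_Cons)

lemma reduced_act [simp]: "reduced x \<Longrightarrow> reduced (act w x)"
  by (induction w) auto

lemma push_push: "reduced x \<Longrightarrow> push (i, b) (push (i, \<not> b) x) = x"
  by (cases x; cases "tl x") (auto simp: push_def reduced_Cons)

lemma push_push' [simp]:
  "reduced x \<Longrightarrow> push (i, True) (push (i, False) x) = x"
  "reduced x \<Longrightarrow> push (i, False) (push (i, True) x) = x"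
  using push_push[of x i True] push_push[of x i False] by simp_all

lemma act_reduced: "reduced x \<Longrightarrow> act x [] = x"
  by (induction x) (auto simp: reduced_Cons push_def)

lemma inv_word_simps [simp]:
  "inv_word [] = []" "inv_word (l # w) = inv_word w @ [(fst l, \<not> snd l)]"
  "inv_word (w @ w') = inv_word w' @ inv_word w"
  by (auto simp: inv_word_def case_prod_beta)

lemma act_inv_word [simp]: "reduced x \<Longrightarrow> act (inv_word w) (act w x) = x"
proof (induction w arbitrary: x)
  case (Cons l w)
  then show ?case
    using push_push[of "act w x" "fst l" "\<not> snd l"] by simp
qed simp

lemma inv_word_inv_word [simp]: "inv_word (inv_word w) = w"
  by (induction w) auto

lemma act_act_inv_word [simp]: "reduced x \<Longrightarrow> act w (act (inv_word w) x) = x"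
  using act_inv_word[of x "inv_word w"] by simp

definition subst_letter :: "('a \<Rightarrow> 'b word) \<Rightarrow> 'a \<times> bool \<Rightarrow> 'b word" where
  "subst_letter f l = (if snd l then f (fst l) else inv_word (f (fst l)))"

definition subst :: "('a \<Rightarrow> 'b word) \<Rightarrow> 'a word \<Rightarrow> 'b word" where
  "subst f w = concat (map (subst_letter f) w)"

definition endo :: "('a \<Rightarrow> 'b word) \<Rightarrow> 'a word \<Rightarrow> 'b word" where
  "endo f x = act (subst f x) []"

lemma subst_simps [simp]:
  "subst f [] = []" "subst f (l # w) = subst_letter f l @ subst f w"
  "subst f (w @ w') = subst f w @ subst f w'"
  by (auto simp: subst_def)

lemma subst_letter_inv: "subst_letter f (i, \<not> b) = inv_word (subst_letter f (i, b))"
  by (simp add: subst_letter_def)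

lemma subst_inv_word: "subst f (inv_word w) = inv_word (subst f w)"
  by (induction w) (auto simp: subst_letter_def)

lemma reduced_endo [simp]: "reduced (endo f x)"
  by (simp add: endo_def)

lemma endo_push:
  assumes "reduced x"
  shows "endo f (push l x) = act (subst_letter f l) (endo f x)"
proof (cases "x \<noteq> [] \<and> hd x = (fst l, \<not> snd l)")
  case True
  then obtain y where x: "x = (fst l, \<not> snd l) # y"
    by (cases x) auto
  have "endo f x = act (inv_word (subst_letter f l)) (endo f y)"
    using subst_letter_inv[of f "fst l" "snd l"] by (simp add: x endo_def)
  then show ?thesis
    by (simp add: x push_def)
next
  case False
  then show ?thesis
    by (auto simp: push_def endo_def)
qed

lemma endo_act: "reduced x \<Longrightarrow> endo f (act w x) = act (subst f w) (endo f x)"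
  by (induction w) (simp_all add: endo_push)

lemma endo_endo:
  assumes "\<And>i y. reduced y \<Longrightarrow> act (subst f (g i)) y = push (i, True) y" and "reduced x"
  shows "endo f (endo g x) = x"
proof -
  have inv: "act (subst f (inv_word (g i))) y = push (i, False) y" if "reduced y" for i y
  proof -
    have "y = act (subst f (g i)) (push (i, False) y)"
      using assms(1) that by simp
    then have "act (inv_word (subst f (g i))) y = push (i, False) y"
      by (metis act_inv_word reduced_push that)
    then show ?thesis
      by (simp add: subst_inv_word)
  qed
  have "act (subst f (subst g w)) [] = act w []" for w
  proof (induction w)
    case (Cons l w)
    then show ?case
      using assms(1)[of "act w []" "fst l"] inv[of "act w []" "fst l"]
      by (cases l) (auto simp: subst_letter_def)
  qed simp
  then show ?thesis
    using endo_act[of "[]" f "subst g x"] assms(2) act_reduced[of x] by (simp add: endo_def)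
qed

section \<open>The automorphism and its inverse on words\<close>

definition phi_word :: "nat \<Rightarrow> nat word" where
  "phi_word i = (if i \<le> 1 then [(i, True)] else [(i, True), (i - 1, True)])"

text \<open>Solving \<open>\<phi>(a_{i+1}) = a_{i+1} a_i\<close> gives
  \<open>\<psi>(a_{i+1}) = a_{i+1} \<psi>(a_i)^-1\<close>. The index 0 is a letter fixed by both
  maps, so that they are inverse to each other on all reduced words over \<open>nat\<close>.\<close>

fun psi_word :: "nat \<Rightarrow> nat word" where
  "psi_word 0 = [(0, True)]"
| "psi_word (Suc i) = (Suc i, True) # (if i = 0 then [] else inv_word (psi_word i))"

lemma phi_psi: "reduced y \<Longrightarrow> act (subst phi_word (psi_word i)) y = push (i, True) y"
proof (induction i arbitrary: y)
  case 0
  then show ?case by (simp add: phi_word_def subst_letter_def)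
next
  case (Suc i)
  show ?case
  proof (cases "i = 0")
    case True
    then show ?thesis by (simp add: phi_word_def subst_letter_def)
  next
    case False
    have "y = act (subst phi_word (psi_word i)) (push (i, False) y)"
      using Suc by simp
    then have "act (inv_word (subst phi_word (psi_word i))) y = push (i, False) y"
      by (metis act_inv_word reduced_push Suc.prems)
    moreover have "phi_word (Suc i) = [(Suc i, True), (i, True)]"
      using False by (simp add: phi_word_def)
    ultimately show ?thesis
      using False Suc.prems by (simp add: subst_letter_def subst_inv_word)
  qed
qed

lemma psi_phi: "reduced y \<Longrightarrow> act (subst psi_word (phi_word i)) y = push (i, True) y"
  by (cases i) (auto simp: phi_word_def subst_letter_def)

lemma endo_phi_psi [simp]: "reduced x \<Longrightarrow> endo phi_word (endo psi_word x) = x"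
  by (rule endo_endo[OF phi_psi])

lemma endo_psi_phi [simp]: "reduced x \<Longrightarrow> endo psi_word (endo phi_word x) = x"
  by (rule endo_endo[OF psi_phi])

subsection \<open>The group acting on reduced words\<close>

text \<open>
  The integer component records the exponent sum of the stable letter; the group is only a
  container for the elements \<open>letter i\<close> and \<open>twist\<close> below.
\<close>

typedef model = "{p :: (nat word \<Rightarrow> nat word) \<times> int. bij (fst p)}"
  by (rule exI[of _ "(id, 0)"]) simp

setup_lifting type_definition_model

instantiation model :: grp
begin

lift_definition one_model :: model is "(id, 0)"
  by simp

lift_definition times_model :: "model \<Rightarrow> model \<Rightarrow> model" is
  "\<lambda>p q. (fst p \<circ> fst q, snd p + snd q)"
  by (simp add: bij_comp)

lift_definition inverse_model :: "model \<Rightarrow> model" is "\<lambda>p. (inv_into UNIV (fst p), - snd p)"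
  by (simp add: bij_imp_bij_inv)

definition divide_model :: "model \<Rightarrow> model \<Rightarrow> model" where
  "divide_model x y = x * inverse y"

instance
  by standard (transfer; simp add: comp_assoc bij_is_inj)+

end

lift_definition sigma :: "model \<Rightarrow> int" is snd .

lift_definition app :: "model \<Rightarrow> nat word \<Rightarrow> nat word" is fst .

text \<open>The type consists of bijections of all lists, so maps of reduced words are extended by
  the identity.\<close>

definition on_reduced :: "('a word \<Rightarrow> 'a word) \<Rightarrow> 'a word \<Rightarrow> 'a word" where
  "on_reduced f x = (if reduced x then f x else x)"

lemma bij_on_reduced:
  assumes "\<And>x. reduced x \<Longrightarrow> reduced (f x) \<and> reduced (g x) \<and> f (g x) = x \<and> g (f x) = x"
  shows "bij (on_reduced f)"
  by (rule o_bij[of "on_reduced g"]) (auto simp: on_reduced_def fun_eq_iff assms)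

lemma bij_push: "bij (on_reduced (push (i, True)))"
  by (rule bij_on_reduced[where g = "push (i, False)"]) simp

lemma bij_endo_psi: "bij (on_reduced (endo psi_word))"
  by (rule bij_on_reduced[where g = "endo phi_word"]) simp

lift_definition letter0 :: "nat \<Rightarrow> model" is "\<lambda>i. (on_reduced (push (i, True)), 0)"
  by (simp add: bij_push)

text \<open>The action is by the inverse automorphism: \<open>s^-1 a s = \<phi>(a)\<close> means
  that conjugation \<open>a \<mapsto> s a s^-1\<close> is \<open>\<psi>\<close>. Free generators act
  by left multiplication and \<open>s\<close> fixes the empty word, which is the action on the
  cosets of \<open><s>\<close>.\<close>

lift_definition twist :: model is "(on_reduced (endo psi_word), 1)"
  by (simp add: bij_endo_psi)

text \<open>With \<open>letter 0 = 1\<close> the relation for \<open>a\<^sub>1\<close> is not exceptional.\<close>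

definition letter :: "nat \<Rightarrow> model" where
  "letter i = (if i = 0 then 1 else letter0 i)"

lemma sigma_simps [simp]:
  "sigma 1 = 0" "sigma (x * y) = sigma x + sigma y" "sigma (inverse x) = - sigma x"
  "sigma (letter i) = 0" "sigma twist = 1"
  unfolding letter_def by (auto, (transfer, simp)+)

lemma sigma_powi [simp]: "sigma (x powi p) = p * sigma x"
  by (rule additive_on_powi[of "{x}"]) (auto simp: additive_on_def)

lemma app_mult [simp]: "app 1 x = x" "app (g * h) x = app g (app h x)"
  by (transfer, simp)+

lemma app_inverse [simp]: "app (inverse g) (app g x) = x"
  by (metis app_mult grp_left_inverse)

lemma app_letter [simp]: "i \<noteq> 0 \<Longrightarrow> reduced x \<Longrightarrow> app (letter i) x = push (i, True) x"
  unfolding letter_def by (simp, transfer, simp add: on_reduced_def)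

lemma app_twist [simp]: "reduced x \<Longrightarrow> app twist x = endo psi_word x"
  by (transfer, simp add: on_reduced_def)

lemma app_letter_inverse [simp]:
  "i \<noteq> 0 \<Longrightarrow> reduced x \<Longrightarrow> app (inverse (letter i)) x = push (i, False) x"
  by (metis app_inverse app_letter push_push'(1) reduced_push)

lemma app_twist_inverse [simp]: "reduced x \<Longrightarrow> app (inverse twist) x = endo phi_word x"
  by (metis app_inverse app_twist endo_psi_phi reduced_endo)

lemma letter_0 [simp]: "letter 0 = 1"
  by (simp add: letter_def)

lemma twist_letter: "twist * (letter (Suc i) * letter i) = letter (Suc i) * twist"
proof -
  have "twist * (letter0 (Suc i) * letter i) = letter0 (Suc i) * twist"
  proof (cases "i = 0")
    case True
    then show ?thesis
      by (simp, transfer) (auto simp: on_reduced_def fun_eq_iff endo_push subst_letter_def)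
  next
    case False
    then have "letter i = letter0 i"
      by (simp add: letter_def)
    then show ?thesis
      using False
      by (simp, transfer) (auto simp: on_reduced_def fun_eq_iff endo_push subst_letter_def)
  qed
  then show ?thesis
    by (simp add: letter_def)
qed

lemma twist_conj_letter:
  "inverse twist * letter (Suc i) * twist = letter (Suc i) * letter i"
  using twist_letter[of i] by (metis grp_eq_inverse_mult mult.assoc)

section \<open>Normal forms in the semidirect product\<close>

definition word_elem :: "nat word \<Rightarrow> model" where
  "word_elem w = prod_list (map (\<lambda>l. if snd l then letter (fst l) else inverse (letter (fst l))) w)"

lemma word_elem_simps [simp]:
  "word_elem [] = 1" "word_elem (l # w) = (if snd l then letter (fst l) else inverse (letter (fst l))) * word_elem w"
  "word_elem (w @ w') = word_elem w * word_elem w'"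
  by (simp_all add: word_elem_def)

definition reduced_words :: "nat \<Rightarrow> nat word set" where
  "reduced_words m = {x. reduced x \<and> fst ` set x \<subseteq> {1..m}}"

lemma reduced_words_Nil [simp]: "[] \<in> reduced_words m"
  by (simp add: reduced_words_def)

lemma app_elem: "0 \<notin> fst ` set w \<Longrightarrow> reduced x \<Longrightarrow> app (word_elem w) x = act w x"
  by (induction w) auto

lemma app_twist_powi [simp]: "app (twist powi p) [] = []"
proof (induction p rule: int_induct[where k = 0])
  case (step1 i)
  then show ?case by (simp add: powi_Suc endo_def)
next
  case (step2 i)
  have "twist powi (i - 1) = twist powi i * inverse twist"
    by (simp add: powi_diff)
  then show ?case
    using step2 by (simp add: endo_def)
qed simp

text \<open>Powers of \<open>twist\<close> fix the empty word, so the image of \<open>[]\<close> is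
  the free part of the element, and \<open>sigma\<close> gives the exponent.\<close>

lemma normal_form_unique:
  assumes "x \<in> reduced_words m" "y \<in> reduced_words m" "word_elem x * twist powi p = word_elem y * twist powi q"
  shows "x = y" "p = q"
proof -
  have app: "app (word_elem z * twist powi r) [] = z" if "z \<in> reduced_words m" for z r
    using that by (subst app_mult, subst app_twist_powi, subst app_elem)
      (auto simp: reduced_words_def act_reduced)
  then show "x = y"
    using assms by metis
  have "sigma (word_elem z) = 0" for z
    by (induction z) auto
  then show "p = q"
    using arg_cong[OF assms(3), of sigma] by simp
qed

lemma set_push: "set (push l x) \<subseteq> insert l (set x)"
  by (cases x) (auto simp: push_def)

lemma set_act: "set (act w x) \<subseteq> set w \<union> set x"
  using set_push by (induction w) force+

lemma fst_set_inv_word [simp]: "fst ` set (inv_word w) = fst ` set w"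
  by (induction w) auto

lemma push_reduced_words:
  "x \<in> reduced_words m \<Longrightarrow> fst l \<in> {1..m} \<Longrightarrow> push l x \<in> reduced_words m"
  using set_push[of l x] by (fastforce simp: reduced_words_def)

lemma word_elem_push: "word_elem (push l x) = word_elem [l] * word_elem x"
  by (cases x; cases l) (auto simp: push_def)

text \<open>Each step adds exactly the two elements by which \<open>Y2\<close> enlarges
  \<open>Y\<close>, so the result of one extension is literally the base of the next.\<close>

primrec gen_set :: "nat \<Rightarrow> model set" where
  "gen_set 0 = {twist}"
| "gen_set (Suc i) = insert (letter (Suc i)) (insert (twist * inverse (letter (Suc i))) (gen_set i))"

abbreviation "free_part m \<equiv> span (letter ` {1..m})"

text \<open>Normality of the free part. For conjugation by the inverse of \<open>twist\<close> it is
  the relation; for \<open>twist\<close> it follows by induction from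
  \<open>s a_{i+1} s^-1 = a_{i+1} (s a_i s^-1)^-1\<close>.\<close>

lemma twist_free_part:
  assumes "f \<in> free_part m"
  shows "inverse twist * f * twist \<in> free_part m" "twist * f * inverse twist \<in> free_part m"
proof -
  have letter: "letter i \<in> free_part m" if "i \<le> m" for i
    using that by (cases "i = 0") auto
  have pos: "inverse twist * letter i * twist \<in> free_part m" if "i \<le> m" for i
    using that letter by (cases i) (auto simp: twist_conj_letter)
  have neg: "twist * letter i * inverse twist \<in> free_part m" if "i \<le> m" for i
    using that
  proof (induction i)
    case (Suc i)
    have "twist * letter (Suc i) = letter (Suc i) * twist * inverse (letter i)"
      using twist_letter[of i] by (metis grp_eq_mult_inverse mult.assoc)
    then have "twist * letter (Suc i) * inverse twist
        = letter (Suc i) * inverse (twist * letter i * inverse twist)"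
      by (simp add: mult.assoc)
    moreover have "letter (Suc i) * inverse (twist * letter i * inverse twist) \<in> free_part m"
      by (rule span_mult[OF letter span_inverse]) (use Suc in auto)
    ultimately show ?case
      by (simp only:)
  qed simp
  show "inverse twist * f * twist \<in> free_part m"
    using assms
  proof (induction rule: span_induct)
    case (gen y g)
    have "(inverse twist * y * twist) * (inverse twist * g * twist) \<in> free_part m"
      by (rule span_mult[OF _ gen.IH]) (use gen.hyps pos in auto)
    then show ?case by (simp add: mult.assoc)
  next
    case (inv y g)
    have "inverse (inverse twist * y * twist) * (inverse twist * g * twist) \<in> free_part m"
      by (rule span_mult[OF span_inverse inv.IH]) (use inv.hyps pos in auto)
    then show ?case by (simp add: mult.assoc)
  qed simp
  show "twist * f * inverse twist \<in> free_part m"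
    using assms
  proof (induction rule: span_induct)
    case (gen y g)
    have "(twist * y * inverse twist) * (twist * g * inverse twist) \<in> free_part m"
      by (rule span_mult[OF _ gen.IH]) (use gen.hyps neg in auto)
    then show ?case by (simp add: mult.assoc)
  next
    case (inv y g)
    have "inverse (twist * y * inverse twist) * (twist * g * inverse twist) \<in> free_part m"
      by (rule span_mult[OF span_inverse inv.IH]) (use inv.hyps neg in auto)
    then show ?case by (simp add: mult.assoc)
  qed simp
qed

lemma free_part_elem:
  assumes "f \<in> free_part m"
  obtains x where "x \<in> reduced_words m" "f = word_elem x"
proof -
  have "\<exists>x \<in> reduced_words m. f = word_elem x"
    using assms
  proof (induction rule: span_induct)
    case one
    show ?case by (rule bexI[of _ "[]"]) simp_all
  next
    case (gen y g)
    then obtain i x where "i \<in> {1..m}" "y = letter i" "x \<in> reduced_words m" "g = word_elem x"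
      by auto
    then show ?case
      using push_reduced_words[of x m "(i, True)"] word_elem_push[of "(i, True)" x]
      by (intro bexI[of _ "push (i, True) x"]) auto
  next
    case (inv y g)
    then obtain i x where "i \<in> {1..m}" "y = letter i" "x \<in> reduced_words m" "g = word_elem x"
      by auto
    then show ?case
      using push_reduced_words[of x m "(i, False)"] word_elem_push[of "(i, False)" x]
      by (intro bexI[of _ "push (i, False) x"]) auto
  qed
  then show ?thesis using that by blast
qed

lemma gen_set_span: "gen_set m \<subseteq> span (insert twist (letter ` {1..m}))"
proof (induction m)
  case (Suc m)
  have "span (insert twist (letter ` {1..m})) \<subseteq> span (insert twist (letter ` {1..Suc m}))"
    by (rule span_mono) auto
  then show ?case
    using Suc by auto
qed auto

lemma letter_gen_set: "1 \<le> i \<Longrightarrow> i \<le> m \<Longrightarrow> letter i \<in> gen_set m"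
  by (induction m) (auto simp: le_Suc_eq)

lemma twist_gen_set [simp]: "twist \<in> gen_set m"
  by (induction m) auto

lemma span_gen_set: "span (gen_set m) = span (insert twist (letter ` {1..m}))"
proof (intro antisym span_subset[OF gen_set_span] span_mono)
  show "insert twist (letter ` {1..m}) \<subseteq> gen_set m"
    by (auto intro: letter_gen_set)
qed

lemma normal_form_aux:
  assumes "g \<in> span (insert twist (letter ` {1..m}))"
  shows "\<exists>f \<in> free_part m. g = f * twist powi sigma g"
  using assms
proof (induction rule: span_induct)
  case one
  show ?case by (intro bexI[of _ 1]) simp_all
next
  case (gen y g)
  then obtain f where f: "f \<in> free_part m" "g = f * twist powi sigma g"
    by blast
  show ?case
  proof (cases "y = twist")
    case True
    then have "y * g = (twist * f * inverse twist) * twist powi sigma (y * g)"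
      using f(2)[symmetric] by (simp add: powi_add mult.assoc)
    then show ?thesis
      using twist_free_part(2)[OF f(1)] by blast
  next
    case False
    then have "y \<in> letter ` {1..m}" "sigma y = 0"
      using gen.hyps by auto
    then show ?thesis
      using f by (intro bexI[of _ "y * f"]) (auto simp: mult.assoc)
  qed
next
  case (inv y g)
  then obtain f where f: "f \<in> free_part m" "g = f * twist powi sigma g"
    by blast
  show ?case
  proof (cases "y = twist")
    case True
    have "twist powi (sigma g - 1) = inverse twist * twist powi sigma g"
      using powi_add[of twist "- 1" "sigma g"] powi_minus[of twist 1] by simp
    with True have "inverse y * g = (inverse twist * f * twist) * twist powi sigma (inverse y * g)"
      using f(2)[symmetric] by (simp add: mult.assoc)
    then show ?thesis
      using twist_free_part(1)[OF f(1)] by blast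
  next
    case False
    then have "y \<in> letter ` {1..m}" "sigma y = 0"
      using inv.hyps by auto
    then show ?thesis
      using f by (intro bexI[of _ "inverse y * f"]) (auto simp: mult.assoc)
  qed
qed

lemma normal_form:
  assumes "g \<in> span (gen_set m)"
  obtains x where "x \<in> reduced_words m" "g = word_elem x * twist powi sigma g"
  using normal_form_aux[of g m] assms free_part_elem by (metis span_gen_set)


subsection \<open>Exponent sums\<close>

definition eps :: "nat \<Rightarrow> nat word \<Rightarrow> int" where
  "eps i x = (\<Sum>l\<leftarrow>x. if fst l = i then (if snd l then 1 else - 1) else 0)"

lemma eps_simps [simp]:
  "eps i [] = 0" "eps i (l # x) = (if fst l = i then (if snd l then 1 else - 1) else 0) + eps i x"
  "eps i (x @ y) = eps i x + eps i y"
  by (simp_all add: eps_def)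

lemma eps_push: "eps i (push l x) = eps i [l] + eps i x"
  by (cases x) (auto simp: push_def)

lemma eps_act: "eps i (act w x) = eps i w + eps i x"
  by (induction w) (auto simp: eps_push)

lemma eps_inv_word [simp]: "eps i (inv_word w) = - eps i w"
  by (induction w) auto

lemma eps_eq_0: "i \<notin> fst ` set x \<Longrightarrow> eps i x = 0"
  by (induction x) auto

lemma set_psi_word: "fst ` set (psi_word k) \<subseteq> {..k}" "k \<noteq> 0 \<Longrightarrow> 0 \<notin> fst ` set (psi_word k)"
  by (induction k) auto

lemma set_phi_word: "fst ` set (phi_word k) \<subseteq> {..k}" "k \<noteq> 0 \<Longrightarrow> 0 \<notin> fst ` set (phi_word k)"
  by (auto simp: phi_word_def)

lemma eps_psi_word: "k \<noteq> 0 \<Longrightarrow> k \<le> Suc i \<Longrightarrow>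
    eps (Suc i) (psi_word k) = (if k = Suc i then 1 else 0)"
    "k \<noteq> 0 \<Longrightarrow> k \<le> Suc (Suc i) \<Longrightarrow>
    eps (Suc i) (psi_word k) = (if k = Suc i then 1 else if k = Suc (Suc i) then - 1 else 0)"
proof -
  have 0: "eps j (psi_word k) = 0" if "k < j" for j k
    using set_psi_word(1)[of k] that by (intro eps_eq_0) auto
  then show "k \<noteq> 0 \<Longrightarrow> k \<le> Suc i \<Longrightarrow> eps (Suc i) (psi_word k) = (if k = Suc i then 1 else 0)"
    by (cases k) auto
  show "k \<noteq> 0 \<Longrightarrow> k \<le> Suc (Suc i) \<Longrightarrow>
      eps (Suc i) (psi_word k) = (if k = Suc i then 1 else if k = Suc (Suc i) then - 1 else 0)"
    using 0[of _ "Suc i"] by (cases k) (auto simp: le_Suc_eq)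
qed

lemma eps_phi_word: "k \<noteq> 0 \<Longrightarrow> k \<le> Suc i \<Longrightarrow>
    eps (Suc i) (phi_word k) = (if k = Suc i then 1 else 0)"
    "k \<noteq> 0 \<Longrightarrow> k \<le> Suc (Suc i) \<Longrightarrow>
    eps (Suc i) (phi_word k) = (if k = Suc i then 1 else if k = Suc (Suc i) then 1 else 0)"
  by (auto simp: phi_word_def)

lemma eps_endo:
  assumes "\<And>k. k \<in> fst ` set x \<Longrightarrow> eps i (f k) = eps i [(k, True)] + c * eps j [(k, True)]"
  shows "eps i (endo f x) = eps i x + c * eps j x"
proof -
  have "eps i (subst f x) = eps i x + c * eps j x"
    using assms by (induction x) (auto simp: subst_letter_def algebra_simps split: if_splits)
  then show ?thesis
    by (simp add: endo_def eps_act)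
qed

lemma endo_reduced_words:
  assumes "\<And>k. k \<in> {1..m} \<Longrightarrow> fst ` set (f k) \<subseteq> {1..m}" "x \<in> reduced_words m"
  shows "endo f x \<in> reduced_words m"
proof -
  have x: "fst ` set x \<subseteq> {1..m}"
    using assms(2) by (simp add: reduced_words_def)
  have "fst ` set (subst_letter f l) \<subseteq> {1..m}" if "fst l \<in> {1..m}" for l
    using assms(1)[OF that] by (simp add: subst_letter_def)
  then have "fst ` set (subst f x) \<subseteq> {1..m}"
    using x by (induction x) (simp_all add: image_Un)
  then show ?thesis
    using set_act[of "subst f x" "[]"] by (auto simp: reduced_words_def endo_def)
qed

lemma letters_in_range:
  assumes "k \<in> {1..m}"
  shows "fst ` set (psi_word k) \<subseteq> {1..m}" "fst ` set (phi_word k) \<subseteq> {1..m}"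
proof -
  have sub: "A \<subseteq> {1..m}" if A: "A \<subseteq> {..k}" "0 \<notin> A" "k \<le> m" for A and k :: nat
  proof
    fix j assume "j \<in> A"
    then have "j \<le> k" "j \<noteq> 0"
      using A by (blast, metis)
    then show "j \<in> {1..m}"
      using A(3) by simp
  qed
  show "fst ` set (psi_word k) \<subseteq> {1..m}" "fst ` set (phi_word k) \<subseteq> {1..m}"
    using assms set_psi_word[of k] set_phi_word[of k] by (intro sub[of _ k]; simp)+
qed

lemma twist_reduced_words:
  assumes "x \<in> reduced_words m"
  shows "endo psi_word x \<in> reduced_words m" "endo phi_word x \<in> reduced_words m"
  by (rule endo_reduced_words[OF letters_in_range(1) assms], assumption)
    (rule endo_reduced_words[OF letters_in_range(2) assms], assumption)

text \<open>
  On the exponent sums of \<open>a\<^sub>i\<close> and \<open>a\<^sub>i\<^sub>-\<^sub>1\<close> of words in \<open>a\<^sub>1, \<dots>, a\<^sub>i\<close> the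
  group acts through the Heisenberg group.
\<close>

definition heisenberg :: "nat \<Rightarrow> model \<Rightarrow> int \<Rightarrow> int \<Rightarrow> bool" where
  "heisenberg i g a b \<longleftrightarrow> (\<forall>x \<in> reduced_words i. app g x \<in> reduced_words i \<and>
     eps i (app g x) = eps i x + b \<and>
     (2 \<le> i \<longrightarrow> eps (i - 1) (app g x) = eps (i - 1) x + a - sigma g * eps i x))"

text \<open>For \<open>2 \<le> i\<close> this is the multiplication of the integral Heisenberg group
  in the coordinates \<open>a\<close>, \<open>b\<close> and \<open>sigma\<close>, with
  \<open>a\<close> central.\<close>

lemma heisenberg_mult:
  assumes g: "heisenberg i g a b" and h: "heisenberg i h a' b'"
  shows "heisenberg i (g * h) (a + a' - sigma g * b') (b + b')"
  unfolding heisenberg_def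
proof (intro ballI)
  fix x assume "x \<in> reduced_words i"
  then have hx: "app h x \<in> reduced_words i" "eps i (app h x) = eps i x + b'"
      "2 \<le> i \<longrightarrow> eps (i - 1) (app h x) = eps (i - 1) x + a' - sigma h * eps i x"
    using h by (auto simp: heisenberg_def)
  have gx: "app g (app h x) \<in> reduced_words i" "eps i (app g (app h x)) = eps i (app h x) + b"
      "2 \<le> i \<longrightarrow> eps (i - 1) (app g (app h x)) = eps (i - 1) (app h x) + a - sigma g * eps i (app h x)"
    using g hx(1) by (auto simp: heisenberg_def)
  show "app (g * h) x \<in> reduced_words i \<and> eps i (app (g * h) x) = eps i x + (b + b') \<and>
      (2 \<le> i \<longrightarrow> eps (i - 1) (app (g * h) x) =
        eps (i - 1) x + (a + a' - sigma g * b') - sigma (g * h) * eps i x)"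
    using gx(1) by (auto simp: gx(2) gx(3)[rule_format] hx(2) hx(3)[rule_format] algebra_simps simp del: One_nat_def)
qed

lemma heisenberg_twist:
  assumes "i \<noteq> 0"
  shows "heisenberg i twist 0 0" "heisenberg i (inverse twist) 0 0"
proof -
  obtain j where j: "i = Suc j"
    using assms by (cases i) auto
  have *: "app twist x \<in> reduced_words i \<and> app (inverse twist) x \<in> reduced_words i \<and>
      eps i (app twist x) = eps i x \<and> eps i (app (inverse twist) x) = eps i x \<and>
      (2 \<le> i \<longrightarrow> eps (i - 1) (app twist x) = eps (i - 1) x - eps i x \<and>
        eps (i - 1) (app (inverse twist) x) = eps (i - 1) x + eps i x)" if x: "x \<in> reduced_words i" for x
  proof -
    have r: "reduced x" "\<And>k. k \<in> fst ` set x \<Longrightarrow> k \<noteq> 0 \<and> k \<le> i"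
      using x by (auto simp: reduced_words_def)
    have "eps i (endo psi_word x) = eps i x + 0 * eps i x" "eps i (endo phi_word x) = eps i x + 0 * eps i x"
      using r eps_psi_word(1)[of _ j] eps_phi_word(1)[of _ j] by (intro eps_endo; auto simp: j)+
    moreover have "eps (i - 1) (endo psi_word x) = eps (i - 1) x + (- 1) * eps i x"
        "eps (i - 1) (endo phi_word x) = eps (i - 1) x + 1 * eps i x" if i: "2 \<le> i"
    proof -
      obtain k where "j = Suc k"
        using i j by (cases j) auto
      then show "eps (i - 1) (endo psi_word x) = eps (i - 1) x + (- 1) * eps i x"
        "eps (i - 1) (endo phi_word x) = eps (i - 1) x + 1 * eps i x"
        using r eps_psi_word(2)[of _ k] eps_phi_word(2)[of _ k] by (intro eps_endo; auto simp: j)+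
    qed
    ultimately show ?thesis
      using x r twist_reduced_words by auto
  qed
  then show "heisenberg i twist 0 0" "heisenberg i (inverse twist) 0 0"
    by (auto simp: heisenberg_def)
qed

lemma heisenberg_letter:
  assumes "j \<in> {1..i}"
  shows "heisenberg i (letter j) (eps (i - 1) [(j, True)]) (eps i [(j, True)])"
    "heisenberg i (inverse (letter j)) (eps (i - 1) [(j, False)]) (eps i [(j, False)])"
  using assms push_reduced_words[of _ i "(j, True)"] push_reduced_words[of _ i "(j, False)"]
  by (auto simp: heisenberg_def eps_push reduced_words_def)

lemma heisenberg_exists:
  assumes "i \<noteq> 0" "g \<in> span (gen_set i)"
  shows "\<exists>a b. heisenberg i g a b"
proof -
  have "g \<in> span (insert twist (letter ` {1..i}))"
    using assms(2) by (simp add: span_gen_set)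
  then show ?thesis
  proof (induction rule: span_induct)
    case one
    show ?case by (intro exI[of _ 0]) (simp add: heisenberg_def)
  next
    case (gen y g)
    then have "\<exists>a b. heisenberg i y a b"
      using heisenberg_twist(1) heisenberg_letter(1) assms(1) by blast
    then show ?case using gen heisenberg_mult by blast
  next
    case (inv y g)
    then have "\<exists>a b. heisenberg i (inverse y) a b"
      using heisenberg_twist(2) heisenberg_letter(2) assms(1) by blast
    then show ?case using inv heisenberg_mult by blast
  qed
qed

text \<open>Read off at the empty word, this is defined on the whole type. On
  \<open>span (gen_set i)\<close> it is the Heisenberg coordinate \<open>b\<close>, hence
  additive.\<close>

definition tau :: "nat \<Rightarrow> model \<Rightarrow> int" where
  "tau i g = eps i (app g [])"

lemma heisenberg_tau: "heisenberg i g a b \<Longrightarrow> tau i g = b"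
  unfolding heisenberg_def tau_def by (drule bspec[OF _ reduced_words_Nil]) simp

lemma tau_additive:
  assumes "i \<noteq> 0"
  shows "additive_on (span (gen_set i)) (tau i)"
  unfolding additive_on_def
proof (intro ballI)
  fix x y assume "x \<in> span (gen_set i)" "y \<in> span (gen_set i)"
  then obtain a b a' b' where xy: "heisenberg i x a b" "heisenberg i y a' b'"
    using heisenberg_exists[OF assms, of x] heisenberg_exists[OF assms, of y] by auto
  show "tau i (x * y) = tau i x + tau i y"
    using heisenberg_tau[OF heisenberg_mult[OF xy]] xy[THEN heisenberg_tau] by simp
qed

lemma tau_letter [simp]: "i \<noteq> 0 \<Longrightarrow> tau i (letter i) = 1"
  using heisenberg_tau[OF heisenberg_letter(1)[of i i]] by simp

lemma tau_twist [simp]: "tau i twist = 0"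
  by (simp add: tau_def endo_def)

lemma tau_gen_set: "y \<in> gen_set i \<Longrightarrow> tau (Suc i) y = 0"
proof -
  assume y: "y \<in> gen_set i"
  show ?thesis
  proof (cases "i = 0")
    case True
    then show ?thesis using y by simp
  next
    case False
    then obtain a b where "heisenberg i y a b"
      using heisenberg_exists y by blast
    then have "app y [] \<in> reduced_words i"
      by (auto simp: heisenberg_def)
    then show ?thesis
      by (auto simp: tau_def reduced_words_def intro!: eps_eq_0)
  qed
qed

text \<open>In the coordinates \<open>(a, b)\<close> the letter is \<open>(0, 1)\<close> and its
  conjugate by \<open>twist powi j\<close> is \<open>(j, 1)\<close>. Comparing the central
  coordinate of both products with \<open>g\<close> gives the claim.\<close>

lemma sigma_conjugator:
  assumes "2 \<le> i" "g \<in> span (gen_set i)"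
    and "letter i * g = g * (twist powi (- j) * letter i * twist powi j)"
  shows "sigma g = j"
proof -
  have twist: "heisenberg i (twist powi p) 0 0" for p
  proof (induction p rule: int_induct[where k = 0])
    case base
    then show ?case by (simp add: heisenberg_def)
  next
    case (step1 p)
    then show ?case
      using heisenberg_mult[OF step1(2) heisenberg_twist(1)] assms(1) powi_Suc[of twist p] by simp
  next
    case (step2 p)
    then show ?case
      using heisenberg_mult[OF step2(2) heisenberg_twist(2)] assms(1) by (simp add: powi_diff)
  qed
  obtain a b where ab: "heisenberg i g a b"
    using heisenberg_exists assms by force
  have l: "heisenberg i (letter i) 0 1"
    using heisenberg_letter(1)[of i i] assms(1) by (auto split: if_splits)
  have "heisenberg i (letter i * g) (0 + a - sigma (letter i) * b) (1 + b)"
    by (rule heisenberg_mult[OF l ab])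
  moreover have "heisenberg i (twist powi (- j) * letter i * twist powi j) j 1"
    using heisenberg_mult[OF heisenberg_mult[OF twist l] twist, of "- j" j] by simp
  then have "heisenberg i (letter i * g) (a + j - sigma g * 1) (b + 1)"
    unfolding assms(3) by (rule heisenberg_mult[OF ab])
  ultimately have "a = a + j - sigma g"
    using assms(1) unfolding heisenberg_def by (auto dest!: bspec[OF _ reduced_words_Nil])
  then show ?thesis by simp
qed

subsection \<open>The tower of HNN extensions\<close>

abbreviation "edge' i \<equiv> edge twist (twist * inverse (letter i))"

lemma twisted_gen_set: "i \<noteq> 0 \<Longrightarrow> twist * inverse (letter i) \<in> gen_set i"
  by (cases i) auto

lemma twist_conj_stable: "twist * letter (Suc i) = letter (Suc i) * (twist * inverse (letter i))"
  using twist_letter[of i] by (metis grp_eq_mult_inverse mult.assoc)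

lemma sigma_edge [simp]: "sigma (edge' i e) = 1"
  by (simp add: edge_def)

lemma edge_span: "i \<noteq> 0 \<Longrightarrow> edge' i e \<in> span (gen_set i)"
  using twisted_gen_set by (auto simp: edge_def)

text \<open>Both edge generators have \<open>sigma\<close> equal to 1, so the free part is a
  complement of either edge group and serves as a transversal for both.\<close>

lemma edge_transversal:
  assumes "i \<noteq> 0" "g \<in> span (gen_set i)"
  obtains y where "y \<in> reduced_words i" "g = word_elem y * edge' i e powi sigma g"
proof -
  have "g * inverse (edge' i e powi sigma g) \<in> span (gen_set i)"
    using assms edge_span by blast
  then obtain y where "y \<in> reduced_words i" "g * inverse (edge' i e powi sigma g) = word_elem y"
    using normal_form[of "g * inverse (edge' i e powi sigma g)" i] by auto
  then show ?thesis
    using that[of y] by (metis grp_eq_mult_inverse)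
qed

text \<open>Split \<open>g\<close> into a free part and an edge power, move the power across the
  first stable letter and continue to the right. Freeness from pinches excludes cancellation of the
  letters \<open>a_{i+1}\<close>, so the part of the reduced word before the first of them
  represents the coset of \<open>g\<close> modulo the edge group.\<close>

lemma path_normal_form:
  assumes i: "i \<noteq> 0" and "successively (pinch_free twist (twist * inverse (letter i))) r"
    "snd ` set r \<subseteq> span (gen_set i)" "g \<in> span (gen_set i)" "u \<in> span (gen_set i)"
  shows "\<exists>x\<in>reduced_words (Suc i). \<exists>p. g * path (letter (Suc i)) r * u = word_elem x * twist powi p \<and>
    (r = [] \<longrightarrow> x \<in> reduced_words i) \<and>
    (r \<noteq> [] \<longrightarrow> (\<exists>y\<in>reduced_words i. \<exists>x' q. x = y @ (Suc i, fst (hd r)) # x' \<and>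
       g = word_elem y * edge' i (fst (hd r)) powi q))"
  using assms(2-)
proof (induction r arbitrary: g)
  case Nil
  then have "g * u \<in> span (gen_set i)"
    by simp
  then obtain x p where "x \<in> reduced_words i" "g * u = word_elem x * twist powi p"
    using normal_form by blast
  then show ?case
    by (intro bexI[of _ x] exI[of _ p]) (auto simp: reduced_words_def)
next
  case (Cons l r)
  obtain e h where l: "l = (e, h)" by (cases l)
  have h: "h \<in> span (gen_set i)" "successively (pinch_free twist (twist * inverse (letter i))) r"
    using Cons.prems by (auto simp: l successively_Cons)
  obtain y where y: "y \<in> reduced_words i" "g = word_elem y * edge' i e powi sigma g"
    using edge_transversal[OF i Cons.prems(3)] .
  define q where "q = sigma g"
  let ?h = "edge' i (\<not> e) powi q * h"
  have hK: "?h \<in> span (gen_set i)"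
    using h edge_span[OF i] by blast
  obtain x p where x: "x \<in> reduced_words (Suc i)"
      "?h * path (letter (Suc i)) r * u = word_elem x * twist powi p"
      "r = [] \<longrightarrow> x \<in> reduced_words i"
      "r \<noteq> [] \<longrightarrow> (\<exists>y\<in>reduced_words i. \<exists>x' q. x = y @ (Suc i, fst (hd r)) # x' \<and>
        ?h = word_elem y * edge' i (fst (hd r)) powi q)"
    using Cons.IH[OF h(2) _ hK Cons.prems(4)] Cons.prems(2) by auto
  have "g * path (letter (Suc i)) (l # r) * u
      = word_elem y * (edge' i e powi q * stable (letter (Suc i)) e) * (h * path (letter (Suc i)) r * u)"
    by (subst y(2)) (simp add: l q_def mult.assoc)
  also have "\<dots> = word_elem y * stable (letter (Suc i)) e * (?h * path (letter (Suc i)) r * u)"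
    unfolding edge_powi_stable[OF twist_conj_stable] by (simp add: mult.assoc)
  also have "\<dots> = word_elem (y @ (Suc i, e) # x) * twist powi p"
    unfolding x(2) by (simp add: stable_def mult.assoc)
  finally have eq: "g * path (letter (Suc i)) (l # r) * u = word_elem (y @ (Suc i, e) # x) * twist powi p" .
  \<comment> \<open>A cancellation would make the next coset representative empty, so
    \<open>?h\<close> and hence \<open>h\<close> would lie in the edge group opposite to
    \<open>e\<close>: a pinch.\<close>
  have hd: "hd x \<noteq> (Suc i, \<not> e)" if "x \<noteq> []"
  proof (cases "r = []")
    case True
    then have "hd x \<in> set x" "fst ` set x \<subseteq> {1..i}"
      using x(3) \<open>x \<noteq> []\<close> by (auto simp: reduced_words_def)
    then show ?thesis by force
  next
    case False
    then obtain y' x' q' where y': "y' \<in> reduced_words i" "x = y' @ (Suc i, fst (hd r)) # x'"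
        "?h = word_elem y' * edge' i (fst (hd r)) powi q'"
      using x(4) by blast
    show ?thesis
    proof
      assume hd: "hd x = (Suc i, \<not> e)"
      have "y' = []"
        using y'(1,2) hd by (cases y') (auto simp: reduced_words_def)
      then have "fst (hd r) = (\<not> e)" "?h = edge' i (\<not> e) powi q'"
        using y' hd by auto
      then have "edge' i (\<not> e) powi q * h = edge' i (\<not> e) powi q * edge' i (\<not> e) powi (q' - q)"
        by (simp add: powi_add[symmetric])
      then have "h = edge' i (\<not> e) powi (q' - q)"
        by (simp only: grp_left_cancel)
      then show False
        using Cons.prems(1) False \<open>fst (hd r) = (\<not> e)\<close>
        by (auto simp: l successively_Cons pinch_free_def)
    qed
  qed
  have "reduced (y @ (Suc i, e) # x)"
  proof -
    have "last y \<in> set y \<Longrightarrow> fst (last y) \<le> i"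
      using y(1) by (auto simp: reduced_words_def)
    then show ?thesis
      using y(1) x(1) hd by (cases "y = []") (auto simp: reduced_append reduced_Cons reduced_words_def)
  qed
  then have "y @ (Suc i, e) # x \<in> reduced_words (Suc i)"
    using y(1) x(1) by (auto simp: reduced_words_def)
  moreover have "g = word_elem y * edge' i e powi q"
    using y(2) by (simp add: q_def)
  ultimately show ?case
    using eq y(1) by (intro bexI[of _ "y @ (Suc i, e) # x"] exI[of _ p]) (auto simp: l)
qed

lemma append_Cons_split_unique:
  assumes "y @ a # x = y' @ a' # x'" "\<forall>b\<in>set y \<union> set y'. Q b" "\<not> Q a" "\<not> Q a'"
  shows "y = y' \<and> a = a'"
  using assms
proof (induction y arbitrary: y')
  case Nil
  then show ?case by (cases y') auto
next
  case (Cons b y)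
  then show ?case by (cases y') auto
qed

text \<open>The reduced word of the element determines whether a letter \<open>a_{i+1}\<close>
  occurs, the sign of the first one and the part before it. Equal parts mean equal cosets of the
  edge group.\<close>

lemma britton_model:
  assumes i: "i \<noteq> 0"
    and r: "successively (pinch_free twist (twist * inverse (letter i))) r"
      "snd ` set r \<subseteq> span (gen_set i)"
    and r': "successively (pinch_free twist (twist * inverse (letter i))) r'"
      "snd ` set r' \<subseteq> span (gen_set i)"
    and K: "g \<in> span (gen_set i)" "h \<in> span (gen_set i)" "u \<in> span (gen_set i)"
    and eq: "g * path (letter (Suc i)) r * u = h * path (letter (Suc i)) r'"
  shows "r = [] \<and> r' = [] \<or>
    (\<exists>e x r1 y r1' p. r = (e, x) # r1 \<and> r' = (e, y) # r1' \<and> h = g * edge' i e powi p)"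
proof -
  obtain x p where x: "x \<in> reduced_words (Suc i)"
      "g * path (letter (Suc i)) r * u = word_elem x * twist powi p" "r = [] \<longrightarrow> x \<in> reduced_words i"
      "r \<noteq> [] \<longrightarrow> (\<exists>y\<in>reduced_words i. \<exists>x' q. x = y @ (Suc i, fst (hd r)) # x' \<and>
        g = word_elem y * edge' i (fst (hd r)) powi q)"
    using path_normal_form[OF i r K(1,3)] by blast
  obtain x2 p2 where x2: "x2 \<in> reduced_words (Suc i)"
      "h * path (letter (Suc i)) r' * 1 = word_elem x2 * twist powi p2" "r' = [] \<longrightarrow> x2 \<in> reduced_words i"
      "r' \<noteq> [] \<longrightarrow> (\<exists>y\<in>reduced_words i. \<exists>x' q. x2 = y @ (Suc i, fst (hd r')) # x' \<and>
        h = word_elem y * edge' i (fst (hd r')) powi q)"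
    using path_normal_form[OF i r' K(2) span_one] by blast
  have "x = x2"
    using normal_form_unique(1)[OF x(1) x2(1)] x(2) x2(2) eq by simp
  have no: "y @ (Suc i, e) # z \<notin> reduced_words i" for y e z
    by (auto simp: reduced_words_def)
  show ?thesis
  proof (cases "r = [] \<or> r' = []")
    case True
    then show ?thesis
      using x(3,4) x2(3,4) no \<open>x = x2\<close> by metis
  next
    case False
    then obtain y z q where y: "y \<in> reduced_words i" "x = y @ (Suc i, fst (hd r)) # z"
        "g = word_elem y * edge' i (fst (hd r)) powi q"
      using x(4) by blast
    obtain y' z' q' where y': "y' \<in> reduced_words i" "x2 = y' @ (Suc i, fst (hd r')) # z'"
        "h = word_elem y' * edge' i (fst (hd r')) powi q'"
      using x2(4) False by blast
    have "y = y' \<and> (Suc i, fst (hd r)) = (Suc i, fst (hd r'))"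
      using y(1,2) y'(1,2) \<open>x = x2\<close>
      by (intro append_Cons_split_unique[of y _ z y' _ z' "\<lambda>b. fst b \<le> i"])
        (auto simp: reduced_words_def)
    then have "fst (hd r) = fst (hd r')" "h = g * edge' i (fst (hd r)) powi (q' - q)"
      using y(3) y'(3) powi_add[of "edge' i (fst (hd r))" "q" "q' - q"] by (auto simp: mult.assoc)
    then show ?thesis
      using False by (cases r; cases r') (auto simp: prod_eq_iff)
  qed
qed

lemma sigma_gen_set: "y \<in> gen_set i \<Longrightarrow> \<bar>sigma y\<bar> \<le> 1"
  by (induction i) auto

lemma hnn_gen_set:
  assumes "i \<noteq> 0"
  shows "hnn (gen_set i) (letter (Suc i)) twist (twist * inverse (letter i)) sigma (tau (Suc i))"
proof
  show "additive_on UNIV sigma"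
    by (simp add: additive_on_def)
  show "additive_on (span (insert (letter (Suc i)) (insert (twist * inverse (letter (Suc i))) (gen_set i))))
      (tau (Suc i))"
    using tau_additive[of "Suc i"] by simp
  \<comment> \<open>\<open>sigma\<close> gives \<open>p = q\<close>, and the exponent of
    \<open>a_i\<close> is 0 on the left and \<open>- q\<close> on the right.\<close>
  fix p q assume eq: "twist powi p = (twist * inverse (letter i)) powi q"
  have "p = q"
    using arg_cong[OF eq, of sigma] by simp
  have s: "twist \<in> span (gen_set i)" "letter i \<in> span (gen_set i)"
    using assms letter_gen_set[of i i] by auto
  note tau = additive_on_powi[OF tau_additive[OF assms]] additive_onD[OF tau_additive[OF assms]]
    additive_on_inverse[OF tau_additive[OF assms]]
  show "p = 0"
    using arg_cong[OF eq, of "tau i"] s assms \<open>p = q\<close> by (simp add: tau)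
next
  fix r r' g h u
  assume "successively (pinch_free twist (twist * inverse (letter i))) r"
    "successively (pinch_free twist (twist * inverse (letter i))) r'"
    "snd ` set r \<subseteq> span (gen_set i)" "snd ` set r' \<subseteq> span (gen_set i)"
    "g \<in> span (gen_set i)" "h \<in> span (gen_set i)" "u \<in> span (gen_set i)"
    "g * path (letter (Suc i)) r * u = h * path (letter (Suc i)) r'"
  then show "r = [] \<and> r' = [] \<or>
      (\<exists>e x r1 y r1' p. r = (e, x) # r1 \<and> r' = (e, y) # r1' \<and> h = g * edge' i e powi p)"
    by (intro britton_model[OF assms])
qed (use assms in \<open>simp_all add: twisted_gen_set twist_conj_stable tau_gen_set sigma_gen_set\<close>)

section \<open>The abelian base and the induction up the tower\<close>

lemma level_one_commute:
  assumes "g \<in> span (gen_set 1)" "h \<in> span (gen_set 1)"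
  shows "g * h = h * g"
proof -
  have comm: "twist * letter (Suc 0) = letter (Suc 0) * twist"
    using twist_letter[of 0] by simp
  have S: "span (gen_set 1) = span {twist, letter (Suc 0)}"
    using span_gen_set[of 1] by simp
  have h: "h * y = y * h" if "y \<in> {twist, letter (Suc 0)}" for y
    using assms(2) unfolding S by (rule span_commute[rotated]) (use that comm in auto)
  show ?thesis
    by (rule span_commute[OF h[symmetric] assms(1)[unfolded S]])
qed

text \<open>At level 1 everything commutes: equal edge generators are always parallel, different
  ones are separated by the exponent of \<open>a_1\<close>, and conjugate elements are equal, so the
  trivial conjugator serves.\<close>

lemma level_one:
  "axes_diverge (gen_set 1) (edge' 1 e) (edge' 1 f) 1" "conj_bounded (gen_set 1) 0"
proof -
  have T: "twist \<in> span (gen_set 1)" "letter 1 \<in> span (gen_set 1)"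
    by auto
  have tau: "tau 1 (twist * inverse (letter 1)) = - 1"
    using additive_onD[OF tau_additive, of 1 twist "inverse (letter 1)"]
      additive_on_inverse[OF tau_additive, of 1 "letter 1"] T by simp
  have gen: "\<bar>tau 1 z\<bar> \<le> 1" if "z \<in> gen_set 1" for z
    using that tau tau_letter[of 1] by auto
  show "axes_diverge (gen_set 1) (edge' 1 e) (edge' 1 f) 1"
  proof (cases "e = f")
    case True
    then show ?thesis
      using level_one_commute edge_span[of 1 e] unfolding axes_diverge_def by auto
  next
    case False
    then show ?thesis
      by (intro axes_diverge_additive[OF tau_additive gen edge_span edge_span])
        (use tau in \<open>auto simp: edge_def\<close>)
  qed
  show "conj_bounded (gen_set 1) 0"
    unfolding conj_bounded_def
  proof (intro ballI impI)
    fix g h z assume *: "g \<in> span (gen_set 1)" "z \<in> span (gen_set 1)" "g * z = z * h"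
    then have "z * g = z * h"
      using level_one_commute[OF *(1,2)] by simp
    then have "g = h"
      by simp
    then show "\<exists>z'\<in>span (gen_set 1). g * z' = z' * h \<and>
        len (gen_set 1) z' \<le> 0 * (len (gen_set 1) g + len (gen_set 1) h + 1)"
      by (intro bexI[of _ 1]) auto
  qed
qed

lemma conj_bounded_gen_set:
  assumes "1 \<le> m"
  shows "\<exists>B. conj_bounded (gen_set m) B"
proof -
  have "(\<exists>C. \<forall>e f. axes_diverge (gen_set m) (edge' m e) (edge' m f) C) \<and> (\<exists>B. conj_bounded (gen_set m) B)"
    using assms
  proof (induction m rule: dec_induct)
    case base
    show ?case using level_one by blast
  next
    case (step i)
    interpret hnn "gen_set i" "letter (Suc i)" twist "twist * inverse (letter i)" sigma "tau (Suc i)"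
      by (rule hnn_gen_set) (use step in simp)
    obtain C B where "\<And>e f. axes_diverge (gen_set i) (edge' i e) (edge' i f) C" "conj_bounded (gen_set i) B"
      using step.IH by blast
    then show ?case
      using diverge_step[of C] conj_bounded_step[of C B] by auto
  qed
  then show ?thesis by blast
qed

section \<open>Transfer to the presented group\<close>

text \<open>\<open>b\<close> enters twice: once for the lengths of the given elements and once for
  the conjugator.\<close>

lemma conj_bounded_change_gens:
  assumes "conj_bounded Y B" "span Y = span Z" and b: "\<And>y. y \<in> Y \<Longrightarrow> len Z y \<le> b" "\<And>z. z \<in> Z \<Longrightarrow> len Y z \<le> b"
  shows "conj_bounded Z (b * B * (b + 1))"
  unfolding conj_bounded_def
proof (intro ballI impI)
  fix g h z assume gh: "g \<in> span Z" "h \<in> span Z" "z \<in> span Z" "g * z = z * h"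
  then obtain z' where z': "z' \<in> span Z" "g * z' = z' * h" "len Y z' \<le> B * (len Y g + len Y h + 1)"
    using assms(1,2) unfolding conj_bounded_def by blast
  have Y: "y \<in> span Z \<and> len Z y \<le> b" if "y \<in> Y" for y
    using that b(1) assms(2) by (metis span_gen)
  have Z: "z \<in> span Y \<and> len Y z \<le> b" if "z \<in> Z" for z
    using that b(2) assms(2) by (metis span_gen)
  have "len Z z' \<le> b * len Y z'"
    using z'(1) Y assms(2) by (intro len_scale) auto
  also have "\<dots> \<le> b * (B * (len Y g + len Y h + 1))"
    using z'(3) by (rule mult_le_mono2)
  also have "\<dots> \<le> b * (B * ((b + 1) * (len Z g + len Z h + 1)))"
  proof -
    have "len Y g \<le> b * len Z g" "len Y h \<le> b * len Z h"
      using gh Z by (auto intro: len_scale)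
    then have "len Y g + len Y h + 1 \<le> (b + 1) * (len Z g + len Z h + 1)"
      by (simp add: algebra_simps)
    then show ?thesis by (intro mult_le_mono2)
  qed
  finally have "len Z z' \<le> b * B * (b + 1) * (len Z g + len Z h + 1)"
    by (simp only: mult.assoc)
  then show "\<exists>z'\<in>span Z. g * z' = z' * h \<and> len Z z' \<le> b * B * (b + 1) * (len Z g + len Z h + 1)"
    using z' by blast
qed

section \<open>Evaluation of words of the presentation in the model\<close>

primrec gen_val :: "gen \<Rightarrow> model" where
  "gen_val (Gen i) = letter i"
| "gen_val Stable = twist"

definition eval_word :: "gen word \<Rightarrow> model" where
  "eval_word w = prod_list (map (\<lambda>l. if snd l then gen_val (fst l) else inverse (gen_val (fst l))) w)"

lemma eval_word_simps [simp]:
  "eval_word [] = 1"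
  "eval_word (l # w) = (if snd l then gen_val (fst l) else inverse (gen_val (fst l))) * eval_word w"
  "eval_word (w @ w') = eval_word w * eval_word w'"
  by (simp_all add: eval_word_def)

abbreviation "H_rel m \<equiv> pres_rel (gens m) (H_relations m)"
abbreviation "H_class m \<equiv> pres_class (gens m) (H_relations m)"
abbreviation "H_words m \<equiv> words_on (gens m)"

lemma eval_word_phi: "1 \<le> i \<Longrightarrow> eval_word (phi i) = letter i * letter (i - 1)"
  by (simp add: phi_def)

lemma eval_word_sound: "(u, v) \<in> H_rel m \<Longrightarrow> eval_word u = eval_word v"
proof (induction rule: pres_rel.induct)
  case (relation u v)
  then obtain i where "1 \<le> i" "u = [(Stable, False), (Gen i, True), (Stable, True)]" "v = phi i"
    by (auto simp: H_relations_def)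
  then show ?case
    using twist_conj_letter[of "i - 1"] by (simp add: eval_word_phi mult.assoc)
qed auto

lemma H_rel_cong:
  "(u, v) \<in> H_rel m \<Longrightarrow> a \<in> H_words m \<Longrightarrow> b \<in> H_words m \<Longrightarrow> (a @ u @ b, a @ v @ b) \<in> H_rel m"
  by (intro pres_rel.append pres_rel.refl)

lemma H_rel_cong_left: "(u, v) \<in> H_rel m \<Longrightarrow> a \<in> H_words m \<Longrightarrow> (a @ u, a @ v) \<in> H_rel m"
  by (intro pres_rel.append pres_rel.refl)

lemma H_rel_cong_right: "(u, v) \<in> H_rel m \<Longrightarrow> b \<in> H_words m \<Longrightarrow> (u @ b, v @ b) \<in> H_rel m"
  by (intro pres_rel.append pres_rel.refl)

lemma inv_word_cancel_right: "u \<in> H_words m \<Longrightarrow> (u @ inv_word u, []) \<in> H_rel m"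
  using inv_word_cancel[of "inv_word u" "gens m"] by (simp add: inv_word_words_on)

lemma H_rel_swap_inv:
  assumes "(s @ g, g' @ s) \<in> H_rel m" "s \<in> H_words m" "g \<in> H_words m" "g' \<in> H_words m"
  shows "(s @ inv_word g, inv_word g' @ s) \<in> H_rel m"
proof -
  note w = assms(2-4) inv_word_words_on[OF assms(3)] inv_word_words_on[OF assms(4)]
  have "([] @ (s @ inv_word g), (inv_word g' @ g') @ (s @ inv_word g)) \<in> H_rel m"
    using w by (intro H_rel_cong_right pres_rel.sym[OF inv_word_cancel]) auto
  moreover have "(inv_word g' @ (g' @ s) @ inv_word g, inv_word g' @ (s @ g) @ inv_word g) \<in> H_rel m"
    using w by (intro H_rel_cong pres_rel.sym[OF assms(1)])
  moreover have "((inv_word g' @ s) @ (g @ inv_word g), (inv_word g' @ s) @ []) \<in> H_rel m"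
    using w by (intro H_rel_cong_left inv_word_cancel_right) auto
  ultimately show ?thesis
    unfolding append_assoc append_Nil append_Nil2 by (blast intro: pres_rel.trans)
qed

section \<open>Rewriting words to normal form by the relations\<close>

abbreviation lift :: "nat word \<Rightarrow> gen word" where
  "lift w \<equiv> map (\<lambda>l. (Gen (fst l), snd l)) w"

lemma lift_words: "fst ` set w \<subseteq> {1..m} \<Longrightarrow> lift w \<in> H_words m"
  by (induction w) (auto simp: gens_def)

lemma lift_inv_word: "lift (inv_word w) = inv_word (lift w)"
  by (induction w) auto

lemma Stable_words [simp]: "[(Stable, b)] \<in> H_words m"
  by (simp add: gens_def)

lemma Stable_gens [simp]: "Stable \<in> gens m"
  by (simp add: gens_def)

lemma lift_push:
  assumes "fst l \<in> {1..m}" "fst ` set x \<subseteq> {1..m}"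
  shows "(lift (l # x), lift (push l x)) \<in> H_rel m"
proof (cases "x \<noteq> [] \<and> hd x = (fst l, \<not> snd l)")
  case True
  then obtain y where x: "x = (fst l, \<not> snd l) # y"
    by (cases x) auto
  have "([(Gen (fst l), snd l), (Gen (fst l), \<not> snd l)] @ lift y, [] @ lift y) \<in> H_rel m"
    using assms x lift_words[of y m] by (intro H_rel_cong_right pres_rel.cancel) (auto simp: gens_def)
  then show ?thesis
    by (simp add: x push_def)
next
  case False
  then have "push l x = l # x"
    by (auto simp: push_def)
  then show ?thesis
    using lift_words[of "l # x" m] assms by (simp only:) (intro pres_rel.refl, auto)
qed

lemma lift_act:
  assumes "fst ` set w \<subseteq> {1..m}"
  shows "(lift w, lift (act w [])) \<in> H_rel m"
  using assms
proof (induction w)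
  case Nil
  then show ?case by (simp add: pres_rel.refl)
next
  case (Cons l w)
  have "fst ` set (act w []) \<subseteq> {1..m}"
    using Cons.prems set_act[of w "[]"] by auto
  then have "(lift (l # act w []), lift (act (l # w) [])) \<in> H_rel m"
    using Cons.prems lift_push[of l m "act w []"] by simp
  moreover have "([(Gen (fst l), snd l)] @ lift w, [(Gen (fst l), snd l)] @ lift (act w [])) \<in> H_rel m"
    using Cons by (intro H_rel_cong_left) (auto simp: gens_def)
  ultimately show ?case
    using pres_rel.trans by fastforce
qed

text \<open>It suffices to know how the stable letter passes positive letters: inverse letters
  follow from \<open>H_rel_swap_inv\<close>, and free reduction of the result is derivable by
  \<open>lift_act\<close>.\<close>

lemma lift_endo:
  assumes letters: "\<And>k. k \<in> {1..m} \<Longrightarrow> fst ` set (f k) \<subseteq> {1..m}"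
    and swap: "\<And>k. k \<in> {1..m} \<Longrightarrow> ([(Stable, b)] @ [(Gen k, True)], lift (f k) @ [(Stable, b)]) \<in> H_rel m"
    and x: "fst ` set x \<subseteq> {1..m}"
  shows "([(Stable, b)] @ lift x, lift (endo f x) @ [(Stable, b)]) \<in> H_rel m"
proof -
  have sub: "fst ` set (subst_letter f l) \<subseteq> {1..m}" if "fst l \<in> {1..m}" for l
    using letters[OF that] by (simp add: subst_letter_def)
  have letter: "([(Stable, b)] @ lift [l], lift (subst_letter f l) @ [(Stable, b)]) \<in> H_rel m"
    if l: "fst l \<in> {1..m}" for l
  proof (cases "snd l")
    case True
    then show ?thesis
      using swap[OF l] by (simp add: subst_letter_def)
  next
    case False
    have "([(Stable, b)] @ inv_word [(Gen (fst l), True)], inv_word (lift (f (fst l))) @ [(Stable, b)]) \<in> H_rel m"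
      using l letters[OF l] by (intro H_rel_swap_inv swap lift_words) (auto simp: gens_def)
    then show ?thesis
      using False by (simp add: subst_letter_def lift_inv_word)
  qed
  have all: "fst ` set (subst f x) \<subseteq> {1..m}"
    using x sub by (induction x) (simp_all add: image_Un)
  have "([(Stable, b)] @ lift x, lift (subst f x) @ [(Stable, b)]) \<in> H_rel m"
    using x
  proof (induction x)
    case Nil
    then show ?case by (simp add: pres_rel.refl)
  next
    case (Cons l x)
    have l: "fst l \<in> {1..m}" "fst ` set x \<subseteq> {1..m}"
      using Cons.prems by auto
    have "(([(Stable, b)] @ lift [l]) @ lift x, (lift (subst_letter f l) @ [(Stable, b)]) @ lift x) \<in> H_rel m"
      using letter[OF l(1)] lift_words[OF l(2)] by (rule H_rel_cong_right)
    moreover have "(lift (subst_letter f l) @ ([(Stable, b)] @ lift x),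
        lift (subst_letter f l) @ (lift (subst f x) @ [(Stable, b)])) \<in> H_rel m"
      using Cons.IH[OF l(2)] lift_words[OF sub[OF l(1)]] by (rule H_rel_cong_left)
    ultimately have "(([(Stable, b)] @ lift [l]) @ lift x,
        lift (subst_letter f l) @ (lift (subst f x) @ [(Stable, b)])) \<in> H_rel m"
      unfolding append_assoc by (rule pres_rel.trans)
    then show ?case by simp
  qed
  moreover have "(lift (subst f x) @ [(Stable, b)], lift (endo f x) @ [(Stable, b)]) \<in> H_rel m"
    unfolding endo_def by (rule H_rel_cong_right[OF lift_act[OF all] Stable_words])
  ultimately show ?thesis
    by (rule pres_rel.trans)
qed

lemma lift_phi_word: "k \<noteq> 0 \<Longrightarrow> lift (phi_word k) = phi k"
  by (auto simp: phi_word_def phi_def)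

lemma Stable_phi:
  assumes "k \<in> {1..m}"
  shows "([(Stable, False)] @ [(Gen k, True)], lift (phi_word k) @ [(Stable, False)]) \<in> H_rel m"
    "([(Stable, True)] @ lift (phi_word k), [(Gen k, True)] @ [(Stable, True)]) \<in> H_rel m"
proof -
  have w: "[(Gen k, True)] \<in> H_words m" "lift (phi_word k) \<in> H_words m"
    using assms lift_words letters_in_range(2)[OF assms] by (auto simp: gens_def)
  have rel: "([(Stable, False), (Gen k, True), (Stable, True)], lift (phi_word k)) \<in> H_rel m"
    using assms w by (intro pres_rel.relation) (auto simp: H_relations_def gens_def lift_phi_word)
  have c: "([(Stable, b), (Stable, \<not> b)], []) \<in> H_rel m" for b
    by (intro pres_rel.cancel) (simp add: gens_def)
  have "([(Stable, False), (Gen k, True)] @ [(Stable, True), (Stable, False)],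
      [(Stable, False), (Gen k, True)] @ []) \<in> H_rel m"
    using w c[of True] by (intro H_rel_cong_left) auto
  moreover have "([(Stable, False), (Gen k, True), (Stable, True)] @ [(Stable, False)],
      lift (phi_word k) @ [(Stable, False)]) \<in> H_rel m"
    using rel by (rule H_rel_cong_right) simp
  ultimately show "([(Stable, False)] @ [(Gen k, True)], lift (phi_word k) @ [(Stable, False)]) \<in> H_rel m"
    by (simp) (meson pres_rel.sym pres_rel.trans)
  have "([(Stable, True)] @ [(Stable, False), (Gen k, True), (Stable, True)],
      [(Stable, True)] @ lift (phi_word k)) \<in> H_rel m"
    using rel by (rule H_rel_cong_left) simp
  moreover have "([(Stable, True), (Stable, False)] @ [(Gen k, True), (Stable, True)],
      [] @ [(Gen k, True), (Stable, True)]) \<in> H_rel m"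
    using w c[of True] by (intro H_rel_cong_right) auto
  ultimately show "([(Stable, True)] @ lift (phi_word k), [(Gen k, True)] @ [(Stable, True)]) \<in> H_rel m"
    by (simp) (meson pres_rel.sym pres_rel.trans)
qed

text \<open>The relations mention only \<open>\<phi>\<close>. The rule for \<open>\<psi>\<close>
  comes from \<open>s a_{k+1} = s a_{k+1} a_k a_k^-1 = a_{k+1} s a_k^-1\<close> and the rule for
  \<open>a_k\<close>.\<close>

lemma Stable_psi:
  assumes "k \<in> {1..m}"
  shows "([(Stable, True)] @ [(Gen k, True)], lift (psi_word k) @ [(Stable, True)]) \<in> H_rel m"
  using assms
proof (induction k)
  case (Suc k)
  show ?case
  proof (cases "k = 0")
    case True
    then show ?thesis
      using Stable_phi(2)[OF Suc.prems] by (simp add: phi_word_def)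
  next
    case False
    then have k: "k \<in> {1..m}"
      using Suc.prems by auto
    have w: "[(Gen k, b)] \<in> H_words m" "[(Gen (Suc k), b)] \<in> H_words m" "lift (psi_word k) \<in> H_words m" for b
      using k Suc.prems lift_words letters_in_range(1)[OF k] by (auto simp: gens_def)
    have "(([(Stable, True)] @ [(Gen (Suc k), True)]) @ [(Gen k, True), (Gen k, False)],
        ([(Stable, True)] @ [(Gen (Suc k), True)]) @ []) \<in> H_rel m"
      using k w pres_rel.cancel[of "Gen k" "gens m" True] by (intro H_rel_cong_left) (auto simp: gens_def)
    moreover have "([(Stable, True)] @ lift (phi_word (Suc k)), [(Gen (Suc k), True)] @ [(Stable, True)]) \<in> H_rel m"
      by (rule Stable_phi(2)[OF Suc.prems])
    then have "(([(Stable, True)] @ lift (phi_word (Suc k))) @ [(Gen k, False)],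
        ([(Gen (Suc k), True)] @ [(Stable, True)]) @ [(Gen k, False)]) \<in> H_rel m"
      using w by (intro H_rel_cong_right)
    moreover have "([(Stable, True)] @ inv_word [(Gen k, True)], inv_word (lift (psi_word k)) @ [(Stable, True)]) \<in> H_rel m"
      using Suc.IH[OF k] w by (intro H_rel_swap_inv) auto
    then have "([(Gen (Suc k), True)] @ ([(Stable, True)] @ [(Gen k, False)]),
        [(Gen (Suc k), True)] @ (inv_word (lift (psi_word k)) @ [(Stable, True)])) \<in> H_rel m"
      using w by (intro H_rel_cong_left) auto
    ultimately show ?thesis
      using False by (simp add: phi_word_def lift_inv_word) (meson pres_rel.sym pres_rel.trans)
  qed
qed simp

definition stable_power :: "int \<Rightarrow> gen word" where
  "stable_power k = replicate (nat \<bar>k\<bar>) (Stable, 0 \<le> k)"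

lemma stable_power_words [simp]: "stable_power k \<in> H_words m"
proof -
  have "replicate n (Stable, b) \<in> H_words m" for n b
    by (induction n) (auto simp: gens_def)
  then show ?thesis by (simp add: stable_power_def)
qed

lemma stable_power_up: "0 \<le> k \<Longrightarrow> stable_power (k + 1) = (Stable, True) # stable_power k"
  by (simp add: stable_power_def nat_add_distrib)

lemma stable_power_down: "k \<le> 0 \<Longrightarrow> stable_power (k - 1) = (Stable, False) # stable_power k"
proof -
  assume "k \<le> 0"
  then have "nat \<bar>k - 1\<bar> = Suc (nat \<bar>k\<bar>)" "0 \<le> k \<Longrightarrow> nat \<bar>k\<bar> = 0"
    by auto
  with \<open>k \<le> 0\<close> show ?thesis
    by (cases "k = 0") (auto simp: stable_power_def)
qed

lemma stable_power_step:
  "([(Stable, b)] @ stable_power k, stable_power (if b then k + 1 else k - 1)) \<in> H_rel m"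
proof -
  have cancel: "([(Stable, b)] @ ((Stable, \<not> b) # stable_power j), stable_power j) \<in> H_rel m" for j b
    using H_rel_cong_right[OF pres_rel.cancel[OF Stable_gens] stable_power_words[of j m], of b] by simp
  consider "b" "0 \<le> k" | "\<not> b" "k \<le> 0" | "b" "k < 0" | "\<not> b" "0 < k"
    by linarith
  then show ?thesis
  proof cases
    case 1
    then show ?thesis
      using pres_rel.refl[OF stable_power_words[of "k + 1" m]] by (simp add: stable_power_up)
  next
    case 2
    then show ?thesis
      using pres_rel.refl[OF stable_power_words[of "k - 1" m]] by (simp add: stable_power_down)
  next
    case 3
    then show ?thesis
      using cancel[of True "k + 1"] stable_power_down[of "k + 1"] by simp
  next
    case 4
    then show ?thesis
      using cancel[of False "k - 1"] stable_power_up[of "k - 1"] by simp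
  qed
qed

text \<open>The normal form is computed by the action on the empty word and reached by the relations
  alone. Words with the same value thus have a common normal form, which makes the model
  faithful.\<close>

lemma word_normal_form:
  assumes "u \<in> H_words m"
  shows "app (eval_word u) [] \<in> reduced_words m \<and>
    (u, lift (app (eval_word u) []) @ stable_power (sigma (eval_word u))) \<in> H_rel m"
  using assms
proof (induction u)
  case Nil
  then show ?case by (simp add: stable_power_def pres_rel.refl)
next
  case (Cons l u)
  define x where "x = app (eval_word u) []"
  define k where "k = sigma (eval_word u)"
  have x: "x \<in> reduced_words m" "(u, lift x @ stable_power k) \<in> H_rel m" "reduced x" "fst ` set x \<subseteq> {1..m}"
    using Cons by (auto simp: x_def k_def reduced_words_def)
  have l: "[l] \<in> H_words m"
    using Cons.prems by simp
  have u: "([l] @ u, [l] @ (lift x @ stable_power k)) \<in> H_rel m"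
    using x(2) l by (rule H_rel_cong_left)
  obtain y b where yb: "l = (y, b)" by (cases l)
  show ?case
  proof (cases y)
    case (Gen i)
    then have i: "i \<in> {1..m}"
      using l by (auto simp: yb gens_def)
    have "(lift ((i, b) # x) @ stable_power k, lift (push (i, b) x) @ stable_power k) \<in> H_rel m"
      using lift_push[of "(i, b)" m x] i x by (intro H_rel_cong_right) auto
    moreover have "app (eval_word (l # u)) [] = push (i, b) x" "sigma (eval_word (l # u)) = k"
      using i x(3) by (auto simp: yb Gen x_def[symmetric] k_def)
    ultimately show ?thesis
      using u push_reduced_words[OF x(1), of "(i, b)"] i
      by (simp add: yb Gen) (meson pres_rel.trans)
  next
    case Stable
    define f where "f = (if b then psi_word else phi_word)"
    have swap: "([(Stable, b)] @ lift x, lift (endo f x) @ [(Stable, b)]) \<in> H_rel m"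
      using letters_in_range Stable_psi Stable_phi(1) x(4) by (intro lift_endo) (auto simp: f_def)
    have fx: "endo f x \<in> reduced_words m"
      using twist_reduced_words[OF x(1)] by (simp add: f_def)
    then have fxw: "lift (endo f x) \<in> H_words m"
      by (intro lift_words) (auto simp: reduced_words_def)
    have "(([(Stable, b)] @ lift x) @ stable_power k, (lift (endo f x) @ [(Stable, b)]) @ stable_power k) \<in> H_rel m"
      using swap by (rule H_rel_cong_right) simp
    moreover have "(lift (endo f x) @ ([(Stable, b)] @ stable_power k),
        lift (endo f x) @ stable_power (if b then k + 1 else k - 1)) \<in> H_rel m"
      using stable_power_step fxw by (rule H_rel_cong_left)
    moreover have "app (eval_word (l # u)) [] = endo f x"
        "sigma (eval_word (l # u)) = (if b then k + 1 else k - 1)"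
      using x(3) by (auto simp: yb Stable x_def[symmetric] k_def f_def)
    ultimately show ?thesis
      using u fx by (simp only: yb Stable append_assoc append_Cons append_Nil) (meson pres_rel.trans)
  qed
qed

lemma eval_word_complete:
  assumes "u \<in> H_words m" "v \<in> H_words m" "eval_word u = eval_word v"
  shows "(u, v) \<in> H_rel m"
  using word_normal_form[OF assms(1), THEN conjunct2]
    word_normal_form[OF assms(2), THEN conjunct2, THEN pres_rel.sym]
  unfolding assms(3) by (rule pres_rel.trans)

text \<open>By soundness all words of a class have the same value, so the image is a singleton on
  the carrier.\<close>

definition to_model :: "gen word set \<Rightarrow> model" where
  "to_model A = the_elem (eval_word ` A)"

lemma to_model_class:
  assumes "u \<in> H_words m"
  shows "to_model (H_class m u) = eval_word u"
proof -
  have "eval_word ` H_class m u = {eval_word u}"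
    using assms eval_word_sound by (auto simp: pres_class_def intro: pres_rel.refl)
  then show ?thesis by (simp add: to_model_def)
qed

lemma carrier_H: "carrier (H m) = H_class m ` H_words m"
  by (simp add: H_def carrier_presented_group)

lemma to_model_mult:
  assumes "x \<in> carrier (H m)" "y \<in> carrier (H m)"
  shows "to_model (x \<otimes>\<^bsub>H m\<^esub> y) = to_model x * to_model y"
proof -
  obtain u v where uv: "u \<in> H_words m" "x = H_class m u" "v \<in> H_words m" "y = H_class m v"
    using assms by (auto simp: carrier_H)
  then have "x \<otimes>\<^bsub>H m\<^esub> y = H_class m (u @ v)"
    by (simp add: H_def mult_presented_group)
  then show ?thesis
    using uv by (simp add: to_model_class)
qed

lemma to_model_one: "to_model \<one>\<^bsub>H m\<^esub> = 1"
  using to_model_class[of "[]" m] by (simp add: H_def one_presented_group)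

lemma to_model_inv:
  assumes "x \<in> carrier (H m)"
  shows "to_model (inv\<^bsub>H m\<^esub> x) = inverse (to_model x)"
proof -
  interpret group "H m" by (rule group_H)
  have "to_model x * to_model (inv\<^bsub>H m\<^esub> x) = 1"
    using assms by (simp add: to_model_mult[symmetric] to_model_one)
  then show ?thesis
    using grp_inverse_unique by metis
qed

lemma to_model_inj:
  assumes "x \<in> carrier (H m)" "y \<in> carrier (H m)" "to_model x = to_model y"
  shows "x = y"
proof -
  obtain u v where uv: "u \<in> H_words m" "x = H_class m u" "v \<in> H_words m" "y = H_class m v"
    using assms by (auto simp: carrier_H)
  then have "(u, v) \<in> H_rel m"
    using assms(3) by (intro eval_word_complete) (simp_all add: to_model_class)
  then show ?thesis
    using uv by (simp add: pres_class_eq_iff)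
qed

section \<open>Word length for an arbitrary generating set\<close>

context
  fixes m :: nat and S :: "gen word set set"
  assumes S: "S \<subseteq> carrier (H m)"
begin

interpretation H: group "H m" by (rule group_H)

lemma word_length_word_val:
  "u \<in> words_on S \<Longrightarrow> word_length (to_model ` S) (length u) (to_model (word_val (H m) u))"
proof (induction u)
  case Nil
  then show ?case by (simp add: to_model_one word_length.one)
next
  case (Cons l u)
  obtain x b where l: "l = (x, b)" by (cases l)
  have x: "x \<in> S" "x \<in> carrier (H m)" "word_val (H m) u \<in> carrier (H m)"
    using Cons.prems S l H.word_val_closed[OF S] by auto
  then show ?case
    using Cons l word_length.gen[of "to_model x" "to_model ` S"] word_length.inv[of "to_model x" "to_model ` S"]
    by (auto simp: to_model_mult to_model_inv)
qed

lemma word_length_words_on: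
  "word_length (to_model ` S) n g \<Longrightarrow> \<exists>u\<in>words_on S. length u = n \<and> to_model (word_val (H m) u) = g"
proof (induction rule: word_length.induct)
  case one
  show ?case by (rule bexI[of _ "[]"]) (simp_all add: to_model_one)
next
  case (gen y n g)
  then obtain x u where xu: "x \<in> S" "y = to_model x" "u \<in> words_on S" "length u = n"
      "to_model (word_val (H m) u) = g"
    by auto
  then show ?case
    using S H.word_val_closed[OF S] by (intro bexI[of _ "(x, True) # u"]) (auto simp: to_model_mult)
next
  case (inv y n g)
  then obtain x u where xu: "x \<in> S" "y = to_model x" "u \<in> words_on S" "length u = n"
      "to_model (word_val (H m) u) = g"
    by auto
  then show ?case
    using S H.word_val_closed[OF S]
    by (intro bexI[of _ "(x, False) # u"]) (auto simp: to_model_mult to_model_inv)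
qed

lemma span_to_model:
  assumes "generate (H m) S = carrier (H m)"
  shows "span (to_model ` S) = to_model ` carrier (H m)"
proof
  show "span (to_model ` S) \<subseteq> to_model ` carrier (H m)"
    using word_length_words_on H.word_val_closed[OF S] unfolding span_def by blast
  show "to_model ` carrier (H m) \<subseteq> span (to_model ` S)"
  proof
    fix g assume "g \<in> to_model ` carrier (H m)"
    then obtain u where "u \<in> words_on S" "g = to_model (word_val (H m) u)"
      using H.generate_word_val[OF S] assms by auto
    then show "g \<in> span (to_model ` S)"
      using word_length_word_val unfolding span_def by blast
  qed
qed

end

lemma to_model_H_gens: "span (to_model ` H_gens m) = span (gen_set m)"
proof -
  have "to_model ` H_gens m = gen_val ` gens m"
    unfolding H_gens_def image_image
  proof (rule image_cong[OF HOL.refl])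
    fix x assume "x \<in> gens m"
    then have "[(x, True)] \<in> H_words m"
      by simp
    then show "to_model (H_class m [(x, True)]) = gen_val x"
      by (subst to_model_class) auto
  qed
  also have "gen_val ` gens m = insert twist (letter ` {1..m})"
    by (force simp: gens_def)
  finally show ?thesis
    by (simp add: span_gen_set)
qed

lemma span_generating_set:
  assumes "finite_generating_set (H m) S"
  shows "span (to_model ` S) = span (gen_set m)" "to_model ` carrier (H m) = span (gen_set m)"
  using assms finite_generating_set_H_gens[of m] to_model_H_gens[of m] span_to_model
  unfolding finite_generating_set_def by metis+

section \<open>The two linear bounds\<close>

lemma CL_upper:
  assumes "m \<ge> 1" and S: "finite_generating_set (H m) S"
  shows "\<exists>B. \<forall>n. CL (H m) S n \<le> B * (n + 1)"
proof -
  interpret group "H m" by (rule group_H)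
  have sub: "S \<subseteq> carrier (H m)" and fin: "finite S"
    using S by (auto simp: finite_generating_set_def)
  let ?Z = "to_model ` S"
  note span = span_generating_set[OF S]
  obtain B where B: "conj_bounded (gen_set m) B"
    using conj_bounded_gen_set[OF assms(1)] by blast
  have finY: "finite (gen_set m)"
    by (induction m) auto
  define b where "b = (\<Sum>y\<in>gen_set m. len ?Z y) + (\<Sum>z\<in>?Z. len (gen_set m) z)"
  have "len ?Z y \<le> b" if "y \<in> gen_set m" for y
    using member_le_sum[of y "gen_set m" "len ?Z"] that finY by (simp add: b_def)
  moreover have "len (gen_set m) z \<le> b" if "z \<in> ?Z" for z
    using member_le_sum[of z ?Z "len (gen_set m)"] that fin by (simp add: b_def)
  ultimately have bnd: "conj_bounded ?Z (b * B * (b + 1))"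
    using span(1) by (intro conj_bounded_change_gens[OF B]) auto
  define D where "D = b * B * (b + 1)"
  have "conj_bound (H m) S n (D * (n + 1))" for n
    unfolding conj_bound_def
  proof (intro ballI impI, elim conjE)
    fix u v assume uv: "u \<in> words_on S" "v \<in> words_on S" "length u + length v \<le> n"
      and "conjugate (H m) (word_val (H m) u) (word_val (H m) v)"
    then obtain g where g: "g \<in> carrier (H m)" "word_val (H m) v = inv\<^bsub>H m\<^esub> g \<otimes>\<^bsub>H m\<^esub> word_val (H m) u \<otimes>\<^bsub>H m\<^esub> g"
      by (auto simp: conjugate_def)
    define x y where "x = word_val (H m) u" and "y = word_val (H m) v"
    have c: "x \<in> carrier (H m)" "y \<in> carrier (H m)"
      using word_val_closed[OF sub] uv by (auto simp: x_def y_def)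
    have "to_model y = inverse (to_model g) * to_model x * to_model g"
      using g c by (simp add: x_def[symmetric] y_def[symmetric] to_model_mult to_model_inv)
    then have "to_model x * to_model g = to_model g * to_model y"
      by (simp add: mult.assoc)
    moreover have "to_model x \<in> span ?Z" "to_model y \<in> span ?Z" "to_model g \<in> span ?Z"
      using c g(1) span by auto
    ultimately obtain z where z: "z \<in> span ?Z" "to_model x * z = z * to_model y"
        "len ?Z z \<le> D * (len ?Z (to_model x) + len ?Z (to_model y) + 1)"
      using bnd unfolding conj_bounded_def D_def by blast
    have "len ?Z (to_model x) \<le> length u" "len ?Z (to_model y) \<le> length v"
      using word_length_word_val[OF sub] uv by (auto simp: x_def y_def intro: len_le)
    then have "len ?Z z \<le> D * (n + 1)"
      using uv(3) by (intro le_trans[OF z(3)] mult_le_mono2) simp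
    moreover obtain w where w: "w \<in> words_on S" "length w = len ?Z z" "to_model (word_val (H m) w) = z"
      using word_length_words_on[OF sub word_length_len[OF z(1)]] by blast
    moreover have "x \<otimes>\<^bsub>H m\<^esub> word_val (H m) w = word_val (H m) w \<otimes>\<^bsub>H m\<^esub> y"
      using z(2) c w word_val_closed[OF sub w(1)]
      by (intro to_model_inj[of _ m]) (auto simp: to_model_mult)
    ultimately show "\<exists>w\<in>words_on S. length w \<le> D * (n + 1) \<and>
        word_val (H m) u \<otimes>\<^bsub>H m\<^esub> word_val (H m) w = word_val (H m) w \<otimes>\<^bsub>H m\<^esub> word_val (H m) v"
      unfolding x_def[symmetric] y_def[symmetric] by (intro bexI[of _ w]) auto
  qed
  then have "CL (H m) S n \<le> D * (n + 1)" for n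
    unfolding CL_def by (rule Least_le)
  then show ?thesis by blast
qed

lemma CL_lower:
  assumes "m \<ge> 2" and S: "finite_generating_set (H m) S"
  shows "\<exists>k l. \<forall>n. n \<le> k * CL (H m) S (l * n + l)"
proof -
  interpret group "H m" by (rule group_H)
  have sub: "S \<subseteq> carrier (H m)" and fin: "finite S"
    using S by (auto simp: finite_generating_set_def)
  let ?Z = "to_model ` S"
  note span = span_generating_set[OF S]
  \<comment> \<open>The largest effect of one generator on \<open>sigma\<close> is at most
    \<open>k\<close>; a conjugator with \<open>sigma\<close> equal to \<open>n\<close> therefore has
    \<open>k\<close> times its length at least \<open>n\<close>.\<close>
  define k where "k = (\<Sum>z\<in>?Z. nat \<bar>sigma z\<bar>)"
  have k: "\<bar>sigma z\<bar> \<le> int k" if "z \<in> ?Z" for z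
  proof -
    have "nat \<bar>sigma z\<bar> \<le> k"
      unfolding k_def using that fin by (intro member_le_sum) auto
    then show ?thesis by linarith
  qed
  have a: "letter m \<in> span ?Z" "twist \<in> span ?Z"
    using assms(1) letter_gen_set[of m m] span(1) by auto
  \<comment> \<open>The pair consists of \<open>a_m\<close> and \<open>s^-n a_m s^n\<close>, of
    total length at most twice the length of \<open>a_m\<close> plus \<open>2 * n\<close> times that
    of \<open>s\<close>.\<close>
  define l where "l = 2 * len ?Z (letter m) + 2 * len ?Z twist"
  have "n \<le> k * CL (H m) S (l * n + l)" for n
  proof -
    define t where "t = twist powi int n"
    have t: "t \<in> span ?Z" "len ?Z t \<le> n * len ?Z twist"
      using a len_power[of twist ?Z n] by (auto simp: t_def)
    have "len ?Z (inverse t * letter m * t) \<le> len ?Z t + len ?Z (letter m) + len ?Z t"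
      using len_mult[of "inverse t * letter m" ?Z t] len_mult[of "inverse t" ?Z "letter m"] t(1) a by simp
    then have length: "len ?Z (letter m) + len ?Z (inverse t * letter m * t) \<le> l * n + l"
      using t(2) by (simp add: l_def algebra_simps)
    obtain u where u: "u \<in> words_on S" "length u = len ?Z (letter m)" "to_model (word_val (H m) u) = letter m"
      using word_length_words_on[OF sub word_length_len[OF a(1)]] by blast
    have "inverse t * letter m * t \<in> span ?Z"
      using t a by simp
    then obtain v where v: "v \<in> words_on S" "length v = len ?Z (inverse t * letter m * t)"
        "to_model (word_val (H m) v) = inverse t * letter m * t"
      using word_length_words_on[OF sub word_length_len] by blast
    obtain g where g: "g \<in> carrier (H m)" "t = to_model g"
      using t(1) span by auto
    have c: "word_val (H m) u \<in> carrier (H m)" "word_val (H m) v \<in> carrier (H m)"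
      using word_val_closed[OF sub] u v by auto
    have "word_val (H m) v = inv\<^bsub>H m\<^esub> g \<otimes>\<^bsub>H m\<^esub> word_val (H m) u \<otimes>\<^bsub>H m\<^esub> g"
      using c g u v by (intro to_model_inj[of _ m]) (auto simp: to_model_mult to_model_inv)
    then have "conjugate (H m) (word_val (H m) u) (word_val (H m) v)"
      using g by (auto simp: conjugate_def)
    moreover have "length u + length v \<le> l * n + l"
      using length u v by simp
    ultimately obtain w where w: "w \<in> words_on S" "length w \<le> CL (H m) S (l * n + l)"
        "word_val (H m) u \<otimes>\<^bsub>H m\<^esub> word_val (H m) w = word_val (H m) w \<otimes>\<^bsub>H m\<^esub> word_val (H m) v"
      using conj_bound_CL[OF S, of "l * n + l"] u(1) v(1) unfolding conj_bound_def by blast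
    define h where "h = to_model (word_val (H m) w)"
    have "letter m * h = h * (inverse t * letter m * t)"
      using arg_cong[OF w(3), of to_model] c word_val_closed[OF sub w(1)] u(3) v(3)
      by (simp add: to_model_mult h_def)
    then have "letter m * h = h * (twist powi (- int n) * letter m * twist powi int n)"
      by (simp only: t_def powi_minus)
    moreover have len: "word_length ?Z (length w) h"
      using word_length_word_val[OF sub w(1)] by (simp add: h_def)
    then have hZ: "h \<in> span ?Z"
      by (auto simp: span_def)
    ultimately have "sigma h = int n"
      using sigma_conjugator[OF assms(1)] span(1) by simp
    moreover have "additive_on (span ?Z) sigma"
      by (simp add: additive_on_def)
    then have "\<bar>sigma h\<bar> \<le> int k * int (len ?Z h)"
      using hZ k by (rule additive_on_len)
    ultimately have "n \<le> k * len ?Z h"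
      by (simp flip: of_nat_mult)
    also have "\<dots> \<le> k * CL (H m) S (l * n + l)"
      using len_le[OF len] w(2) by (intro mult_le_mono2) simp
    finally show ?thesis .
  qed
  then show ?thesis by blast
qed

theorem theorem1:
  fixes m :: nat and S :: "gen word set set"
  assumes "m \<ge> 2"
    and "finite_generating_set (H m) S"
  shows "CL (H m) S \<simeq> (\<lambda>n. n)"
proof -
  interpret group "H m" by (rule group_H)
  obtain B where B: "\<And>n. CL (H m) S n \<le> B * (n + 1)"
    using CL_upper[of m S] assms by auto
  have "CL (H m) S n \<le> (B + 1) * ((B + 1) * n + (B + 1)) + (B + 1)" for n
  proof -
    have "B * (n + 1) \<le> (B + 1) * ((B + 1) * n + (B + 1))"
      by (simp add: algebra_simps)
    then show ?thesis
      using B[of n] by linarith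
  qed
  then have "CL (H m) S \<preceq> (\<lambda>n. n)"
    unfolding preceq_def by (intro exI[of _ "B + 1"]) simp
  moreover obtain k l where kl: "\<And>n. n \<le> k * CL (H m) S (l * n + l)"
    using CL_lower[OF assms] by blast
  have mono: "CL (H m) S i \<le> CL (H m) S j" if "i \<le> j" for i j
  proof -
    have "conj_bound (H m) S i (CL (H m) S j)"
      using conj_bound_CL[OF assms(2), of j] that unfolding conj_bound_def by (meson le_trans)
    then show ?thesis
      unfolding CL_def by (rule Least_le)
  qed
  \<comment> \<open>Monotonicity of \<open>CL\<close> lets one constant replace both
    \<open>k\<close> and \<open>l\<close>; the summand 1 makes it positive.\<close>
  define C where "C = k + l + 1"
  have "n \<le> C * CL (H m) S (C * n + C) + C" for n
  proof -
    have "n \<le> k * CL (H m) S (l * n + l)"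
      by (rule kl)
    also have "\<dots> \<le> C * CL (H m) S (C * n + C)"
      by (intro mult_le_mono mono add_mono) (auto simp: C_def)
    finally show ?thesis by simp
  qed
  then have "(\<lambda>n. n) \<preceq> CL (H m) S"
    unfolding preceq_def by (intro exI[of _ C]) (simp add: C_def)
  ultimately show ?thesis
    by (simp add: simeq_def)
qed

end
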